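(* Let $k$ be an algebraically closed field of characteristic $0$. Let $S=k\langle x,y\rangle/(f)$ be a noetherian AS-regular algebra of dimension $2$ with $\gcd(\deg x,\deg y)=1$ and Gorenstein parameter $\ell=\deg x+\deg y$. Let $G=\langle g\rangle\leq\operatorname{HSL}(S)$ be the finite cyclic subgroup generated by $g:x\mapsto\xi x,\ y\mapsto\xi^{-1}y$, where $\xi$ is a primitive $r$-th root of unity and $r=|G|$. Let $Q_{S,G}$ be the quiver such that $(\nabla S)*G\cong kQ_S*G\cong kQ_{S,G}$. Then $Q_{S,G}$ is given as follows. The set of vertices is $\{(i,j)\mid 0\leq i\leq\ell-1,\ 0\leq j\leq r-1\}$, with the second coordinate read in $\mathbb Z/r\mathbb Z$. For any arrow $i\xrightarrow{x}i'$ (so $i'=i+\deg x$) in $Q_S$ and any $j\in\mathbb Z/r\mathbb Z$ there is an arrow $(i,j-1)\to(i',j)$. For any arrow $i\xrightarrow{y}i'$ (so $i'=i+\deg y$) in $Q_S$ and any $j\in\mathbb Z/r\mathbb Z$ there is an arrow $(i,j+1)\to(i',j)$. There are no other arrows.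
   Context: Here $\deg x,\deg y\in\mathbb N^+$ and $f$ is a homogeneous element of the free algebra $k\langle x,y\rangle$. AS-regular: a connected $\mathbb N$-graded algebra $A$ ($A_0=k$) is AS-regular of dimension $d$ and Gorenstein parameter $\ell$ if $\operatorname{gldim}A=d<\infty$ and both $\underline{\operatorname{Ext}}^i_A(k,A)$ and $\underline{\operatorname{Ext}}^i_{A^o}(k,A)$ are $k(\ell)$ for $i=d$ and $0$ for $i\neq d$, where $\underline{\operatorname{Ext}}^i_A(M,N)=\bigoplus_{n\in\mathbb Z}\operatorname{Ext}^i_{\operatorname{GrMod}A}(M,N(n))$, $M(n)_i=M_{n+i}$, $\operatorname{GrMod}A$ is the category of graded right $A$-modules with degree-zero homomorphisms, and $A^o$ is the opposite algebra. Homological determinant: let $A$ be noetherian AS-regular of dimension $d$ and parameter $\ell$, $\underline{H}^i_{\mathfrak m}(M)=\lim_{n\to\infty}\underline{\operatorname{Ext}}^i_A(A/A_{\geq n},M)$ (direct limit), and $DA$ the graded dual of $A$. Then $\underline H^d_{\mathfrak m}(A)\cong DA(\ell)$. A graded algebra automorphism $\sigma$ of $A$ induces a $\sigma$-linear map on $\underline H^d_{\mathfrak m}(A)$ which under this identification equals $c\,D(\sigma^{-1})$ for a constant $c\in k^\times$; put $\operatorname{hdet}\sigma=c^{-1}$. $\operatorname{HSL}(A)$ is the group of graded algebra automorphisms with $\operatorname{hdet}\sigma=1$. Beilinson algebra: $\nabla S=\operatorname{End}_S\big(\bigoplus_{i=0}^{\ell-1}S(i)\big)$ (degree-zero endomorphisms),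 i.e. upper triangular $\ell\times\ell$ matrices $(a_{ij})_{0\le i,j\le\ell-1}$ with $a_{ij}\in S_{j-i}$ and multiplication $(a_{ij})(b_{ij})=\big(\sum_{k}a_{kj}b_{ik}\big)$; $G$ acts entrywise. The quiver $Q_S$: vertices $0,1,\dots,\ell-1$; an arrow $i\xrightarrow{x}i+\deg x$ for each vertex $i$ with $i+\deg x<\ell$, and an arrow $i\xrightarrow{y}i+\deg y$ for each vertex $i$ with $i+\deg y<\ell$. One has $\nabla S\cong kQ_S$ compatibly with the $G$-action, where $g$ fixes the vertices, multiplies each $x$-arrow by $\xi$ and each $y$-arrow by $\xi^{-1}$. $kQ$ is the path algebra. For a finite group $G$ acting on an algebra $B$, $B*G=B\otimes_kkG$ with $(a*g)(b*h)=a\,g(b)*gh$. The algebra $kQ_S*G$ is finite dimensional, basic and hereditary, hence isomorphic to $kQ_{S,G}$ for a quiver $Q_{S,G}$, unique up to isomorphism. *)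

theory Defs
  imports
    "HOL-Algebra.QuotRing"
    "HOL-Algebra.Module"
    "HOL-Algebra.Bij"
    "HOL-Algebra.Generated_Groups"
    "HOL-Computational_Algebra.Polynomial"
    "HOL-Library.Poly_Mapping"
    "HOL-Library.Extended_Nat"
    "Graph_Theory.Digraph_Isomorphism"
    "Graph_Theory.Arc_Walk"
begin

hide_const (open) Multiset.mult Polynomial.smult

section \<open>Algebras and vector spaces over a field\<close>

text \<open>
  The ground field is a type \<open>'k\<close>.  Algebras, vector spaces and modules are records on top of the
  \<open>ring\<close> record of HOL-Algebra; for mere vector spaces and modules the fields \<open>mult\<close> and \<open>one\<close> are
  meaningless and left \<open>undefined\<close>.
\<close>

definition k_algebra :: "('k::field, 'a, 'z) module_scheme \<Rightarrow> bool" where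
  "k_algebra A \<longleftrightarrow> ring A
    \<and> (\<forall>c. \<forall>a\<in>carrier A. c \<odot>\<^bsub>A\<^esub> a \<in> carrier A)
    \<and> (\<forall>c. \<forall>a\<in>carrier A. \<forall>b\<in>carrier A. c \<odot>\<^bsub>A\<^esub> (a \<oplus>\<^bsub>A\<^esub> b) = c \<odot>\<^bsub>A\<^esub> a \<oplus>\<^bsub>A\<^esub> c \<odot>\<^bsub>A\<^esub> b)
    \<and> (\<forall>c d. \<forall>a\<in>carrier A. (c + d) \<odot>\<^bsub>A\<^esub> a = c \<odot>\<^bsub>A\<^esub> a \<oplus>\<^bsub>A\<^esub> d \<odot>\<^bsub>A\<^esub> a)
    \<and> (\<forall>c d. \<forall>a\<in>carrier A. (c * d) \<odot>\<^bsub>A\<^esub> a = c \<odot>\<^bsub>A\<^esub> (d \<odot>\<^bsub>A\<^esub> a))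
    \<and> (\<forall>a\<in>carrier A. 1 \<odot>\<^bsub>A\<^esub> a = a)
    \<and> (\<forall>c. \<forall>a\<in>carrier A. \<forall>b\<in>carrier A.
          c \<odot>\<^bsub>A\<^esub> (a \<otimes>\<^bsub>A\<^esub> b) = (c \<odot>\<^bsub>A\<^esub> a) \<otimes>\<^bsub>A\<^esub> b \<and> c \<odot>\<^bsub>A\<^esub> (a \<otimes>\<^bsub>A\<^esub> b) = a \<otimes>\<^bsub>A\<^esub> (c \<odot>\<^bsub>A\<^esub> b))"

definition algebra_iso :: "('k, 'a, 'y) module_scheme \<Rightarrow> ('k, 'b, 'z) module_scheme \<Rightarrow> bool"
    (infix \<open>\<cong>\<^sub>a\<^sub>l\<^sub>g\<close> 50) where
  "A \<cong>\<^sub>a\<^sub>l\<^sub>g B \<longleftrightarrow> (\<exists>\<phi>\<in>ring_iso A B. \<forall>c. \<forall>a\<in>carrier A. \<phi> (c \<odot>\<^bsub>A\<^esub> a) = c \<odot>\<^bsub>B\<^esub> \<phi> a)"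

definition linear_bij :: "('k, 'v, 'y) module_scheme \<Rightarrow> ('k, 'w, 'z) module_scheme \<Rightarrow> ('v \<Rightarrow> 'w) \<Rightarrow> bool"
  where
  "linear_bij V W \<phi> \<longleftrightarrow> bij_betw \<phi> (carrier V) (carrier W)
    \<and> (\<forall>x\<in>carrier V. \<forall>y\<in>carrier V. \<phi> (x \<oplus>\<^bsub>V\<^esub> y) = \<phi> x \<oplus>\<^bsub>W\<^esub> \<phi> y)
    \<and> (\<forall>c. \<forall>x\<in>carrier V. \<phi> (c \<odot>\<^bsub>V\<^esub> x) = c \<odot>\<^bsub>W\<^esub> \<phi> x)"

definition quotient_space :: "('k, 'v, 'z) module_scheme \<Rightarrow> 'v set \<Rightarrow> ('k, 'v set) module" where
  "quotient_space V W =
    \<lparr>carrier = a_rcosets\<^bsub>V\<^esub> W, mult = undefined, one = undefined, zero = W, add = set_add V,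
     smult = \<lambda>c X. \<Union>x\<in>X. W +>\<^bsub>V\<^esub> (c \<odot>\<^bsub>V\<^esub> x)\<rparr>"

section \<open>Graded algebras and graded right modules\<close>

record ('k, 'a) graded_algebra = "('k, 'a) module" +
  hcomp :: "int \<Rightarrow> 'a set"

text \<open>\<open>internal_grading M V\<close>: the abelian group \<open>M\<close> is the direct sum of its subgroups \<open>V n\<close>.\<close>

definition internal_grading :: "('m, 'z) ring_scheme \<Rightarrow> (int \<Rightarrow> 'm set) \<Rightarrow> bool" where
  "internal_grading M V \<longleftrightarrow> (\<forall>n. additive_subgroup (V n) M)
    \<and> (\<forall>m\<in>carrier M. \<exists>!h :: int \<Rightarrow> 'm. (\<forall>n. h n \<in> V n) \<and> finite {n. h n \<noteq> \<zero>\<^bsub>M\<^esub>}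
          \<and> m = (\<Oplus>\<^bsub>M\<^esub>n\<in>{n. h n \<noteq> \<zero>\<^bsub>M\<^esub>}. h n))"

definition is_graded_algebra :: "('k::field, 'a, 'z) graded_algebra_scheme \<Rightarrow> bool" where
  "is_graded_algebra A \<longleftrightarrow> k_algebra A \<and> internal_grading A (hcomp A)
    \<and> (\<forall>n c. \<forall>a\<in>hcomp A n. c \<odot>\<^bsub>A\<^esub> a \<in> hcomp A n)
    \<and> \<one>\<^bsub>A\<^esub> \<in> hcomp A 0
    \<and> (\<forall>i j. \<forall>a\<in>hcomp A i. \<forall>b\<in>hcomp A j. a \<otimes>\<^bsub>A\<^esub> b \<in> hcomp A (i + j))"

text \<open>Connected \<open>\<nat>\<close>-graded: no negative degrees, and \<open>k \<rightarrow> A\<^sub>0\<close> is bijective.\<close>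

definition connected_graded :: "('k::field, 'a, 'z) graded_algebra_scheme \<Rightarrow> bool" where
  "connected_graded A \<longleftrightarrow> is_graded_algebra A
    \<and> (\<forall>n<0. hcomp A n = {\<zero>\<^bsub>A\<^esub>})
    \<and> bij_betw (\<lambda>c::'k. c \<odot>\<^bsub>A\<^esub> \<one>\<^bsub>A\<^esub>) UNIV (hcomp A 0)"

definition opposite :: "('k, 'a, 'z) graded_algebra_scheme \<Rightarrow> ('k, 'a, 'z) graded_algebra_scheme" where
  "opposite A = A\<lparr>mult := \<lambda>a b. b \<otimes>\<^bsub>A\<^esub> a\<rparr>"

definition quotient_algebra ::
  "('k, 'a, 'z) graded_algebra_scheme \<Rightarrow> 'a set \<Rightarrow> ('k, 'a set) graded_algebra" where
  "quotient_algebra A I =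
    \<lparr>carrier = a_rcosets\<^bsub>A\<^esub> I, mult = rcoset_mult A I, one = I +>\<^bsub>A\<^esub> \<one>\<^bsub>A\<^esub>, zero = I,
     add = set_add A, smult = \<lambda>c X. \<Union>x\<in>X. I +>\<^bsub>A\<^esub> (c \<odot>\<^bsub>A\<^esub> x),
     hcomp = \<lambda>n. (\<lambda>x. I +>\<^bsub>A\<^esub> x) ` hcomp A n\<rparr>"

definition right_ideal :: "('a, 'z) ring_scheme \<Rightarrow> 'a set \<Rightarrow> bool" where
  "right_ideal A I \<longleftrightarrow> additive_subgroup I A \<and> (\<forall>x\<in>I. \<forall>a\<in>carrier A. x \<otimes>\<^bsub>A\<^esub> a \<in> I)"

definition right_noetherian :: "('a, 'z) ring_scheme \<Rightarrow> bool" where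
  "right_noetherian A \<longleftrightarrow> (\<forall>I. right_ideal A I \<longrightarrow>
     (\<exists>F. finite F \<and> F \<subseteq> carrier A \<and> I = \<Inter>{J. right_ideal A J \<and> F \<subseteq> J}))"

definition noetherian :: "('k, 'a, 'z) graded_algebra_scheme \<Rightarrow> bool" where
  "noetherian A \<longleftrightarrow> right_noetherian A \<and> right_noetherian (opposite A)"

record ('a, 'm) graded_module = "'m ring" +
  ract :: "'m \<Rightarrow> 'a \<Rightarrow> 'm"
  mcomp :: "int \<Rightarrow> 'm set"

definition is_graded_module ::
  "('k::field, 'a, 'y) graded_algebra_scheme \<Rightarrow> ('a, 'm, 'z) graded_module_scheme \<Rightarrow> bool" where
  "is_graded_module A M \<longleftrightarrow> abelian_group M \<and> internal_grading M (mcomp M)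
    \<and> (\<forall>m\<in>carrier M. \<forall>a\<in>carrier A. ract M m a \<in> carrier M)
    \<and> (\<forall>m\<in>carrier M. \<forall>n\<in>carrier M. \<forall>a\<in>carrier A.
          ract M (m \<oplus>\<^bsub>M\<^esub> n) a = ract M m a \<oplus>\<^bsub>M\<^esub> ract M n a)
    \<and> (\<forall>m\<in>carrier M. \<forall>a\<in>carrier A. \<forall>b\<in>carrier A.
          ract M m (a \<oplus>\<^bsub>A\<^esub> b) = ract M m a \<oplus>\<^bsub>M\<^esub> ract M m b)
    \<and> (\<forall>m\<in>carrier M. \<forall>a\<in>carrier A. \<forall>b\<in>carrier A.
          ract M m (a \<otimes>\<^bsub>A\<^esub> b) = ract M (ract M m a) b)
    \<and> (\<forall>m\<in>carrier M. ract M m \<one>\<^bsub>A\<^esub> = m)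
    \<and> (\<forall>i j. \<forall>m\<in>mcomp M i. \<forall>a\<in>hcomp A j. ract M m a \<in> mcomp M (i + j))"

text \<open>The \<open>k\<close>-structure of a right \<open>A\<close>-module is the one induced by \<open>k \<rightarrow> A\<close>.\<close>

definition scal ::
  "('k, 'a, 'y) graded_algebra_scheme \<Rightarrow> ('a, 'm, 'z) graded_module_scheme \<Rightarrow> 'k \<Rightarrow> 'm \<Rightarrow> 'm" where
  "scal A M c m = ract M m (c \<odot>\<^bsub>A\<^esub> \<one>\<^bsub>A\<^esub>)"

definition shift :: "int \<Rightarrow> ('a, 'm) graded_module \<Rightarrow> ('a, 'm) graded_module" where
  "shift n M = M\<lparr>mcomp := \<lambda>i. mcomp M (n + i)\<rparr>"

definition degree_part ::
  "('k, 'a, 'y) graded_algebra_scheme \<Rightarrow> ('a, 'm, 'z) graded_module_scheme \<Rightarrow> int \<Rightarrow> ('k, 'm) module"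
  where
  "degree_part A M n = \<lparr>carrier = mcomp M n, mult = undefined, one = undefined, zero = \<zero>\<^bsub>M\<^esub>,
     add = add M, smult = scal A M\<rparr>"

definition regular_module :: "('k, 'a, 'z) graded_algebra_scheme \<Rightarrow> ('a, 'a) graded_module" where
  "regular_module A = \<lparr>carrier = carrier A, mult = undefined, one = undefined, zero = \<zero>\<^bsub>A\<^esub>,
     add = add A, ract = mult A, mcomp = hcomp A\<rparr>"

text \<open>\<open>tail_ideal A n\<close> is \<open>A\<^bsub>\<ge>n\<^esub>\<close>.\<close>

definition tail_ideal :: "('k, 'a, 'z) graded_algebra_scheme \<Rightarrow> nat \<Rightarrow> 'a set" where
  "tail_ideal A n = {\<Oplus>\<^bsub>A\<^esub>i\<in>F. h i | F h. finite F \<and> F \<subseteq> {int n..} \<and> h \<in> (\<Pi> i\<in>F. hcomp A i)}"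

definition truncation :: "('k, 'a, 'z) graded_algebra_scheme \<Rightarrow> nat \<Rightarrow> ('a, 'a set) graded_module" where
  "truncation A n = (let I = tail_ideal A n in
    \<lparr>carrier = a_rcosets\<^bsub>A\<^esub> I, mult = undefined, one = undefined, zero = I, add = set_add A,
     ract = \<lambda>X a. rcoset_mult A I X (I +>\<^bsub>A\<^esub> a), mcomp = \<lambda>p. (\<lambda>x. I +>\<^bsub>A\<^esub> x) ` hcomp A p\<rparr>)"

definition augmentation :: "('k, 'a, 'z) graded_algebra_scheme \<Rightarrow> 'a \<Rightarrow> 'k" where
  "augmentation A a = (THE c. \<exists>b\<in>tail_ideal A 1. a = c \<odot>\<^bsub>A\<^esub> \<one>\<^bsub>A\<^esub> \<oplus>\<^bsub>A\<^esub> b)"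

definition residue_module :: "('k::field, 'a, 'z) graded_algebra_scheme \<Rightarrow> ('a, 'k) graded_module" where
  "residue_module A = \<lparr>carrier = UNIV, mult = undefined, one = undefined, zero = 0, add = (+),
     ract = \<lambda>c a. c * augmentation A a, mcomp = \<lambda>n. if n = 0 then UNIV else {0}\<rparr>"

section \<open>Ext in the category of graded right modules\<close>

text \<open>
  \<open>Ext\<^sup>i(M,N)\<close> in \<open>GrMod A\<close> is the cohomology of \<open>Hom(B\<^sub>\<bullet>,N)\<close> for a projective resolution \<open>B\<^sub>\<bullet>\<close> of
  \<open>M\<close>.  We take the bar resolution \<open>B\<^sub>i = M \<otimes> A\<^sup>\<otimes>\<^sup>i \<otimes> A\<close> (tensor products over the field \<open>k\<close>), which is a
  resolution by graded free modules and is functorial in \<open>M\<close> and \<open>A\<close>.  A degree-zero \<open>A\<close>-linear map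
  \<open>B\<^sub>i \<rightarrow> N\<close> is the same as a \<open>k\<close>-multilinear map \<open>M \<times> A\<^sup>i \<rightarrow> N\<close> that adds up degrees; these maps are the
  \<open>cochains\<close>, and the differential is the one dual to
  \[ (m,a_1,\dots,a_{i+1}) \mapsto (m a_1,a_2,\dots) + \sum_{j=1}^{i} (-1)^j (m,\dots,a_j a_{j+1},\dots)
      + (-1)^{i+1} (m,a_1,\dots,a_i)\, a_{i+1}. \]
  Cochains are set to zero outside their domain, so that equality of cochains is equality of functions.
\<close>

definition tuples :: "('a, 'z) ring_scheme \<Rightarrow> nat \<Rightarrow> 'a list set" where
  "tuples A i = {as. length as = i \<and> set as \<subseteq> carrier A}"

definition is_cochain ::
  "('k, 'a, 'y) graded_algebra_scheme \<Rightarrow> nat \<Rightarrow> ('a, 'm) graded_module \<Rightarrow> ('a, 'n) graded_module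
    \<Rightarrow> ('m \<Rightarrow> 'a list \<Rightarrow> 'n) \<Rightarrow> bool" where
  "is_cochain A i M N c \<longleftrightarrow>
     (\<forall>m as. \<not> (m \<in> carrier M \<and> as \<in> tuples A i) \<longrightarrow> c m as = \<zero>\<^bsub>N\<^esub>)
   \<and> (\<forall>m\<in>carrier M. \<forall>as\<in>tuples A i. c m as \<in> carrier N)
   \<and> (\<forall>m\<in>carrier M. \<forall>m'\<in>carrier M. \<forall>as\<in>tuples A i. c (m \<oplus>\<^bsub>M\<^esub> m') as = c m as \<oplus>\<^bsub>N\<^esub> c m' as)
   \<and> (\<forall>t. \<forall>m\<in>carrier M. \<forall>as\<in>tuples A i. c (scal A M t m) as = scal A N t (c m as))
   \<and> (\<forall>m\<in>carrier M. \<forall>as\<in>tuples A i. \<forall>j<i. \<forall>a\<in>carrier A. \<forall>b\<in>carrier A.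
        c m (as[j := a \<oplus>\<^bsub>A\<^esub> b]) = c m (as[j := a]) \<oplus>\<^bsub>N\<^esub> c m (as[j := b]))
   \<and> (\<forall>t. \<forall>m\<in>carrier M. \<forall>as\<in>tuples A i. \<forall>j<i.
        c m (as[j := t \<odot>\<^bsub>A\<^esub> (as ! j)]) = scal A N t (c m as))
   \<and> (\<forall>p qs m as. m \<in> mcomp M p \<and> length as = i \<and> list_all2 (\<lambda>a q. a \<in> hcomp A q) as qs
        \<longrightarrow> c m as \<in> mcomp N (p + sum_list qs))"

definition cochains ::
  "('k, 'a, 'y) graded_algebra_scheme \<Rightarrow> nat \<Rightarrow> ('a, 'm) graded_module \<Rightarrow> ('a, 'n) graded_module
    \<Rightarrow> ('k, 'm \<Rightarrow> 'a list \<Rightarrow> 'n) module" where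
  "cochains A i M N =
    \<lparr>carrier = {c. is_cochain A i M N c}, mult = undefined, one = undefined,
     zero = \<lambda>m as. \<zero>\<^bsub>N\<^esub>, add = \<lambda>c c' m as. c m as \<oplus>\<^bsub>N\<^esub> c' m as,
     smult = \<lambda>t c m as. scal A N t (c m as)\<rparr>"

definition alt_sign :: "('n, 'z) ring_scheme \<Rightarrow> nat \<Rightarrow> 'n \<Rightarrow> 'n" where
  "alt_sign N j x = (if even j then x else \<ominus>\<^bsub>N\<^esub> x)"

definition merge :: "('a, 'z) ring_scheme \<Rightarrow> nat \<Rightarrow> 'a list \<Rightarrow> 'a list" where
  "merge A j as = take (j - 1) as @ (as ! (j - 1) \<otimes>\<^bsub>A\<^esub> as ! j) # drop (j + 1) as"

definition coboundary ::
  "('k, 'a, 'y) graded_algebra_scheme \<Rightarrow> nat \<Rightarrow> ('a, 'm) graded_module \<Rightarrow> ('a, 'n) graded_module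
    \<Rightarrow> ('m \<Rightarrow> 'a list \<Rightarrow> 'n) \<Rightarrow> 'm \<Rightarrow> 'a list \<Rightarrow> 'n" where
  "coboundary A i M N c = (\<lambda>m as.
     if m \<in> carrier M \<and> as \<in> tuples A (Suc i)
     then c (ract M m (hd as)) (tl as)
          \<oplus>\<^bsub>N\<^esub> (\<Oplus>\<^bsub>N\<^esub>j\<in>{1..i}. alt_sign N j (c m (merge A j as)))
          \<oplus>\<^bsub>N\<^esub> alt_sign N (Suc i) (ract N (c m (butlast as)) (last as))
     else \<zero>\<^bsub>N\<^esub>)"

definition cocycle_set where
  "cocycle_set A i M N =
    {c \<in> carrier (cochains A i M N). coboundary A i M N c = \<zero>\<^bsub>cochains A (Suc i) M N\<^esub>}"

definition coboundary_set where
  "coboundary_set A i M N = (case i of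
      0 \<Rightarrow> {\<zero>\<^bsub>cochains A 0 M N\<^esub>}
    | Suc j \<Rightarrow> coboundary A j M N ` carrier (cochains A j M N))"

definition Ext ::
  "('k, 'a, 'y) graded_algebra_scheme \<Rightarrow> nat \<Rightarrow> ('a, 'm) graded_module \<Rightarrow> ('a, 'n) graded_module
    \<Rightarrow> ('k, ('m \<Rightarrow> 'a list \<Rightarrow> 'n) set) module" where
  "Ext A i M N = quotient_space ((cochains A i M N)\<lparr>carrier := cocycle_set A i M N\<rparr>)
     (coboundary_set A i M N)"

text \<open>The map on \<open>Ext\<^sup>i(-,-) \<rightarrow> Ext\<^sup>i(M',N')\<close> induced by a map \<open>F\<close> of cochains.\<close>

definition ext_map where
  "ext_map A i M' N' F X = (\<Union>c\<in>X. coboundary_set A i M' N' +>\<^bsub>cochains A i M' N'\<^esub> F c)"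

text \<open>
  Global dimension: the supremum of all \<open>i\<close> such that \<open>Ext\<^sup>i(M,N) \<noteq> 0\<close> for some graded modules.  In HOL
  the modules must have their elements in a fixed type.  We use sets of sequences in \<open>A\<close>: this contains
  a copy of every countably generated graded module, as a set of cosets in a quotient of
  \<open>A \<oplus> A \<oplus> \<dots>\<close>; by Auslander's theorem already cyclic modules \<open>M\<close>, and their syzygies for \<open>N\<close>,
  compute the supremum over all modules.
\<close>

definition gldim :: "('k::field, 'a, 'z) graded_algebra_scheme \<Rightarrow> enat" where
  "gldim A = Sup {enat i | i (M :: ('a, (nat \<Rightarrow> 'a) set) graded_module)
                             (N :: ('a, (nat \<Rightarrow> 'a) set) graded_module).
     is_graded_module A M \<and> is_graded_module A N \<and> carrier (Ext A i M N) \<noteq> {\<zero>\<^bsub>Ext A i M N\<^esub>}}"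

section \<open>AS-regular algebras\<close>

text \<open>
  The condition that the graded vector space \<open>\<Oplus>\<^sub>n Ext\<^sup>i(k,A(n))\<close> is \<open>k(\<ell>)\<close> for \<open>i = d\<close> and zero
  otherwise, degree by degree.
\<close>

definition gorenstein_condition :: "('k::field, 'a, 'z) graded_algebra_scheme \<Rightarrow> nat \<Rightarrow> int \<Rightarrow> bool" where
  "gorenstein_condition A d l \<longleftrightarrow> (\<forall>i n.
     let E = Ext A i (residue_module A) (shift n (regular_module A)) in
       if i = d then (\<exists>\<phi>. linear_bij E (degree_part A (shift l (residue_module A)) n) \<phi>)
       else carrier E = {\<zero>\<^bsub>E\<^esub>})"

definition AS_regular :: "('k::field, 'a, 'z) graded_algebra_scheme \<Rightarrow> nat \<Rightarrow> int \<Rightarrow> bool" where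
  "AS_regular A d l \<longleftrightarrow> connected_graded A \<and> gldim A = enat d
     \<and> gorenstein_condition A d l \<and> gorenstein_condition (opposite A) d l"

section \<open>Direct limits and local cohomology\<close>

text \<open>
  The direct limit of vector spaces \<open>V n\<close> along \<open>t n m : V n \<rightarrow> V m\<close> (\<open>n \<le> m\<close>); \<open>dl_class V t n v\<close> is
  the class of \<open>v \<in> V n\<close>.
\<close>

definition dl_class ::
  "(nat \<Rightarrow> ('k, 'v) module) \<Rightarrow> (nat \<Rightarrow> nat \<Rightarrow> 'v \<Rightarrow> 'v) \<Rightarrow> nat \<Rightarrow> 'v \<Rightarrow> (nat \<times> 'v) set" where
  "dl_class V t n v = {(m, w). w \<in> carrier (V m) \<and> (\<exists>N\<ge>max n m. t n N v = t m N w)}"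

definition direct_limit ::
  "(nat \<Rightarrow> ('k, 'v) module) \<Rightarrow> (nat \<Rightarrow> nat \<Rightarrow> 'v \<Rightarrow> 'v) \<Rightarrow> ('k, (nat \<times> 'v) set) module" where
  "direct_limit V t =
    \<lparr>carrier = {dl_class V t n v | n v. v \<in> carrier (V n)}, mult = undefined, one = undefined,
     zero = dl_class V t 0 \<zero>\<^bsub>V 0\<^esub>,
     add = \<lambda>P Q. \<Union>{dl_class V t N (t n N v \<oplus>\<^bsub>V N\<^esub> t m N w) | n v m w N.
                     (n, v) \<in> P \<and> (m, w) \<in> Q \<and> max n m \<le> N},
     smult = \<lambda>c P. \<Union>(n, v)\<in>P. dl_class V t n (c \<odot>\<^bsub>V n\<^esub> v)\<rparr>"

definition direct_limit_map where
  "direct_limit_map W s F P = (\<Union>(n, v)\<in>P. dl_class W s n (F n v))"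

text \<open>
  Local cohomology \<open>H\<^sup>i(M) = lim Ext\<^sup>i(A/A\<^bsub>\<ge>n\<^esub>, M)\<close>; \<open>local_cohomology A i M m\<close> is its degree \<open>m\<close>
  component.  The transition maps come from the projections \<open>A/A\<^bsub>\<ge>n'\<^esub> \<rightarrow> A/A\<^bsub>\<ge>n\<^esub>\<close> for \<open>n \<le> n'\<close>.
\<close>

definition lc_term where
  "lc_term A i M m n = Ext A i (truncation A n) (shift m M)"

definition lc_transition where
  "lc_transition A i M m n n' = ext_map A i (truncation A n') (shift m M)
     (\<lambda>c X as. if X \<in> carrier (truncation A n') then c (\<Union>x\<in>X. tail_ideal A n +>\<^bsub>A\<^esub> x) as else \<zero>\<^bsub>M\<^esub>)"

definition local_cohomology where
  "local_cohomology A i M m = direct_limit (lc_term A i M m) (lc_transition A i M m)"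

text \<open>
  The right \<open>A\<close>-module structure of \<open>H\<^sup>i(M)\<close>: an element \<open>a\<close> of degree \<open>j\<close> maps degree \<open>m\<close> to degree
  \<open>m + j\<close> by precomposing with left multiplication by \<open>a\<close> on \<open>A/A\<^bsub>\<ge>n\<^esub>\<close>.
\<close>

definition lc_ract where
  "lc_ract A i M m j a =
     direct_limit_map (lc_term A i M (m + j)) (lc_transition A i M (m + j))
       (\<lambda>n. ext_map A i (truncation A n) (shift (m + j) M)
          (\<lambda>c X as. if X \<in> carrier (truncation A n)
             then c (rcoset_mult A (tail_ideal A n) (tail_ideal A n +>\<^bsub>A\<^esub> a) X) as else \<zero>\<^bsub>M\<^esub>))"

section \<open>Graded automorphisms and the homological determinant\<close>

definition gr_automorphisms :: "('k, 'a, 'z) graded_algebra_scheme \<Rightarrow> ('a \<Rightarrow> 'a) set" where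
  "gr_automorphisms A = {\<sigma> \<in> Bij (carrier A). \<sigma> \<in> ring_hom A A
     \<and> (\<forall>c. \<forall>a\<in>carrier A. \<sigma> (c \<odot>\<^bsub>A\<^esub> a) = c \<odot>\<^bsub>A\<^esub> \<sigma> a) \<and> (\<forall>n. \<sigma> ` hcomp A n \<subseteq> hcomp A n)}"

definition GrAut :: "('k, 'a, 'z) graded_algebra_scheme \<Rightarrow> ('a \<Rightarrow> 'a) monoid" where
  "GrAut A = BijGroup (carrier A)\<lparr>carrier := gr_automorphisms A\<rparr>"

text \<open>
  The \<open>\<sigma>\<close>-linear map on \<open>H\<^sup>i(A)\<close>, induced on cochains by \<open>c \<mapsto> \<sigma> \<circ> c \<circ> (\<sigma>\<^sup>-\<^sup>1 \<times> \<dots> \<times> \<sigma>\<^sup>-\<^sup>1)\<close>, where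
  \<open>\<sigma>\<^sup>-\<^sup>1\<close> acts on \<open>A/A\<^bsub>\<ge>n\<^esub>\<close> by taking images of cosets.
\<close>

definition lc_automorphism where
  "lc_automorphism A i \<sigma> m =
     direct_limit_map (lc_term A i (regular_module A) m) (lc_transition A i (regular_module A) m)
       (\<lambda>n. ext_map A i (truncation A n) (shift m (regular_module A))
          (\<lambda>c X as. if X \<in> carrier (truncation A n) \<and> as \<in> tuples A i
             then \<sigma> (c (inv_into (carrier A) \<sigma> ` X) (map (inv_into (carrier A) \<sigma>) as))
             else \<zero>\<^bsub>A\<^esub>))"

text \<open>The degree \<open>p\<close> component \<open>Hom\<^sub>k(A\<^bsub>-p\<^esub>,k)\<close> of the graded dual \<open>DA\<close>, with its right action.\<close>

definition graded_dual :: "('k::field, 'a, 'z) graded_algebra_scheme \<Rightarrow> int \<Rightarrow> ('k, 'a \<Rightarrow> 'k) module" where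
  "graded_dual A p =
    \<lparr>carrier = {\<phi> \<in> extensional (hcomp A (- p)).
        (\<forall>a\<in>hcomp A (- p). \<forall>b\<in>hcomp A (- p). \<phi> (a \<oplus>\<^bsub>A\<^esub> b) = \<phi> a + \<phi> b)
      \<and> (\<forall>c. \<forall>a\<in>hcomp A (- p). \<phi> (c \<odot>\<^bsub>A\<^esub> a) = c * \<phi> a)},
     mult = undefined, one = undefined, zero = (\<lambda>a\<in>hcomp A (- p). 0),
     add = \<lambda>\<phi> \<psi>. \<lambda>a\<in>hcomp A (- p). \<phi> a + \<psi> a, smult = \<lambda>c \<phi>. \<lambda>a\<in>hcomp A (- p). c * \<phi> a\<rparr>"

definition dual_ract ::
  "('k::field, 'a, 'z) graded_algebra_scheme \<Rightarrow> int \<Rightarrow> int \<Rightarrow> 'a \<Rightarrow> ('a \<Rightarrow> 'k) \<Rightarrow> 'a \<Rightarrow> 'k" where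
  "dual_ract A p j a \<phi> = (\<lambda>b\<in>hcomp A (- (p + j)). \<phi> (a \<otimes>\<^bsub>A\<^esub> b))"

text \<open>\<open>D(\<sigma>\<^sup>-\<^sup>1)\<close> in degree \<open>p\<close>.\<close>

definition dual_inv_map ::
  "('k::field, 'a, 'z) graded_algebra_scheme \<Rightarrow> ('a \<Rightarrow> 'a) \<Rightarrow> int \<Rightarrow> ('a \<Rightarrow> 'k) \<Rightarrow> 'a \<Rightarrow> 'k" where
  "dual_inv_map A \<sigma> p \<phi> = (\<lambda>b\<in>hcomp A (- p). \<phi> (inv_into (carrier A) \<sigma> b))"

text \<open>An isomorphism of graded right \<open>A\<close>-modules \<open>H\<^sup>d(A) \<rightarrow> DA(\<ell>)\<close>, given by its components.\<close>

definition lc_dual_iso where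
  "lc_dual_iso A d l \<Phi> \<longleftrightarrow>
     (\<forall>m::int. linear_bij (local_cohomology A d (regular_module A) m) (graded_dual A (l + m)) (\<Phi> m))
   \<and> (\<forall>m j. \<forall>a\<in>hcomp A j. \<forall>u\<in>carrier (local_cohomology A d (regular_module A) m).
        \<Phi> (m + j) (lc_ract A d (regular_module A) m j a u) = dual_ract A (l + m) j a (\<Phi> m u))"

definition hdet :: "('k::field, 'a, 'z) graded_algebra_scheme \<Rightarrow> nat \<Rightarrow> int \<Rightarrow> ('a \<Rightarrow> 'a) \<Rightarrow> 'k" where
  "hdet A d l \<sigma> = inverse (THE c. c \<noteq> 0 \<and> (\<exists>\<Phi>. lc_dual_iso A d l \<Phi> \<and>
     (\<forall>m. \<forall>u\<in>carrier (local_cohomology A d (regular_module A) m).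
        \<Phi> m (lc_automorphism A d \<sigma> m u)
          = c \<odot>\<^bsub>graded_dual A (l + m)\<^esub> dual_inv_map A \<sigma> (l + m) (\<Phi> m u))))"

definition HSL :: "('k::field, 'a, 'z) graded_algebra_scheme \<Rightarrow> nat \<Rightarrow> int \<Rightarrow> ('a \<Rightarrow> 'a) set" where
  "HSL A d l = {\<sigma> \<in> gr_automorphisms A. hdet A d l \<sigma> = 1}"

section \<open>Beilinson algebras and skew group algebras\<close>

definition beilinson ::
  "('k, 'a, 'z) graded_algebra_scheme \<Rightarrow> nat \<Rightarrow> ('k, nat \<Rightarrow> nat \<Rightarrow> 'a) module" where
  "beilinson S l =
    \<lparr>carrier = {a. \<forall>i j. if i < l \<and> j < l then a i j \<in> hcomp S (int j - int i) else a i j = \<zero>\<^bsub>S\<^esub>},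
     mult = \<lambda>a b i j. if i < l \<and> j < l then \<Oplus>\<^bsub>S\<^esub>k\<in>{..<l}. a k j \<otimes>\<^bsub>S\<^esub> b i k else \<zero>\<^bsub>S\<^esub>,
     one = \<lambda>i j. if i = j \<and> i < l then \<one>\<^bsub>S\<^esub> else \<zero>\<^bsub>S\<^esub>,
     zero = \<lambda>i j. \<zero>\<^bsub>S\<^esub>, add = \<lambda>a b i j. a i j \<oplus>\<^bsub>S\<^esub> b i j,
     smult = \<lambda>c a i j. c \<odot>\<^bsub>S\<^esub> a i j\<rparr>"

definition entrywise :: "('a \<Rightarrow> 'a) \<Rightarrow> (nat \<Rightarrow> nat \<Rightarrow> 'a) \<Rightarrow> nat \<Rightarrow> nat \<Rightarrow> 'a" where
  "entrywise h a = (\<lambda>i j. h (a i j))"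

text \<open>
  \<open>B * G\<close> for a finite group \<open>G\<close> acting on \<open>B\<close> through \<open>act\<close>: the function \<open>u\<close> stands for
  \<open>\<Sum>\<^sub>p u p * p\<close>.
\<close>

definition skew_group_algebra ::
  "('k, 'b, 'y) module_scheme \<Rightarrow> ('g, 'z) monoid_scheme \<Rightarrow> ('g \<Rightarrow> 'b \<Rightarrow> 'b) \<Rightarrow> ('k, 'g \<Rightarrow> 'b) module" where
  "skew_group_algebra B G act =
    \<lparr>carrier = {u. \<forall>p. if p \<in> carrier G then u p \<in> carrier B else u p = \<zero>\<^bsub>B\<^esub>},
     mult = \<lambda>u v t. if t \<in> carrier G
        then \<Oplus>\<^bsub>B\<^esub>p\<in>carrier G. u p \<otimes>\<^bsub>B\<^esub> act p (v (inv\<^bsub>G\<^esub> p \<otimes>\<^bsub>G\<^esub> t)) else \<zero>\<^bsub>B\<^esub>,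
     one = \<lambda>p. if p = \<one>\<^bsub>G\<^esub> then \<one>\<^bsub>B\<^esub> else \<zero>\<^bsub>B\<^esub>,
     zero = \<lambda>p. \<zero>\<^bsub>B\<^esub>, add = \<lambda>u v p. u p \<oplus>\<^bsub>B\<^esub> v p, smult = \<lambda>c u p. c \<odot>\<^bsub>B\<^esub> u p\<rparr>"

text \<open>The action of the cyclic group generated by \<open>g\<close> in which \<open>g\<close> acts by \<open>\<tau>\<close>.\<close>

definition cyclic_action :: "('g, 'z) monoid_scheme \<Rightarrow> 'g \<Rightarrow> ('b \<Rightarrow> 'b) \<Rightarrow> 'g \<Rightarrow> 'b \<Rightarrow> 'b" where
  "cyclic_action G g \<tau> h = \<tau> ^^ (LEAST n::nat. h = g [^]\<^bsub>G\<^esub> n)"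

section \<open>Path algebras\<close>

text \<open>
  Quivers are the multi-digraphs of Graph-Theory.  A path is a pair of its source and its list of
  arrows in order of traversal.  Products of paths are composed from right to left (\<open>p q\<close> is \<open>q\<close>
  followed by \<open>p\<close>), in accordance with the multiplication of \<open>beilinson\<close>.
\<close>

definition paths :: "('v, 'e) pre_digraph \<Rightarrow> ('v \<times> 'e list) set" where
  "paths Q = {(u, p). \<exists>v. pre_digraph.awalk Q u p v}"

definition path_mult where
  "path_mult Q F H = (\<Sum>(u, p)\<in>Poly_Mapping.keys F. \<Sum>(v, q)\<in>Poly_Mapping.keys H.
     if pre_digraph.awlast Q v q = u
     then Poly_Mapping.single (v, q @ p) (Poly_Mapping.lookup F (u, p) * Poly_Mapping.lookup H (v, q))
     else 0)"

definition path_algebra :: "('v, 'e) pre_digraph \<Rightarrow> ('k::field, ('v \<times> 'e list) \<Rightarrow>\<^sub>0 'k) module" where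
  "path_algebra Q =
    \<lparr>carrier = {F. Poly_Mapping.keys F \<subseteq> paths Q}, mult = path_mult Q,
     one = (\<Sum>v\<in>verts Q. Poly_Mapping.single (v, []) 1), zero = 0, add = (+),
     smult = \<lambda>c. Poly_Mapping.map ((*) c)\<rparr>"

section \<open>The free algebra on two generators and the quivers\<close>

datatype gen = Gx | Gy

datatype gword = Word (letters: "gen list")

instantiation gword :: monoid_add
begin
definition "0 = Word []"
definition "v + w = Word (letters v @ letters w)"
instance by standard (simp_all add: zero_gword_def plus_gword_def)
end

fun gen_deg :: "nat \<Rightarrow> nat \<Rightarrow> gen \<Rightarrow> nat" where
  "gen_deg dx dy Gx = dx"
| "gen_deg dx dy Gy = dy"

text \<open>
  \<open>k\<langle>x,y\<rangle>\<close> is the monoid algebra of the free monoid \<open>gword\<close> (written additively, as required by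
  the multiplication on \<open>\<Rightarrow>\<^sub>0\<close>), graded by \<open>deg x = dx\<close> and \<open>deg y = dy\<close>.
\<close>

definition free_algebra :: "nat \<Rightarrow> nat \<Rightarrow> ('k::field, gword \<Rightarrow>\<^sub>0 'k) graded_algebra" where
  "free_algebra dx dy =
    \<lparr>carrier = UNIV, mult = (*), one = 1, zero = 0, add = (+),
     smult = \<lambda>c. Poly_Mapping.map ((*) c),
     hcomp = \<lambda>n. {F. \<forall>w\<in>Poly_Mapping.keys F. int (\<Sum>s\<leftarrow>letters w. gen_deg dx dy s) = n}\<rparr>"

definition relation_ideal :: "nat \<Rightarrow> nat \<Rightarrow> (gword \<Rightarrow>\<^sub>0 'k::field) \<Rightarrow> (gword \<Rightarrow>\<^sub>0 'k) set" where
  "relation_ideal dx dy f = genideal (free_algebra dx dy) {f}"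

definition one_relator_algebra ::
  "nat \<Rightarrow> nat \<Rightarrow> (gword \<Rightarrow>\<^sub>0 'k::field) \<Rightarrow> ('k, (gword \<Rightarrow>\<^sub>0 'k) set) graded_algebra" where
  "one_relator_algebra dx dy f = quotient_algebra (free_algebra dx dy) (relation_ideal dx dy f)"

definition gen_class :: "nat \<Rightarrow> nat \<Rightarrow> (gword \<Rightarrow>\<^sub>0 'k::field) \<Rightarrow> gen \<Rightarrow> (gword \<Rightarrow>\<^sub>0 'k) set" where
  "gen_class dx dy f s =
     relation_ideal dx dy f +>\<^bsub>(free_algebra dx dy :: ('k, _) graded_algebra)\<^esub> Poly_Mapping.single (Word [s]) 1"

text \<open>The quiver \<open>Q\<^sub>S\<close>: \<open>(i, s)\<close> is the \<open>s\<close>-arrow starting at \<open>i\<close>.\<close>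

definition quiver_S :: "nat \<Rightarrow> nat \<Rightarrow> (nat, nat \<times> gen) pre_digraph" where
  "quiver_S dx dy = \<lparr>verts = {..<dx + dy}, arcs = {(i, s). i + gen_deg dx dy s < dx + dy},
     tail = fst, head = \<lambda>(i, s). i + gen_deg dx dy s\<rparr>"

text \<open>The automorphism of \<open>kQ\<^sub>S\<close> scaling \<open>x\<close>-arrows by \<open>\<xi>\<close> and \<open>y\<close>-arrows by \<open>\<xi>\<^sup>-\<^sup>1\<close>.\<close>

definition arrow_scaling ::
  "'k::field \<Rightarrow> (nat \<times> (nat \<times> gen) list \<Rightarrow>\<^sub>0 'k) \<Rightarrow> nat \<times> (nat \<times> gen) list \<Rightarrow>\<^sub>0 'k" where
  "arrow_scaling \<xi> F = (\<Sum>(u, p)\<in>Poly_Mapping.keys F.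
     Poly_Mapping.single (u, p)
       ((\<Prod>(i, s)\<leftarrow>p. case s of Gx \<Rightarrow> \<xi> | Gy \<Rightarrow> inverse \<xi>) * Poly_Mapping.lookup F (u, p)))"

text \<open>
  The quiver \<open>Q\<^bsub>S,G\<^esub>\<close>, with \<open>\<int>/r\<int>\<close> represented by \<open>{0..<r}\<close>: for an arrow \<open>e : i \<rightarrow> i'\<close> of \<open>Q\<^sub>S\<close>, the
  arrow \<open>(e, j)\<close> is the one ending in \<open>(i', j)\<close>.
\<close>

definition quiver_SG :: "nat \<Rightarrow> nat \<Rightarrow> nat \<Rightarrow> (nat \<times> int, (nat \<times> gen) \<times> int) pre_digraph" where
  "quiver_SG dx dy r =
    \<lparr>verts = {..<dx + dy} \<times> {0..<int r}, arcs = arcs (quiver_S dx dy) \<times> {0..<int r},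
     tail = \<lambda>(e, j). (tail (quiver_S dx dy) e,
                      (case snd e of Gx \<Rightarrow> j - 1 | Gy \<Rightarrow> j + 1) mod int r),
     head = \<lambda>(e, j). (head (quiver_S dx dy) e, j)\<rparr>"

end

theory Submission
  imports Defs "HOL-Library.Function_Algebras"
begin

text \<open>
  If \<open>f\<close> had degree less than \<open>\<ell> = deg x + deg y\<close>, it would be of the form \<open>a x\<^sup>p + b y\<^sup>q\<close>, and there would be a
  nonzero derivation \<open>S \<rightarrow> S\<close> of negative degree (for the trivial left action); this is a nonzero class in
  \<open>Ext\<^sup>1(k,S(m))\<close>, which the Gorenstein condition excludes.  So \<open>S\<close> agrees with the free algebra below degree
  \<open>\<ell>\<close>, where words of degree \<open>j - i\<close> are the paths \<open>i \<rightarrow> j\<close> of \<open>Q\<^sub>S\<close>.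

  The group acts diagonally on paths, and the discrete Fourier transform over \<open>G\<close> turns \<open>kQ\<^sub>S * G\<close> into the path
  algebra of a covering quiver with sheets \<open>\<int>/r\<int>\<close>.

  The quiver is recovered from its path algebra as follows.  If there are no loops, the characters of \<open>kQ\<close> are
  the evaluations \<open>\<chi>\<^sub>v\<close> at the trivial paths, and for \<open>v \<noteq> w\<close> the space of derivations with respect to \<open>\<chi>\<^sub>w\<close> on the
  left and \<open>\<chi>\<^sub>v\<close> on the right has dimension one more than the number of arrows \<open>v \<rightarrow> w\<close> (the inner derivation
  \<open>\<chi>\<^sub>w - \<chi>\<^sub>v\<close> accounts for the one).  Loops are detected by a nonzero derivation for some \<open>\<chi> = \<chi>\<^sub>v\<close> on both sides,
  so it is not necessary to show first that \<open>Q\<close> is acyclic.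
\<close>

section \<open>Path algebras\<close>

text \<open>A 1-cocycle of the bar complex for \<open>k\<close> with values in \<open>S(m)\<close>
  is, up to its scalar argument, a map \<open>D\<close> of degree \<open>m\<close> with
  \<open>D(ab) = e(a) D(b) + D(a) b\<close>, where \<open>e\<close> is the augmentation. On the free
  algebra the values \<open>D(x) = U\<close> and \<open>D(y) = V\<close> are arbitrary, and for
  \<open>f = x f_x + y f_y\<close> the map descends to \<open>S\<close> once
  \<open>U f_x + V f_y\<close> lies in the ideal. A choice with \<open>U = 1\<close> or
  \<open>V = 1\<close> in negative degree is contradictory, since \<open>D = 0\<close> would put 1
  into the ideal. If \<open>f_x = 0\<close>, the pair (1, 0) does it, and symmetrically for
  \<open>f_y = 0\<close>; otherwise counting degrees makes \<open>f_x\<close> or \<open>f_y\<close>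
  a nonzero scalar, and the equation is solved by division. Orientation shapes the comparison of
  words with paths: products of paths are composed from right to left, so a path spells its word
  backwards. For the uniqueness of the quiver an arbitrary finite \<open>Q\<close> is compared with
  the covering quiver. Only the latter is known to have no loops, so characters are classified there
  and carried across the isomorphism.\<close>

lemma lookup_scale [simp]: "Poly_Mapping.lookup (Poly_Mapping.map ((*) c) F) k = c * Poly_Mapping.lookup F k"
  for c :: "'k::field"
  by (simp add: Poly_Mapping.map.rep_eq when_def)

lemma map_scale_add: "Poly_Mapping.map ((*) c) (F + H) = Poly_Mapping.map ((*) c) F + Poly_Mapping.map ((*) c) H"
  for c :: "'k::field"
  by (rule poly_mapping_eqI) (simp add: lookup_add ring_distribs)

lemma map_scale_trivial [simp]:
  fixes F :: "'b \<Rightarrow>\<^sub>0 'k::field"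
  shows "Poly_Mapping.map h (0 :: 'b \<Rightarrow>\<^sub>0 'k) = 0" "Poly_Mapping.map 0 F = 0" "Poly_Mapping.map ((*) 0) F = 0"
    "Poly_Mapping.map (\<lambda>c. c) F = F" "Poly_Mapping.map ((*) 1) F = F"
  by (rule poly_mapping_eqI; simp add: Poly_Mapping.map.rep_eq when_def)+

lemma poly_mapping_eq_sum_singles:
  "F = (\<Sum>k\<in>Poly_Mapping.keys F. Poly_Mapping.single k (Poly_Mapping.lookup F k))"
  by (rule poly_mapping_eqI) (auto simp: lookup_sum lookup_single when_def in_keys_iff)

text \<open>Agreement only has to be inherited by sums, so the codomain needs no addition; this
  covers maps into cosets as well as coefficient functionals.\<close>

lemma additive_eqI_singles:
  fixes T T' :: "('b \<Rightarrow>\<^sub>0 'k::monoid_add) \<Rightarrow> 'c"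
  assumes "T 0 = T' 0"
    and "\<And>F H. T F = T' F \<Longrightarrow> T H = T' H \<Longrightarrow> T (F + H) = T' (F + H)"
    and "\<And>k c. T (Poly_Mapping.single k c) = T' (Poly_Mapping.single k c)"
  shows "T F = T' F"
proof (induction F rule: Poly_Mapping.update_induct)
  case const
  show ?case using assms(1) .
next
  case (update F a b)
  have "Poly_Mapping.update a b F = Poly_Mapping.single a b + F"
    using update(1) by (intro poly_mapping_eqI) (auto simp: lookup_update lookup_add lookup_single when_def in_keys_iff)
  thus ?case using assms(2,3) update by simp
qed

lemma awlast_Nil [simp]: "pre_digraph.awlast Q v [] = v"
  and awlast_Cons [simp]: "pre_digraph.awlast Q v (e # p) = pre_digraph.awlast Q (head Q e) p"
  by (simp_all add: pre_digraph.awalk_verts.simps pre_digraph.awalk_verts_conv)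

lemma Nil_in_paths [simp]: "(v, []) \<in> paths Q \<longleftrightarrow> v \<in> verts Q"
  by (auto simp: paths_def pre_digraph.awalk_def pre_digraph.cas.simps)

lemma Cons_in_paths:
  assumes "wf_digraph Q"
  shows "(v, e # p) \<in> paths Q \<longleftrightarrow> e \<in> arcs Q \<and> v = tail Q e \<and> (head Q e, p) \<in> paths Q"
  using wf_digraph.wellformed[OF assms]
  by (auto simp: paths_def pre_digraph.awalk_def pre_digraph.cas.simps)

lemma append_in_paths:
  assumes "wf_digraph Q"
  shows "(v, q @ p) \<in> paths Q \<longleftrightarrow> (v, q) \<in> paths Q \<and> (pre_digraph.awlast Q v q, p) \<in> paths Q"
proof (induction q arbitrary: v)
  case Nil
  have "(v, p) \<in> paths Q \<Longrightarrow> v \<in> verts Q"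
    by (auto simp: paths_def pre_digraph.awalk_def)
  thus ?case by auto
qed (auto simp: Cons_in_paths[OF assms])

text \<open>\<open>K\<close> is any finite set of pairs that catches the nonzero summands. The
  factorizations of \<open>t\<close> are enumerated by cutting positions, and those outside
  \<open>K\<close> contribute zero.\<close>

lemma sum_over_splits:
  fixes h :: "'a list \<Rightarrow> 'a list \<Rightarrow> 'k::comm_monoid_add"
  assumes "finite K" "\<And>q p. q @ p = t \<Longrightarrow> (q, p) \<notin> K \<Longrightarrow> h q p = 0"
  shows "(\<Sum>(q, p)\<in>K. if q @ p = t then h q p else 0) = (\<Sum>k\<le>length t. h (take k t) (drop k t))"
proof -
  have "(\<Sum>(q, p)\<in>K. if q @ p = t then h q p else 0) = (\<Sum>(q, p)\<in>{x \<in> K. fst x @ snd x = t}. h q p)"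
    using assms(1) by (intro sum.mono_neutral_cong_right) (auto split: if_splits)
  also have "\<dots> = (\<Sum>k\<in>{k. k \<le> length t \<and> (take k t, drop k t) \<in> K}. h (take k t) (drop k t))"
    by (rule sum.reindex_bij_witness[where i = "\<lambda>k. (take k t, drop k t)" and j = "\<lambda>(q, p). length q"]) auto
  also have "\<dots> = (\<Sum>k\<le>length t. h (take k t) (drop k t))"
    using assms(2) by (intro sum.mono_neutral_left) auto
  finally show ?thesis .
qed

text \<open>A path \<open>t\<close> from \<open>v\<close> factors once for each cutting position;
  the part traversed first belongs to the right factor \<open>H\<close>, and its endpoint is the
  source for \<open>F\<close>. This convolution formula replaces the double sum over supports in
  later coefficient computations.\<close>

lemma lookup_path_mult:
  fixes F H :: "('v \<times> 'e list) \<Rightarrow>\<^sub>0 'k::field"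
  shows "Poly_Mapping.lookup (path_mult Q F H) (v, t) = (\<Sum>k\<le>length t.
     Poly_Mapping.lookup F (pre_digraph.awlast Q v (take k t), drop k t) * Poly_Mapping.lookup H (v, take k t))"
proof -
  let ?end = "pre_digraph.awlast Q"
  let ?lk = "Poly_Mapping.lookup"
  \<comment> \<open>Sources are dropped from \<open>K\<close>: the first part starts at
    \<open>v\<close>, and the second starts where the first ends.\<close>
  define K where "K = (snd ` Poly_Mapping.keys H) \<times> (snd ` Poly_Mapping.keys F)"
  have finK: "finite K" by (simp add: K_def)
  have 1: "?lk (path_mult Q F H) (v, t)
     = (\<Sum>x\<in>Poly_Mapping.keys F. \<Sum>y\<in>Poly_Mapping.keys H.
          if ?end (fst y) (snd y) = fst x \<and> fst y = v \<and> snd y @ snd x = t then ?lk F x * ?lk H y else 0)"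
    unfolding path_mult_def lookup_sum case_prod_unfold
    by (intro sum.cong refl) (auto simp: lookup_single when_def lookup_sum)
  have 2: "\<dots> = (\<Sum>(x, y)\<in>Poly_Mapping.keys F \<times> Poly_Mapping.keys H.
          if ?end (fst y) (snd y) = fst x \<and> fst y = v \<and> snd y @ snd x = t then ?lk F x * ?lk H y else 0)"
    by (simp add: sum.cartesian_product)
  have 3: "\<dots> = (\<Sum>(q, p)\<in>K. if q @ p = t then ?lk F (?end v q, p) * ?lk H (v, q) else 0)"
    (is "sum ?f _ = sum ?g _")
  proof -
    let ?S = "{(x, y) \<in> Poly_Mapping.keys F \<times> Poly_Mapping.keys H.
      ?end (fst y) (snd y) = fst x \<and> fst y = v \<and> snd y @ snd x = t}"
    let ?T = "{(q, p) \<in> K. q @ p = t \<and> (?end v q, p) \<in> Poly_Mapping.keys F \<and> (v, q) \<in> Poly_Mapping.keys H}"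
    have "sum ?f (Poly_Mapping.keys F \<times> Poly_Mapping.keys H) = (\<Sum>(x, y)\<in>?S. ?lk F x * ?lk H y)"
      by (rule sum.mono_neutral_cong_right) (auto split: if_splits)
    also have "\<dots> = (\<Sum>(q, p)\<in>?T. ?lk F (?end v q, p) * ?lk H (v, q))"
      by (rule sum.reindex_bij_witness[where i = "\<lambda>(q, p). ((?end v q, p), (v, q))" and j = "\<lambda>(x, y). (snd y, snd x)"])
        (force simp: K_def)+
    also have "\<dots> = sum ?g K"
      by (rule sum.mono_neutral_cong_left) (auto simp: finK in_keys_iff split: if_splits)
    finally show ?thesis .
  qed
  also have "\<dots> = (\<Sum>k\<le>length t. ?lk F (?end v (take k t), drop k t) * ?lk H (v, take k t))"
  proof (rule sum_over_splits[OF finK])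
    fix q p assume "q @ p = t" "(q, p) \<notin> K"
    hence "(v, q) \<notin> Poly_Mapping.keys H \<or> (?end v q, p) \<notin> Poly_Mapping.keys F"
      unfolding K_def by force
    thus "?lk F (?end v q, p) * ?lk H (v, q) = 0" by (auto simp: in_keys_iff)
  qed
  finally show ?thesis using 1 2 by simp
qed

lemma path_algebra_sel [simp]:
  "carrier (path_algebra Q) = {F. Poly_Mapping.keys F \<subseteq> paths Q}"
  "mult (path_algebra Q) = path_mult Q"
  "one (path_algebra Q) = (\<Sum>v\<in>verts Q. Poly_Mapping.single (v, []) 1)"
  "zero (path_algebra Q) = 0" "add (path_algebra Q) = (+)"
  "smult (path_algebra Q) = (\<lambda>c. Poly_Mapping.map ((*) c))"
  by (simp_all add: path_algebra_def)

lemma keys_subset_iff: "Poly_Mapping.keys F \<subseteq> P \<longleftrightarrow> (\<forall>x. x \<notin> P \<longrightarrow> Poly_Mapping.lookup F x = 0)"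
  by (auto simp: in_keys_iff)

lemma lookup_path_one:
  "finite (verts Q) \<Longrightarrow> Poly_Mapping.lookup (one (path_algebra Q :: ('k::field, _) module)) (v, p) = (if v \<in> verts Q \<and> p = [] then 1 else 0)"
  by (auto simp: lookup_sum lookup_single when_def intro!: sum.neutral)

lemma path_algebra_mult_closed:
  fixes F H :: "('v \<times> 'e list) \<Rightarrow>\<^sub>0 'k::field"
  assumes "wf_digraph Q" "F \<in> carrier (path_algebra Q)" "H \<in> carrier (path_algebra Q)"
  shows "path_mult Q F H \<in> carrier (path_algebra Q)"
proof -
  have "Poly_Mapping.lookup (path_mult Q F H) (v, t) = 0" if "(v, t) \<notin> paths Q" for v t
    unfolding lookup_path_mult
  proof (intro sum.neutral ballI)
    fix k
    have "(v, take k t) \<notin> paths Q \<or> (pre_digraph.awlast Q v (take k t), drop k t) \<notin> paths Q"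
      using that append_in_paths[OF assms(1), of v "take k t" "drop k t"] by simp
    thus "Poly_Mapping.lookup F (pre_digraph.awlast Q v (take k t), drop k t) * Poly_Mapping.lookup H (v, take k t) = 0"
      using assms(2,3) by (auto simp: keys_subset_iff)
  qed
  thus ?thesis by (auto simp: keys_subset_iff)
qed

lemma path_algebra_add_closed:
  "F \<in> carrier (path_algebra Q) \<Longrightarrow> H \<in> carrier (path_algebra Q) \<Longrightarrow> F + H \<in> carrier (path_algebra Q)"
  by (auto simp: keys_subset_iff lookup_add)

lemma path_algebra_smult_closed:
  "F \<in> carrier (path_algebra Q) \<Longrightarrow> Poly_Mapping.map ((*) (c::'k::field)) F \<in> carrier (path_algebra Q)"
  by (auto simp: keys_subset_iff)

lemma path_algebra_one_closed:
  "finite (verts Q) \<Longrightarrow> one (path_algebra Q) \<in> carrier (path_algebra Q)"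
  unfolding path_algebra_sel(1) mem_Collect_eq keys_subset_iff
  by (simp add: lookup_path_one[unfolded path_algebra_sel] split_paired_all)

lemma path_algebra_abelian_monoid: "abelian_monoid (path_algebra Q)"
  by (intro abelian_monoidI) (auto simp: path_algebra_add_closed[simplified] add_ac)

lemma path_mult_single:
  "path_mult Q (Poly_Mapping.single (u, p) a) (Poly_Mapping.single (v, q) b)
    = (if pre_digraph.awlast Q v q = u then Poly_Mapping.single (v, q @ p) (a * b) else 0)"
  for a b :: "'k::field"
  by (cases "a = 0"; cases "b = 0") (simp_all add: path_mult_def)

section \<open>Algebra isomorphisms, characters and twisted derivations\<close>

text \<open>Closure is all that inverting an isomorphism and pulling back functionals require, so no
  ring axioms have to be verified for path algebras or skew group algebras.\<close>

definition algebra_closed :: "('k, 'a, 'z) module_scheme \<Rightarrow> bool" where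
  "algebra_closed A \<longleftrightarrow> \<one>\<^bsub>A\<^esub> \<in> carrier A
    \<and> (\<forall>a\<in>carrier A. \<forall>b\<in>carrier A. a \<oplus>\<^bsub>A\<^esub> b \<in> carrier A \<and> a \<otimes>\<^bsub>A\<^esub> b \<in> carrier A)
    \<and> (\<forall>c. \<forall>a\<in>carrier A. c \<odot>\<^bsub>A\<^esub> a \<in> carrier A)"

lemma path_algebra_closed: "fin_digraph Q \<Longrightarrow> algebra_closed (path_algebra Q :: ('k::field, _) module)"
  unfolding algebra_closed_def
  using path_algebra_mult_closed[of Q] path_algebra_add_closed[of _ Q] path_algebra_smult_closed[of _ Q]
    path_algebra_one_closed[of Q] fin_digraph.finite_verts[of Q] fin_digraph.axioms(1)[of Q]
  by (metis path_algebra_sel(2,5,6))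

definition algebra_iso_map ::
  "('k, 'a, 'y) module_scheme \<Rightarrow> ('k, 'b, 'z) module_scheme \<Rightarrow> ('a \<Rightarrow> 'b) \<Rightarrow> bool" where
  "algebra_iso_map A B \<phi> \<longleftrightarrow> bij_betw \<phi> (carrier A) (carrier B) \<and> \<phi> \<one>\<^bsub>A\<^esub> = \<one>\<^bsub>B\<^esub>
    \<and> (\<forall>a\<in>carrier A. \<forall>b\<in>carrier A. \<phi> (a \<oplus>\<^bsub>A\<^esub> b) = \<phi> a \<oplus>\<^bsub>B\<^esub> \<phi> b)
    \<and> (\<forall>a\<in>carrier A. \<forall>b\<in>carrier A. \<phi> (a \<otimes>\<^bsub>A\<^esub> b) = \<phi> a \<otimes>\<^bsub>B\<^esub> \<phi> b)
    \<and> (\<forall>c. \<forall>a\<in>carrier A. \<phi> (c \<odot>\<^bsub>A\<^esub> a) = c \<odot>\<^bsub>B\<^esub> \<phi> a)"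

lemma algebra_iso_iff: "A \<cong>\<^sub>a\<^sub>l\<^sub>g B \<longleftrightarrow> (\<exists>\<phi>. algebra_iso_map A B \<phi>)"
  unfolding algebra_iso_def algebra_iso_map_def ring_iso_def ring_hom_def Bex_def mem_Collect_eq
  by (rule iff_exI) (auto simp: bij_betw_def)

lemma algebra_iso_map_inv:
  assumes "algebra_closed A" "algebra_iso_map A B \<phi>"
  shows "algebra_iso_map B A (inv_into (carrier A) \<phi>)"
proof -
  let ?\<psi> = "inv_into (carrier A) \<phi>"
  have bij: "bij_betw \<phi> (carrier A) (carrier B)" using assms(2) by (simp add: algebra_iso_map_def)
  have in_A: "?\<psi> b \<in> carrier A" and r: "\<phi> (?\<psi> b) = b" if "b \<in> carrier B" for b
    using that bij by (auto simp: bij_betw_def inv_into_into f_inv_into_f)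
  have l: "?\<psi> b = a" if "a \<in> carrier A" "\<phi> a = b" for a b
    using that bij by (auto simp: bij_betw_def inv_into_f_f)
  show ?thesis
    unfolding algebra_iso_map_def
    using assms bij_betw_inv_into[OF bij]
    by (auto simp: algebra_iso_map_def algebra_closed_def in_A r intro!: l)
qed

lemma algebra_iso_sym: "algebra_closed A \<Longrightarrow> A \<cong>\<^sub>a\<^sub>l\<^sub>g B \<Longrightarrow> B \<cong>\<^sub>a\<^sub>l\<^sub>g A"
  unfolding algebra_iso_iff using algebra_iso_map_inv by blast

lemma algebra_iso_trans:
  assumes "A \<cong>\<^sub>a\<^sub>l\<^sub>g B" "B \<cong>\<^sub>a\<^sub>l\<^sub>g C"
  shows "A \<cong>\<^sub>a\<^sub>l\<^sub>g C"
proof -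
  obtain \<phi> \<psi> where "algebra_iso_map A B \<phi>" "algebra_iso_map B C \<psi>"
    using assms by (auto simp: algebra_iso_iff)
  hence "algebra_iso_map A C (\<psi> \<circ> \<phi>)"
    unfolding algebra_iso_map_def
    using bij_betw_trans[of \<phi> "carrier A" "carrier B" \<psi> "carrier C"]
    by (auto dest: bij_betwE)
  thus ?thesis by (auto simp: algebra_iso_iff)
qed

text \<open>Extension by zero outside the carrier makes equality of characters the same as equality
  of functions, on which the bijections between character sets rely.\<close>

definition characters :: "('k::field, 'a, 'z) module_scheme \<Rightarrow> ('a \<Rightarrow> 'k) set" where
  "characters A = {\<chi>. (\<forall>a. a \<notin> carrier A \<longrightarrow> \<chi> a = 0) \<and> \<chi> \<one>\<^bsub>A\<^esub> = 1
    \<and> (\<forall>a\<in>carrier A. \<forall>b\<in>carrier A. \<chi> (a \<oplus>\<^bsub>A\<^esub> b) = \<chi> a + \<chi> b \<and> \<chi> (a \<otimes>\<^bsub>A\<^esub> b) = \<chi> a * \<chi> b)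
    \<and> (\<forall>c. \<forall>a\<in>carrier A. \<chi> (c \<odot>\<^bsub>A\<^esub> a) = c * \<chi> a)}"

text \<open>
  \<open>twisted_derivations A \<chi> \<psi>\<close> modulo inner derivations is \<open>Ext\<^sup>1\<close> between the one-dimensional modules
  given by \<open>\<psi>\<close> and \<open>\<chi>\<close>.
\<close>

definition twisted_derivations ::
  "('k::field, 'a, 'z) module_scheme \<Rightarrow> ('a \<Rightarrow> 'k) \<Rightarrow> ('a \<Rightarrow> 'k) \<Rightarrow> ('a \<Rightarrow> 'k) set" where
  "twisted_derivations A \<chi> \<psi> = {D. (\<forall>a. a \<notin> carrier A \<longrightarrow> D a = 0)
    \<and> (\<forall>a\<in>carrier A. \<forall>b\<in>carrier A. D (a \<oplus>\<^bsub>A\<^esub> b) = D a + D b \<and> D (a \<otimes>\<^bsub>A\<^esub> b) = \<chi> a * D b + D a * \<psi> b)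
    \<and> (\<forall>c. \<forall>a\<in>carrier A. D (c \<odot>\<^bsub>A\<^esub> a) = c * D a)}"

interpretation fun_space: vector_space "\<lambda>(c::'k::field) (f::'x \<Rightarrow> 'k) x. c * f x"
  by unfold_locales (auto simp: fun_eq_iff algebra_simps)

interpretation fun_space_pair: vector_space_pair
  "\<lambda>(c::'k::field) (f::'x \<Rightarrow> 'k) x. c * f x" "\<lambda>(c::'k::field) (f::'y \<Rightarrow> 'k) x. c * f x"
  by unfold_locales

lemma subspace_twisted_derivations: "fun_space.subspace (twisted_derivations A \<chi> \<psi>)"
  by (rule fun_space.subspaceI) (auto simp: twisted_derivations_def algebra_simps)

definition pullback :: "('k, 'a, 'z) module_scheme \<Rightarrow> ('a \<Rightarrow> 'b) \<Rightarrow> ('b \<Rightarrow> 'k::field) \<Rightarrow> 'a \<Rightarrow> 'k" where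
  "pullback A \<phi> f = (\<lambda>a. if a \<in> carrier A then f (\<phi> a) else 0)"

lemma pullback_character:
  assumes "algebra_closed A" "algebra_iso_map A B \<phi>" "\<chi> \<in> characters B"
  shows "pullback A \<phi> \<chi> \<in> characters A"
  using assms unfolding algebra_closed_def algebra_iso_map_def characters_def pullback_def
  by (auto dest: bij_betwE)

lemma pullback_twisted_derivation:
  assumes "algebra_closed A" "algebra_iso_map A B \<phi>" "D \<in> twisted_derivations B \<chi> \<psi>"
  shows "pullback A \<phi> D \<in> twisted_derivations A (pullback A \<phi> \<chi>) (pullback A \<phi> \<psi>)"
  using assms unfolding algebra_closed_def algebra_iso_map_def twisted_derivations_def pullback_def
  by (auto dest: bij_betwE)

lemma pullback_pullback_inv:
  assumes "algebra_iso_map A B \<phi>" "\<And>a. a \<notin> carrier A \<Longrightarrow> f a = 0"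
  shows "pullback A \<phi> (pullback B (inv_into (carrier A) \<phi>) f) = f"
  using assms by (auto simp: pullback_def fun_eq_iff algebra_iso_map_def bij_betw_def inv_into_f_f)

lemma inj_pullback:
  assumes "algebra_iso_map A B \<phi>" "pullback A \<phi> f = pullback A \<phi> h"
    and "\<And>b. b \<notin> carrier B \<Longrightarrow> f b = 0" "\<And>b. b \<notin> carrier B \<Longrightarrow> h b = 0"
  shows "f = h"
proof
  fix b
  show "f b = h b"
  proof (cases "b \<in> carrier B")
    case True
    then obtain a where "a \<in> carrier A" "b = \<phi> a" using assms(1) unfolding algebra_iso_map_def bij_betw_def by blast
    thus ?thesis using fun_cong[OF assms(2), of a] by (simp add: pullback_def)
  qed (simp add: assms)
qed

lemma pullback_bij_characters:
  assumes "algebra_closed A" "algebra_closed B" "algebra_iso_map A B \<phi>"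
  shows "bij_betw (pullback A \<phi>) (characters B) (characters A)"
  unfolding bij_betw_def
proof
  show "inj_on (pullback A \<phi>) (characters B)"
    by (rule inj_onI) (auto intro: inj_pullback[OF assms(3)] simp: characters_def)
  show "pullback A \<phi> ` characters B = characters A"
  proof
    show "pullback A \<phi> ` characters B \<subseteq> characters A" using pullback_character assms by blast
    show "characters A \<subseteq> pullback A \<phi> ` characters B"
    proof
      fix \<chi> assume \<chi>: "\<chi> \<in> characters A"
      hence "pullback A \<phi> (pullback B (inv_into (carrier A) \<phi>) \<chi>) = \<chi>"
        by (intro pullback_pullback_inv assms) (auto simp: characters_def)
      thus "\<chi> \<in> pullback A \<phi> ` characters B"
        using pullback_character[OF assms(2) algebra_iso_map_inv[OF assms(1,3)] \<chi>] by force
    qed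
  qed
qed

lemma pullback_image_twisted_derivations:
  assumes "algebra_closed A" "algebra_closed B" "algebra_iso_map A B \<phi>"
    and "\<chi> \<in> characters B" "\<psi> \<in> characters B"
  shows "pullback A \<phi> ` twisted_derivations B \<chi> \<psi> = twisted_derivations A (pullback A \<phi> \<chi>) (pullback A \<phi> \<psi>)"
proof
  show "pullback A \<phi> ` twisted_derivations B \<chi> \<psi> \<subseteq> twisted_derivations A (pullback A \<phi> \<chi>) (pullback A \<phi> \<psi>)"
    using pullback_twisted_derivation assms by blast
  let ?\<phi>' = "inv_into (carrier A) \<phi>"
  have inv: "pullback B ?\<phi>' (pullback A \<phi> f) = f" if "f \<in> characters B" for f
    using that assms(3) by (auto simp: pullback_def fun_eq_iff characters_def algebra_iso_map_def bij_betw_def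
        inv_into_into f_inv_into_f)
  show "twisted_derivations A (pullback A \<phi> \<chi>) (pullback A \<phi> \<psi>) \<subseteq> pullback A \<phi> ` twisted_derivations B \<chi> \<psi>"
  proof
    fix D assume D: "D \<in> twisted_derivations A (pullback A \<phi> \<chi>) (pullback A \<phi> \<psi>)"
    have "pullback A \<phi> (pullback B ?\<phi>' D) = D"
      using D by (intro pullback_pullback_inv assms) (auto simp: twisted_derivations_def)
    thus "D \<in> pullback A \<phi> ` twisted_derivations B \<chi> \<psi>"
      using pullback_twisted_derivation[OF assms(2) algebra_iso_map_inv[OF assms(1,3)] D] inv assms(4,5) by force
  qed
qed

text \<open>Pullback is linear on all functions but injective only on those vanishing outside the
  carrier of \<open>B\<close>. Injectivity is therefore used on the span of the derivations, which
  is the subspace of derivations itself.\<close>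

lemma dim_twisted_derivations_pullback:
  assumes "algebra_closed A" "algebra_closed B" "algebra_iso_map A B \<phi>"
    and "\<chi> \<in> characters B" "\<psi> \<in> characters B"
  shows "fun_space.dim (twisted_derivations A (pullback A \<phi> \<chi>) (pullback A \<phi> \<psi>))
    = fun_space.dim (twisted_derivations B \<chi> \<psi>)"
proof -
  have lin: "Vector_Spaces.linear (\<lambda>c f x. c * f x) (\<lambda>c f x. c * f x) (pullback A \<phi>)"
    by unfold_locales (auto simp: pullback_def fun_eq_iff algebra_simps)
  have "inj_on (pullback A \<phi>) (twisted_derivations B \<chi> \<psi>)"
    by (rule inj_onI) (auto intro: inj_pullback[OF assms(3)] simp: twisted_derivations_def)
  hence inj: "inj_on (pullback A \<phi>) (fun_space.span (twisted_derivations B \<chi> \<psi>))"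
    by (simp add: fun_space.span_eq_iff[THEN iffD2, OF subspace_twisted_derivations])
  obtain S where S: "S \<subseteq> twisted_derivations B \<chi> \<psi>" "fun_space.independent S"
    "twisted_derivations B \<chi> \<psi> \<subseteq> fun_space.span S" "card S = fun_space.dim (twisted_derivations B \<chi> \<psi>)"
    using fun_space.basis_exists .
  have inj_S: "inj_on (pullback A \<phi>) (fun_space.span S)"
    by (rule inj_on_subset[OF inj fun_space.span_mono[OF S(1)]])
  have "fun_space.dim (pullback A \<phi> ` twisted_derivations B \<chi> \<psi>) = card S"
  proof (rule fun_space.dim_unique)
    show "pullback A \<phi> ` S \<subseteq> pullback A \<phi> ` twisted_derivations B \<chi> \<psi>" using S(1) by blast
    show "pullback A \<phi> ` twisted_derivations B \<chi> \<psi> \<subseteq> fun_space.span (pullback A \<phi> ` S)"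
      using S(3) fun_space_pair.linear_span_image[OF lin, of S] by blast
    show "fun_space.independent (pullback A \<phi> ` S)"
      by (rule fun_space_pair.linear_independent_injective_image[OF lin S(2) inj_S])
    show "card (pullback A \<phi> ` S) = card S"
      using inj_S fun_space.span_superset by (intro card_image) (rule inj_on_subset)
  qed
  thus ?thesis by (simp add: pullback_image_twisted_derivations[OF assms] S(4))
qed

section \<open>Recovering a quiver from its path algebra\<close>

text \<open>At a trivial path this is the character of a vertex, at an arrow a twisted derivation;
  the cutoff follows the convention of \<open>characters\<close> and
  \<open>twisted_derivations\<close>.\<close>

definition path_coeff :: "('v, 'e) pre_digraph \<Rightarrow> 'v \<times> 'e list \<Rightarrow> (('v \<times> 'e list) \<Rightarrow>\<^sub>0 'k::field) \<Rightarrow> 'k" where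
  "path_coeff Q x F = (if F \<in> carrier (path_algebra Q) then Poly_Mapping.lookup F x else 0)"

abbreviation vertex_char :: "('v, 'e) pre_digraph \<Rightarrow> 'v \<Rightarrow> (('v \<times> 'e list) \<Rightarrow>\<^sub>0 'k::field) \<Rightarrow> 'k" where
  "vertex_char Q v \<equiv> path_coeff Q (v, [])"

lemma path_coeff_single:
  "x \<in> paths Q \<Longrightarrow> path_coeff Q y (Poly_Mapping.single x c) = (if x = y then c else 0)"
  by (auto simp: path_coeff_def lookup_single when_def split: if_splits)

lemma vertex_char_character:
  assumes "fin_digraph Q" "v \<in> verts Q"
  shows "vertex_char Q v \<in> characters (path_algebra Q :: ('k::field, _) module)"
proof -
  interpret fin_digraph Q by fact
  show ?thesis
    using path_algebra_closed[OF assms(1), where 'k='k] lookup_path_one[of Q v "[]"] assms(2)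
    by (auto simp: characters_def path_coeff_def algebra_closed_def lookup_add lookup_path_mult)
qed

text \<open>An arrow factors only as itself times a trivial path on one side or the other; these two
  cuts are the two terms of the Leibniz rule.\<close>

lemma arrow_coeff_twisted_derivation:
  assumes "fin_digraph Q" "e \<in> arcs Q"
  shows "path_coeff Q (tail Q e, [e])
    \<in> twisted_derivations (path_algebra Q :: ('k::field, _) module) (vertex_char Q (head Q e)) (vertex_char Q (tail Q e))"
proof -
  interpret fin_digraph Q by fact
  have "{..Suc 0} = {0, 1}" by auto
  thus ?thesis
    using path_algebra_closed[OF assms(1), where 'k='k]
    by (auto simp: twisted_derivations_def path_coeff_def algebra_closed_def lookup_add lookup_path_mult)
qed

lemma additive_zero:
  fixes D :: "(('v \<times> 'e list) \<Rightarrow>\<^sub>0 'k::field) \<Rightarrow> 'k"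
  assumes "D \<in> twisted_derivations (path_algebra Q) \<chi> \<psi>"
  shows "D 0 = 0"
proof -
  have "\<forall>c. \<forall>F\<in>carrier (path_algebra Q). D (Poly_Mapping.map ((*) c) F) = c * D F"
    using assms by (simp add: twisted_derivations_def)
  hence "D (Poly_Mapping.map ((*) 0) 0) = 0 * D 0" by (metis Poly_Mapping.keys_zero empty_subsetI mem_Collect_eq path_algebra_sel(1))
  thus ?thesis by simp
qed

lemma linear_path_expansion:
  fixes D :: "(('v \<times> 'e list) \<Rightarrow>\<^sub>0 'k::field) \<Rightarrow> 'k"
  assumes add: "\<And>F H. F \<in> carrier (path_algebra Q) \<Longrightarrow> H \<in> carrier (path_algebra Q) \<Longrightarrow> D (F + H) = D F + D H"
    and smult: "\<And>c F. F \<in> carrier (path_algebra Q) \<Longrightarrow> D (Poly_Mapping.map ((*) c) F) = c * D F"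
    and F: "F \<in> carrier (path_algebra Q)"
  shows "D F = (\<Sum>x\<in>Poly_Mapping.keys F. Poly_Mapping.lookup F x * D (Poly_Mapping.single x 1))"
proof -
  have D0: "D 0 = 0"
using smult[of 0 0] by simp
  have "D (\<Sum>x\<in>K. Poly_Mapping.single x (Poly_Mapping.lookup F x)) 
    = (\<Sum>x\<in>K. Poly_Mapping.lookup F x * D (Poly_Mapping.single x 1))" if "K \<subseteq> Poly_Mapping.keys F" for K
    using finite_subset[OF that finite_keys] that
  proof (induction K rule: finite_induct)
    case (insert x K)
    have single: "Poly_Mapping.single x (Poly_Mapping.lookup F x)
        = Poly_Mapping.map ((*) (Poly_Mapping.lookup F x)) (Poly_Mapping.single x 1)"
      by (rule poly_mapping_eqI) (simp add: lookup_single when_def)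
    have "D (Poly_Mapping.single x (Poly_Mapping.lookup F x) + (\<Sum>x\<in>K. Poly_Mapping.single x (Poly_Mapping.lookup F x)))
      = D (Poly_Mapping.single x (Poly_Mapping.lookup F x)) + D (\<Sum>x\<in>K. Poly_Mapping.single x (Poly_Mapping.lookup F x))"
      using insert F by (intro add) (auto simp: keys_subset_iff lookup_sum lookup_single when_def intro!: sum.neutral)
    moreover have "D (Poly_Mapping.single x (Poly_Mapping.lookup F x)) = Poly_Mapping.lookup F x * D (Poly_Mapping.single x 1)"
      unfolding single using insert F by (intro smult) auto
    ultimately show ?case using insert by simp
  qed (simp add: D0)
  from this[OF subset_refl] show ?thesis by (simp flip: poly_mapping_eq_sum_singles)
qed

text \<open>The trivial paths are orthogonal idempotents with sum one, so a character is 1 at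
  exactly one of them, say at \<open>v\<close>, and 0 at the others. An arrow absorbs the trivial
  paths at both its ends; without loops these are not both \<open>v\<close>, so the arrow goes to
  zero, and with it every path that begins with it.\<close>

lemma character_path_algebra:
  fixes \<chi> :: "(('v \<times> 'e list) \<Rightarrow>\<^sub>0 'k::field) \<Rightarrow> 'k"
  assumes Q: "fin_digraph Q" "loopfree_digraph Q"
    and \<chi>: "\<chi> \<in> characters (path_algebra Q)"
  shows "\<exists>v\<in>verts Q. \<chi> = vertex_char Q v"
proof -
  interpret fin_digraph Q by fact
  interpret loopfree_digraph Q by fact
  note closed = path_algebra_closed[OF Q(1), where 'k='k]
  let ?s = "\<lambda>x. Poly_Mapping.single x (1::'k)"
  have add: "\<chi> (F + H) = \<chi> F + \<chi> H" and mult: "\<chi> (path_mult Q F H) = \<chi> F * \<chi> H"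
    if "F \<in> carrier (path_algebra Q)" "H \<in> carrier (path_algebra Q)" for F H
    using \<chi> that by (auto simp: characters_def)
  have smult: "\<chi> (Poly_Mapping.map ((*) c) F) = c * \<chi> F" if "F \<in> carrier (path_algebra Q)" for c F
    using \<chi> that by (auto simp: characters_def)
  have single: "?s x \<in> carrier (path_algebra Q)" if "x \<in> paths Q" for x using that by simp
  have mult_single: "\<chi> (if pre_digraph.awlast Q v q = u then ?s (v, q @ p) else 0) = \<chi> (?s (u, p)) * \<chi> (?s (v, q))"
    if "(u, p) \<in> paths Q" "(v, q) \<in> paths Q" for u p v q
    using mult[OF single[OF that(1)] single[OF that(2)]] unfolding path_mult_single mult_1_left .
  have expand: "\<chi> F = (\<Sum>x\<in>Poly_Mapping.keys F. Poly_Mapping.lookup F x * \<chi> (?s x))"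
    if "F \<in> carrier (path_algebra Q)" for F
    by (rule linear_path_expansion[OF _ _ that]) (rule add smult; assumption)+
  have \<chi>0: "\<chi> 0 = 0" using smult[of 0 0] by simp
  have "\<exists>v\<in>verts Q. \<chi> (?s (v, [])) \<noteq> 0"
  proof (rule ccontr)
    assume none: "\<not> ?thesis"
    have one: "one (path_algebra Q) \<in> carrier (path_algebra Q :: ('k, _) module)" using closed by (simp add: algebra_closed_def)
    have keys: "x \<in> fst -` verts Q \<inter> snd -` {[]}"
      if "x \<in> Poly_Mapping.keys (one (path_algebra Q :: ('k, _) module))" for x
      using that lookup_path_one[of Q "fst x" "snd x", where 'k='k] by (auto simp: in_keys_iff split: if_splits)
    have "\<chi> (one (path_algebra Q)) = 0"
      unfolding expand[OF one] using none keys by (intro sum.neutral) (fastforce simp del: path_algebra_sel)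
    thus False using \<chi> by (simp add: characters_def)
  qed
  then obtain v where v: "v \<in> verts Q" "\<chi> (?s (v, [])) \<noteq> 0" by blast
  have v1: "\<chi> (?s (v, [])) = 1" using mult_single[of v "[]" v "[]"] v by simp
  have u0: "\<chi> (?s (u, [])) = 0" if "u \<in> verts Q" "u \<noteq> v" for u
    using mult_single[of u "[]" v "[]"] v that \<chi>0 by auto
  have arrow0: "\<chi> (?s (tail Q e, [e])) = 0" if "e \<in> arcs Q" for e
  proof -
    have p: "(tail Q e, [e]) \<in> paths Q" using that by (simp add: Cons_in_paths[OF wf_digraph])
    have "\<chi> (?s (tail Q e, [e])) = \<chi> (?s (head Q e, [])) * \<chi> (?s (tail Q e, [e]))"
      "\<chi> (?s (tail Q e, [e])) = \<chi> (?s (tail Q e, [e])) * \<chi> (?s (tail Q e, []))"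
      using mult_single[of "head Q e" "[]" "tail Q e" "[e]"] mult_single[of "tail Q e" "[e]" "tail Q e" "[]"] p that
      by (simp_all add: pre_digraph.awalk_verts.simps)
    moreover have "head Q e \<noteq> v \<or> tail Q e \<noteq> v" using no_loops[OF that] by auto
    ultimately show ?thesis using u0[of "head Q e"] u0[of "tail Q e"] that by auto
  qed
  have path0: "\<chi> (?s (u, p)) = 0" if up: "(u, p) \<in> paths Q" "p \<noteq> []" for u p
  proof -
    obtain e p' where p: "p = e # p'" using up(2) by (cases p) auto
    have e: "e \<in> arcs Q" "u = tail Q e" "(head Q e, p') \<in> paths Q"
      using up(1) by (auto simp: p Cons_in_paths[OF wf_digraph])
    hence "(u, [e]) \<in> paths Q" by (simp add: Cons_in_paths[OF wf_digraph])
    from mult_single[OF e(3) this] show ?thesis using arrow0[OF e(1)] by (simp add: p e(2))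
  qed
  have "\<chi> F = vertex_char Q v F" for F
  proof (cases "F \<in> carrier (path_algebra Q)")
    case True
    have val: "\<chi> (?s x) = (if x = (v, []) then 1 else 0)" if "x \<in> paths Q" for x
      using that path0 u0 v1 by (cases x; cases "snd x = []") auto
    have "\<chi> F = (\<Sum>x\<in>Poly_Mapping.keys F. Poly_Mapping.lookup F x * (if x = (v, []) then 1 else 0))"
      unfolding expand[OF True]
    proof (intro sum.cong refl)
      fix x assume "x \<in> Poly_Mapping.keys F"
      hence "x \<in> paths Q" using True by auto
      thus "Poly_Mapping.lookup F x * \<chi> (?s x) = Poly_Mapping.lookup F x * (if x = (v, []) then 1 else 0)"
        by (simp only: val)
    qed
    thus ?thesis using True by (auto simp: path_coeff_def in_keys_iff if_distrib sum.delta cong: if_cong split: if_splits)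
  qed (use \<chi> in \<open>auto simp: path_coeff_def characters_def\<close>)
  thus ?thesis using v(1) by blast
qed

lemma inj_vertex_char: "inj_on (\<lambda>v. vertex_char Q v :: _ \<Rightarrow> 'k::field) (verts Q)"
proof (rule inj_onI)
  fix v w assume *: "v \<in> verts Q" "w \<in> verts Q" "(vertex_char Q v :: _ \<Rightarrow> 'k) = vertex_char Q w"
  from fun_cong[OF *(3), of "Poly_Mapping.single (v, []) 1"] *(1,2) show "v = w"
    by (auto simp: path_coeff_single split: if_splits)
qed

lemma bij_vertex_char:
  assumes "fin_digraph Q" "loopfree_digraph Q"
  shows "bij_betw (vertex_char Q) (verts Q) (characters (path_algebra Q :: ('k::field, _) module))"
  unfolding bij_betw_def
  using inj_vertex_char[of Q] character_path_algebra[OF assms] vertex_char_character[OF assms(1)] by blast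

text \<open>The Leibniz rule is applied to factorizations of the path. Two nontrivial factors are
  both killed by the characters, which excludes length two or more. An arrow absorbs the trivial
  paths at its ends, which forces the ends to be \<open>v\<close> and \<open>w\<close>. At a trivial
  path with value \<open>d\<close>, idempotency gives \<open>d = ([u = w] + [u = v]) d\<close>; if
  both equalities held, this would read \<open>d = 2 d\<close>, so exactly one holds.\<close>

lemma twisted_derivation_path:
  fixes D :: "(('v \<times> 'e list) \<Rightarrow>\<^sub>0 'k::field) \<Rightarrow> 'k"
  assumes Q: "fin_digraph Q"
    and D: "D \<in> twisted_derivations (path_algebra Q) (vertex_char Q w) (vertex_char Q v)"
    and p: "(u, p) \<in> paths Q" "D (Poly_Mapping.single (u, p) 1) \<noteq> 0"
  shows "p = [] \<and> (u = v) \<noteq> (u = w) \<or> (\<exists>e\<in>arcs Q. p = [e] \<and> u = tail Q e \<and> tail Q e = v \<and> head Q e = w)"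
proof -
  interpret fin_digraph Q by fact
  let ?s = "\<lambda>x. Poly_Mapping.single x (1::'k)"
  have mult: "D (path_mult Q F H) = vertex_char Q w F * D H + D F * vertex_char Q v H"
    if "F \<in> carrier (path_algebra Q)" "H \<in> carrier (path_algebra Q)" for F H
    using D that unfolding twisted_derivations_def by auto
  have single: "?s x \<in> carrier (path_algebra Q)" if "x \<in> paths Q" for x using that by simp
  have mult_single: "D (if pre_digraph.awlast Q b q = a then ?s (b, q @ p) else 0)
      = (if (a, p) = (w, []) then D (?s (b, q)) else 0) + (if (b, q) = (v, []) then D (?s (a, p)) else 0)"
    if "(a, p) \<in> paths Q" "(b, q) \<in> paths Q" for a b p q
    using mult[OF single[OF that(1)] single[OF that(2)]] that by (auto simp: path_mult_single path_coeff_single)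
  show ?thesis
  proof (cases p)
    case Nil
    have "(u = v) \<noteq> (u = w)"
    proof
      assume "(u = v) = (u = w)"
      hence "D (?s (u, [])) = 0 \<or> D (?s (u, [])) = D (?s (u, [])) + D (?s (u, []))"
        using p(1) mult_single[of u "[]" u "[]"] by (cases "u = v") (simp_all add: Nil)
      thus False using p(2) unfolding Nil by (auto simp only: add_cancel_right_right)
    qed
    thus ?thesis using Nil by simp
  next
    case (Cons e p')
    have e: "e \<in> arcs Q" "u = tail Q e" "(head Q e, p') \<in> paths Q"
      using p(1) by (auto simp: Cons Cons_in_paths[OF wf_digraph])
    hence e': "(u, [e]) \<in> paths Q" by (simp add: Cons_in_paths[OF wf_digraph])
    have Nil: "p' = []"
    proof (rule ccontr)
      assume "p' \<noteq> []"
      thus False using mult_single[OF e(3) e'] p(2) by (simp add: Cons e(2))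
    qed
    have "u = v"
    proof (rule ccontr)
      assume "u \<noteq> v"
      moreover have "(u, []) \<in> paths Q" using e by simp
      ultimately show False using mult_single[of u "[e]" u "[]"] e' p by (simp add: Cons Nil)
    qed
    moreover have "head Q e = w"
    proof (rule ccontr)
      assume "head Q e \<noteq> w"
      thus False using mult_single[of "head Q e" "[]" u "[e]"] e(1) e' p by (simp add: Cons Nil)
    qed
    ultimately show ?thesis using e by (simp add: Cons Nil)
  qed
qed

text \<open>For distinct \<open>v\<close> and \<open>w\<close> the product of their trivial paths is
  zero, which makes the values there opposite (\<open>vw\<close>). Hence the value at
  \<open>w\<close> and the values at the arrows from \<open>v\<close> to \<open>w\<close> determine
  everything; for \<open>v = w\<close> only loops remain.\<close>

lemma twisted_derivation_eqI:
  fixes D D' :: "(('v \<times> 'e list) \<Rightarrow>\<^sub>0 'k::field) \<Rightarrow> 'k"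
  assumes Q: "fin_digraph Q"
    and D: "D \<in> twisted_derivations (path_algebra Q) (vertex_char Q w) (vertex_char Q v)"
    and D': "D' \<in> twisted_derivations (path_algebra Q) (vertex_char Q w) (vertex_char Q v)"
    and w: "v \<noteq> w \<Longrightarrow> v \<in> verts Q \<and> w \<in> verts Q \<and>
      D (Poly_Mapping.single (w, []) 1) = D' (Poly_Mapping.single (w, []) 1)"
    and e: "\<And>e. e \<in> arcs Q \<Longrightarrow> tail Q e = v \<Longrightarrow> head Q e = w \<Longrightarrow>
      D (Poly_Mapping.single (v, [e]) 1) = D' (Poly_Mapping.single (v, [e]) 1)"
  shows "D = D'"
proof -
  interpret fin_digraph Q by fact
  have out: "D F = D' F" if "F \<notin> carrier (path_algebra Q)" for F
    using that D D' by (auto simp: twisted_derivations_def)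
  have vw: "E (Poly_Mapping.single (v, []) 1) = - E (Poly_Mapping.single (w, []) 1)"
    if "v \<noteq> w" "E \<in> twisted_derivations (path_algebra Q) (vertex_char Q w) (vertex_char Q v)"
    for E :: "(('v \<times> 'e list) \<Rightarrow>\<^sub>0 'k) \<Rightarrow> 'k"
  proof -
    let ?w = "Poly_Mapping.single (w, [] :: 'e list) (1::'k)" and ?v = "Poly_Mapping.single (v, [] :: 'e list) (1::'k)"
    have "?w \<in> carrier (path_algebra Q)" "?v \<in> carrier (path_algebra Q)" using w that(1) by auto
    hence "E (path_mult Q ?w ?v) = vertex_char Q w ?w * E ?v + E ?w * vertex_char Q v ?v"
      using that(2) unfolding twisted_derivations_def by auto
    thus ?thesis using w[OF that(1)] that(1) additive_zero[OF that(2)]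
      by (simp add: path_mult_single path_coeff_single eq_neg_iff_add_eq_0)
  qed
  have single: "D (Poly_Mapping.single x 1) = D' (Poly_Mapping.single x 1)" if "x \<in> paths Q" for x
  proof (rule ccontr)
    obtain u p where x: "x = (u, p)" by (cases x)
    assume neq: "\<not> ?thesis"
    hence "D (Poly_Mapping.single (u, p) 1) \<noteq> 0 \<or> D' (Poly_Mapping.single (u, p) 1) \<noteq> 0" by (auto simp: x)
    hence "p = [] \<and> (u = v) \<noteq> (u = w) \<or> (\<exists>e\<in>arcs Q. p = [e] \<and> u = tail Q e \<and> tail Q e = v \<and> head Q e = w)"
      using twisted_derivation_path[OF Q D] twisted_derivation_path[OF Q D'] that x by blast
    thus False using neq w e vw[OF _ D] vw[OF _ D'] by (auto simp: x)
  qed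
  have "D F = D' F" if F: "F \<in> carrier (path_algebra Q)" for F
  proof -
    have exp: "E F = (\<Sum>x\<in>Poly_Mapping.keys F. Poly_Mapping.lookup F x * E (Poly_Mapping.single x 1))"
      if "E \<in> twisted_derivations (path_algebra Q) (vertex_char Q w) (vertex_char Q v)"
      for E :: "(('v \<times> 'e list) \<Rightarrow>\<^sub>0 'k) \<Rightarrow> 'k"
      by (rule linear_path_expansion[OF _ _ F]) (use that in \<open>auto simp: twisted_derivations_def\<close>)
    show ?thesis
      unfolding exp[OF D] exp[OF D'] using F single by (intro sum.cong refl) auto
  qed
  thus ?thesis using out by blast
qed

lemma twisted_derivations_loop:
  assumes "fin_digraph Q" "v \<in> verts Q"
  shows "twisted_derivations (path_algebra Q :: ('k::field, _) module) (vertex_char Q v) (vertex_char Q v) = {0}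
    \<longleftrightarrow> (\<forall>e\<in>arcs Q. \<not> (tail Q e = v \<and> head Q e = v))"
proof -
  interpret fin_digraph Q by fact
  let ?T = "twisted_derivations (path_algebra Q :: ('k, _) module) (vertex_char Q v) (vertex_char Q v)"
  have zero: "0 \<in> ?T" using fun_space.subspace_0[OF subspace_twisted_derivations] .
  show ?thesis
  proof
    assume T: "?T = {0}"
    show "\<forall>e\<in>arcs Q. \<not> (tail Q e = v \<and> head Q e = v)"
    proof (intro ballI notI)
      fix e assume e: "e \<in> arcs Q" "tail Q e = v \<and> head Q e = v"
      hence "(path_coeff Q (v, [e]) :: _ \<Rightarrow> 'k) = 0"
        using arrow_coeff_twisted_derivation[OF assms(1) e(1), where 'k='k] T by auto
      moreover have "(v, [e]) \<in> paths Q" using e by (auto simp: Cons_in_paths[OF wf_digraph])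
      ultimately show False
        using path_coeff_single[of "(v, [e])" Q "(v, [e])" "1::'k"] by simp
    qed
  next
    assume "\<forall>e\<in>arcs Q. \<not> (tail Q e = v \<and> head Q e = v)"
    thus "?T = {0}" using twisted_derivation_eqI[OF assms(1) _ zero] zero by blast
  qed
qed

text \<open>The basis is the inner derivation \<open>\<delta>\<close> together with the arrow
  coefficients \<open>cf e\<close>. Evaluation at the trivial path of \<open>w\<close> and at the
  arrows is dual to this family, which yields independence and spanning alike.\<close>

lemma dim_twisted_derivations:
  assumes Q: "fin_digraph Q" and vw: "v \<in> verts Q" "w \<in> verts Q" "v \<noteq> w"
  shows "fun_space.dim (twisted_derivations (path_algebra Q :: ('k::field, _) module) (vertex_char Q w) (vertex_char Q v))
    = Suc (card {e \<in> arcs Q. tail Q e = v \<and> head Q e = w})"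
proof -
  interpret fin_digraph Q by fact
  let ?T = "twisted_derivations (path_algebra Q :: ('k, _) module) (vertex_char Q w) (vertex_char Q v)"
  let ?A = "{e \<in> arcs Q. tail Q e = v \<and> head Q e = w}"
  define \<delta> :: "_ \<Rightarrow> 'k" where "\<delta> = vertex_char Q w - vertex_char Q v"
  define cf :: "_ \<Rightarrow> _ \<Rightarrow> 'k" where "cf e = path_coeff Q (v, [e])" for e
  let ?B = "insert \<delta> (cf ` ?A)"
  have e_path: "(v, [e]) \<in> paths Q" if "e \<in> ?A" for e
    using that by (auto simp: Cons_in_paths[OF wf_digraph])
  have cf_e: "cf e (Poly_Mapping.single (v, [e']) 1) = (if e = e' then 1 else 0)" if "e' \<in> ?A" for e e'
    unfolding cf_def path_coeff_single[OF e_path[OF that]] by auto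
  have cf_w: "cf e (Poly_Mapping.single (w, []) 1) = 0" for e
    using vw by (simp add: cf_def path_coeff_single)
  have \<delta>_e: "\<delta> (Poly_Mapping.single (v, [e]) 1) = 0" if "e \<in> ?A" for e
    unfolding \<delta>_def minus_apply path_coeff_single[OF e_path[OF that]] by simp
  have \<delta>_w: "\<delta> (Poly_Mapping.single (w, []) 1) = 1"
    using vw by (simp add: \<delta>_def path_coeff_single)
  have finA: "finite ?A" by simp
  have inj: "inj_on cf ?A"
  proof (rule inj_onI)
    fix e e' assume *: "e \<in> ?A" "e' \<in> ?A" "cf e = cf e'"
    from fun_cong[OF *(3), of "Poly_Mapping.single (v, [e]) 1"] show "e = e'"
      unfolding cf_e[OF *(1)] by (auto split: if_splits)
  qed
  have notin: "\<delta> \<notin> cf ` ?A"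
  proof
    assume "\<delta> \<in> cf ` ?A"
    then obtain e where "\<delta> = cf e" by blast
    thus False using \<delta>_w cf_w[of e] by simp
  qed
  have card: "card ?B = Suc (card ?A)"
    using finA notin card_image[OF inj] by simp
  have sum_B: "(\<Sum>x\<in>?B. f x * x y) = f \<delta> * \<delta> y + (\<Sum>e\<in>?A. f (cf e) * cf e y)" for f :: "_ \<Rightarrow> 'k" and y
    using finA notin sum.reindex[OF inj, of "\<lambda>x. f x * x y"] by (simp add: o_def)
  have indep: "fun_space.independent ?B"
  proof (rule fun_space.independent_if_scalars_zero)
    show "finite ?B" using finA by simp
    fix f :: "_ \<Rightarrow> 'k" and x
    assume f: "(\<Sum>x\<in>?B. (\<lambda>xa. f x * x xa)) = 0" and x: "x \<in> ?B"
    have f: "f \<delta> * \<delta> y + (\<Sum>e\<in>?A. f (cf e) * cf e y) = 0" for y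
    proof -
      have "(\<Sum>x\<in>?B. (\<lambda>xa. f x * x xa)) y = (\<Sum>x\<in>?B. f x * x y)"
        by (induction rule: infinite_finite_induct) auto
      thus ?thesis using f sum_B[of f y] by simp
    qed
    have "f \<delta> = 0" using f[of "Poly_Mapping.single (w, []) 1"] by (simp add: \<delta>_w cf_w)
    moreover have "f (cf e) = 0" if e: "e \<in> ?A" for e
    proof -
      have "(\<Sum>e'\<in>?A. f (cf e') * cf e' (Poly_Mapping.single (v, [e]) 1)) = (\<Sum>e'\<in>?A. if e' = e then f (cf e) else 0)"
        by (intro sum.cong refl) (simp add: cf_e[OF e])
      thus ?thesis using f[of "Poly_Mapping.single (v, [e]) 1"] e by (simp add: \<delta>_e[OF e] sum.delta[OF finA])
    qed
    ultimately show "f x = 0" using x by blast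
  qed
  have cf_T: "cf e \<in> ?T" if "e \<in> ?A" for e
    using arrow_coeff_twisted_derivation[OF Q, of e, where 'k='k] that by (auto simp: cf_def)
  have \<delta>_T: "\<delta> \<in> ?T"
    using vertex_char_character[OF Q vw(1), where 'k='k] vertex_char_character[OF Q vw(2), where 'k='k]
    by (auto simp: \<delta>_def characters_def twisted_derivations_def algebra_simps)
  have "?T \<subseteq> fun_space.span ?B"
  proof
    fix D assume D: "D \<in> ?T"
    let ?D = "\<lambda>x. D (Poly_Mapping.single x 1)"
    define D' where "D' = (\<lambda>F. ?D (w, []) * \<delta> F) + (\<Sum>e\<in>?A. (\<lambda>F. ?D (v, [e]) * cf e F))"
    have span: "D' \<in> fun_space.span ?B"
      unfolding D'_def
      by (intro fun_space.span_add fun_space.span_scale fun_space.span_sum fun_space.span_base) auto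
    have "D' \<in> ?T"
      unfolding D'_def
      by (intro fun_space.subspace_add fun_space.subspace_scale fun_space.subspace_sum
            subspace_twisted_derivations \<delta>_T cf_T)
    moreover have app: "D' y = ?D (w, []) * \<delta> y + (\<Sum>e\<in>?A. ?D (v, [e]) * cf e y)" for y
    proof -
      have "(\<Sum>e\<in>S. (\<lambda>F. ?D (v, [e]) * cf e F)) y = (\<Sum>e\<in>S. ?D (v, [e]) * cf e y)" for S
        by (induction S rule: infinite_finite_induct) auto
      thus ?thesis by (simp add: D'_def)
    qed
    ultimately have "D = D'"
    proof (intro twisted_derivation_eqI[OF Q D])
      fix e assume "e \<in> arcs Q" "tail Q e = v" "head Q e = w"
      hence e: "e \<in> ?A" by simp
      have "(\<Sum>e'\<in>?A. ?D (v, [e']) * cf e' (Poly_Mapping.single (v, [e]) 1)) = (\<Sum>e'\<in>?A. if e' = e then ?D (v, [e]) else 0)"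
        by (intro sum.cong refl) (simp add: cf_e[OF e])
      thus "?D (v, [e]) = D' (Poly_Mapping.single (v, [e]) 1)"
        using e by (simp add: app \<delta>_e[OF e] sum.delta[OF finA])
    qed (use vw in \<open>auto simp: app \<delta>_w cf_w\<close>)
    thus "D \<in> fun_space.span ?B" using span by simp
  qed
  moreover have "?B \<subseteq> ?T" using cf_T \<delta>_T by blast
  ultimately show ?thesis using fun_space.dim_unique[OF _ _ indep card] by blast
qed

text \<open>Characters match the vertices, dimensions of twisted derivations match the numbers of
  parallel arrows, and these two data determine a finite loop-free quiver up to isomorphism.\<close>

theorem path_algebra_determines_quiver:
  fixes Q :: "('v, 'e) pre_digraph" and R :: "('w, 'f) pre_digraph"
  assumes Q: "fin_digraph Q" and R: "fin_digraph R" "loopfree_digraph R"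
    and iso: "(path_algebra Q :: ('k::field, _) module) \<cong>\<^sub>a\<^sub>l\<^sub>g (path_algebra R :: ('k, _) module)"
  shows "digraph_iso Q R"
proof -
  interpret Q: fin_digraph Q by fact
  interpret R: fin_digraph R by fact
  interpret R: loopfree_digraph R by fact
  let ?Q = "path_algebra Q :: ('k, _) module" and ?R = "path_algebra R :: ('k, _) module"
  obtain \<phi> where \<phi>: "algebra_iso_map ?Q ?R \<phi>" using iso by (auto simp: algebra_iso_iff)
  note cl = path_algebra_closed[OF Q, where 'k='k] path_algebra_closed[OF R(1), where 'k='k]
  have bij: "bij_betw (pullback ?Q \<phi>) (characters ?R) (characters ?Q)"
    by (rule pullback_bij_characters[OF cl \<phi>])
  \<comment> \<open>A loop of \<open>Q\<close> gives its vertex character a nonzero twisted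
    derivation. That character corresponds to one of \<open>R\<close>, hence to a vertex of
    \<open>R\<close>, where the absence of loops leaves only zero.\<close>
  have loopfree: "loopfree_digraph Q"
  proof
    fix e assume e: "e \<in> arcs Q"
    show "tail Q e \<noteq> head Q e"
    proof
      assume loop: "tail Q e = head Q e"
      have "vertex_char Q (tail Q e) \<in> characters ?Q" using e by (intro vertex_char_character Q) simp
      then obtain \<chi> where \<chi>: "\<chi> \<in> characters ?R" "pullback ?Q \<phi> \<chi> = vertex_char Q (tail Q e)"
        using bij by (metis (no_types, lifting) bij_betw_imp_surj_on imageE)
      obtain w where w: "w \<in> verts R" "\<chi> = vertex_char R w" using character_path_algebra[OF R \<chi>(1)] by blast
      have "\<forall>e\<in>arcs R. \<not> (tail R e = w \<and> head R e = w)" using R.no_loops by metis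
      hence "twisted_derivations ?R \<chi> \<chi> = {0}"
        unfolding w(2) by (rule twisted_derivations_loop[OF R(1) w(1), THEN iffD2])
      hence "twisted_derivations ?Q (vertex_char Q (tail Q e)) (vertex_char Q (tail Q e)) = {pullback ?Q \<phi> 0}"
        using pullback_image_twisted_derivations[OF cl \<phi> \<chi>(1) \<chi>(1)] unfolding \<chi>(2) by simp
      moreover have "pullback ?Q \<phi> 0 = (0 :: _ \<Rightarrow> 'k)" by (simp add: pullback_def fun_eq_iff)
      ultimately show False
        using twisted_derivations_loop[OF Q, of "tail Q e", where 'k='k] e loop by auto
    qed
  qed
  note bijQ = bij_vertex_char[OF Q loopfree, where 'k='k] and bijR = bij_vertex_char[OF R, where 'k='k]
  define \<tau> where "\<tau> = inv_into (verts R) (vertex_char R :: _ \<Rightarrow> _ \<Rightarrow> 'k)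
    \<circ> inv_into (characters ?R) (pullback ?Q \<phi>) \<circ> vertex_char Q"
  have \<tau>: "bij_betw \<tau> (verts Q) (verts R)"
    unfolding \<tau>_def
    by (intro bij_betw_trans[OF bijQ] bij_betw_trans[OF bij_betw_inv_into[OF bij]] bij_betw_inv_into[OF bijR])
  have pull: "pullback ?Q \<phi> (vertex_char R (\<tau> v)) = vertex_char Q v" if "v \<in> verts Q" for v
  proof -
    have "vertex_char Q v \<in> characters ?Q" using bijQ that by (auto dest: bij_betwE)
    moreover have "inv_into (characters ?R) (pullback ?Q \<phi>) (vertex_char Q v) \<in> characters ?R"
      using bij_betwE[OF bij_betw_inv_into[OF bij]] calculation by blast
    ultimately show ?thesis
      unfolding \<tau>_def o_apply
      by (simp only: bij_betw_inv_into_right[OF bijR] bij_betw_inv_into_right[OF bij])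
  qed
  have card: "card {e \<in> arcs Q. tail Q e = v \<and> head Q e = w} = card {e \<in> arcs R. tail R e = \<tau> v \<and> head R e = \<tau> w}"
    if "v \<in> verts Q" "w \<in> verts Q" for v w
  proof (cases "v = w")
    case True
    hence "{e \<in> arcs Q. tail Q e = v \<and> head Q e = w} = {}" "{e \<in> arcs R. tail R e = \<tau> v \<and> head R e = \<tau> w} = {}"
      by (auto dest: loopfree_digraph.no_loops[OF loopfree] R.no_loops)
    thus ?thesis by (simp only: card.empty)
  next
    case False
    have R_v: "\<tau> v \<in> verts R" "\<tau> w \<in> verts R" "\<tau> v \<noteq> \<tau> w"
      using that False \<tau> by (auto simp: bij_betw_def inj_on_def)
    show ?thesis
      using dim_twisted_derivations_pullback[OF cl \<phi> vertex_char_character[OF R(1) R_v(2)] vertex_char_character[OF R(1) R_v(1)]]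
      unfolding pull[OF that(1)] pull[OF that(2)] dim_twisted_derivations[OF Q that False]
        dim_twisted_derivations[OF R(1) R_v] by simp
  qed
  have arrow_bij: "\<exists>h. bij_betw h {e \<in> arcs Q. tail Q e = v \<and> head Q e = w} {e \<in> arcs R. tail R e = \<tau> v \<and> head R e = \<tau> w}"
    if "v \<in> verts Q" "w \<in> verts Q" for v w
    using card[OF that] by (intro finite_same_card_bij) auto
  \<comment> \<open>No bijection between parallel arrows is canonical; equal cardinality supplies
    one for each pair of vertices.\<close>
  define h where "h v w = (SOME h. bij_betw h {e \<in> arcs Q. tail Q e = v \<and> head Q e = w} {e \<in> arcs R. tail R e = \<tau> v \<and> head R e = \<tau> w})" for v w
  have h: "bij_betw (h v w) {e \<in> arcs Q. tail Q e = v \<and> head Q e = w} {e \<in> arcs R. tail R e = \<tau> v \<and> head R e = \<tau> w}" if "v \<in> verts Q" "w \<in> verts Q" for v w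
    unfolding h_def by (rule someI_ex[OF arrow_bij[OF that]])
  define \<eta> where "\<eta> e = h (tail Q e) (head Q e) e" for e
  have \<eta>: "\<eta> e \<in> arcs R" "tail R (\<eta> e) = \<tau> (tail Q e)" "head R (\<eta> e) = \<tau> (head Q e)" if "e \<in> arcs Q" for e
  proof -
    have "\<eta> e \<in> {a \<in> arcs R. tail R a = \<tau> (tail Q e) \<and> head R a = \<tau> (head Q e)}"
      unfolding \<eta>_def using that by (intro bij_betw_apply[OF h]) simp_all
    thus "\<eta> e \<in> arcs R" "tail R (\<eta> e) = \<tau> (tail Q e)" "head R (\<eta> e) = \<tau> (head Q e)" by simp_all
  qed
  have inj_\<tau>: "inj_on \<tau> (verts Q)" using \<tau> by (simp add: bij_betw_def)
  have "inj_on \<eta> (arcs Q)"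
  proof (rule inj_onI)
    fix e e' assume e: "e \<in> arcs Q" "e' \<in> arcs Q" "\<eta> e = \<eta> e'"
    hence eq: "tail Q e = tail Q e'" "head Q e = head Q e'"
      using \<eta>[OF e(1)] \<eta>[OF e(2)] inj_onD[OF inj_\<tau>] by auto
    have "inj_on (h (tail Q e') (head Q e')) {a \<in> arcs Q. tail Q a = tail Q e' \<and> head Q a = head Q e'}"
      using e by (intro bij_betw_imp_inj_on[OF h]) simp_all
    thus "e = e'" by (rule inj_onD) (use e eq in \<open>simp_all add: \<eta>_def\<close>)
  qed
  moreover have "\<eta> ` arcs Q = arcs R"
  proof
    show "\<eta> ` arcs Q \<subseteq> arcs R" using \<eta> by blast
    show "arcs R \<subseteq> \<eta> ` arcs Q"
    proof
      fix a assume a: "a \<in> arcs R"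
      obtain v w where vw: "v \<in> verts Q" "w \<in> verts Q" "tail R a = \<tau> v" "head R a = \<tau> w"
        using a R.wellformed[OF a] bij_betw_imp_surj_on[OF \<tau>] by (metis imageE)
      then obtain e where "e \<in> arcs Q" "tail Q e = v" "head Q e = w" "h v w e = a"
        using bij_betw_imp_surj_on[OF h[OF vw(1,2)]] a by force
      thus "a \<in> \<eta> ` arcs Q" by (auto simp: \<eta>_def)
    qed
  qed
  ultimately show ?thesis
    using \<tau> \<eta> inj_\<tau> Q.wf_digraph unfolding digraph_iso_def pre_digraph.digraph_isomorphism_def
    by (intro exI[of _ "\<lparr>iso_verts = \<tau>, iso_arcs = \<eta>, iso_head = head R, iso_tail = tail R\<rparr>"])
      (auto simp: app_iso_def bij_betw_def)
qed

section \<open>Skew group algebras\<close>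

lemma skew_group_algebra_closed:
  assumes B: "algebra_closed B" "abelian_monoid B" "\<And>c. c \<odot>\<^bsub>B\<^esub> \<zero>\<^bsub>B\<^esub> = \<zero>\<^bsub>B\<^esub>" and G: "group G"
    and act: "\<And>p b. p \<in> carrier G \<Longrightarrow> b \<in> carrier B \<Longrightarrow> act p b \<in> carrier B"
  shows "algebra_closed (skew_group_algebra B G act)"
proof -
  interpret B: abelian_monoid B by fact
  interpret G: group G by fact
  show ?thesis
    using B(1) unfolding algebra_closed_def skew_group_algebra_def
    by (auto intro!: B.finsum_closed simp: Pi_iff act B(3))
qed

lemma hom_finsum:
  assumes B: "abelian_monoid B" and B': "abelian_monoid B'"
    and \<phi>: "\<phi> \<zero>\<^bsub>B\<^esub> = \<zero>\<^bsub>B'\<^esub>" "\<And>a. a \<in> carrier B \<Longrightarrow> \<phi> a \<in> carrier B'"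
      "\<And>a b. a \<in> carrier B \<Longrightarrow> b \<in> carrier B \<Longrightarrow> \<phi> (a \<oplus>\<^bsub>B\<^esub> b) = \<phi> a \<oplus>\<^bsub>B'\<^esub> \<phi> b"
    and f: "finite I" "f \<in> I \<rightarrow> carrier B"
  shows "\<phi> (finsum B f I) = finsum B' (\<lambda>i. \<phi> (f i)) I"
proof -
  interpret B: abelian_monoid B by fact
  interpret B': abelian_monoid B' by fact
  show ?thesis
    using f
  proof (induction I rule: finite_induct)
    case (insert i I)
    thus ?case using \<phi> by (subst B.finsum_insert B'.finsum_insert; auto)+
  qed (simp add: \<phi>)
qed

text \<open>The equivariant isomorphism is applied to each coefficient. Closure is required of the
  source \<open>B\<close> only; what is needed in \<open>B'\<close> is transported along
  \<open>\<phi>\<close>.\<close>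

lemma skew_group_algebra_iso:
  assumes B: "abelian_monoid B" "algebra_closed B" "\<And>c. c \<odot>\<^bsub>B\<^esub> \<zero>\<^bsub>B\<^esub> = \<zero>\<^bsub>B\<^esub>" and B': "abelian_monoid B'" and G: "group G" "finite (carrier G)"
    and \<phi>: "algebra_iso_map B B' \<phi>" "\<phi> \<zero>\<^bsub>B\<^esub> = \<zero>\<^bsub>B'\<^esub>"
    and act: "\<And>p b. p \<in> carrier G \<Longrightarrow> b \<in> carrier B \<Longrightarrow> act p b \<in> carrier B"
    and equiv: "\<And>p b. p \<in> carrier G \<Longrightarrow> b \<in> carrier B \<Longrightarrow> \<phi> (act p b) = act' p (\<phi> b)"
  shows "skew_group_algebra B G act \<cong>\<^sub>a\<^sub>l\<^sub>g skew_group_algebra B' G act'"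
proof -
  interpret B: abelian_monoid B by fact
  interpret B': abelian_monoid B' by fact
  interpret G: group G by fact
  let ?S = "skew_group_algebra B G act" and ?S' = "skew_group_algebra B' G act'"
  define \<Phi> where "\<Phi> u = (\<lambda>p. if p \<in> carrier G then \<phi> (u p) else \<zero>\<^bsub>B'\<^esub>)" for u
  have bij: "bij_betw \<phi> (carrier B) (carrier B')" using \<phi>(1) by (simp add: algebra_iso_map_def)
  have \<phi>_in: "\<phi> b \<in> carrier B'" if "b \<in> carrier B" for b using bij that by (auto dest: bij_betwE)
  have \<phi>_add: "\<phi> (a \<oplus>\<^bsub>B\<^esub> b) = \<phi> a \<oplus>\<^bsub>B'\<^esub> \<phi> b" and \<phi>_mult: "\<phi> (a \<otimes>\<^bsub>B\<^esub> b) = \<phi> a \<otimes>\<^bsub>B'\<^esub> \<phi> b"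
    if "a \<in> carrier B" "b \<in> carrier B" for a b
    using \<phi>(1) that by (auto simp: algebra_iso_map_def)
  have S: "carrier ?S = {u. (\<forall>p\<in>carrier G. u p \<in> carrier B) \<and> (\<forall>p. p \<notin> carrier G \<longrightarrow> u p = \<zero>\<^bsub>B\<^esub>)}"
    and S': "carrier ?S' = {u. (\<forall>p\<in>carrier G. u p \<in> carrier B') \<and> (\<forall>p. p \<notin> carrier G \<longrightarrow> u p = \<zero>\<^bsub>B'\<^esub>)}"
    by (auto simp: skew_group_algebra_def)
  have "bij_betw \<Phi> (carrier ?S) (carrier ?S')"
  proof (rule bij_betwI[where g = "\<lambda>u p. if p \<in> carrier G then inv_into (carrier B) \<phi> (u p) else \<zero>\<^bsub>B\<^esub>"])
    show "\<Phi> \<in> carrier ?S \<rightarrow> carrier ?S'"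
      unfolding S S' by (auto simp: \<Phi>_def \<phi>_in)
    show "(\<lambda>u p. if p \<in> carrier G then inv_into (carrier B) \<phi> (u p) else \<zero>\<^bsub>B\<^esub>) \<in> carrier ?S' \<rightarrow> carrier ?S"
      unfolding S S' using bij by (auto simp: bij_betw_def intro!: inv_into_into)
    fix u assume "u \<in> carrier ?S"
    thus "(\<lambda>p. if p \<in> carrier G then inv_into (carrier B) \<phi> (\<Phi> u p) else \<zero>\<^bsub>B\<^esub>) = u"
      unfolding S using bij by (auto simp: \<Phi>_def fun_eq_iff bij_betw_inv_into_left)
  next
    fix u assume "u \<in> carrier ?S'"
    thus "\<Phi> (\<lambda>p. if p \<in> carrier G then inv_into (carrier B) \<phi> (u p) else \<zero>\<^bsub>B\<^esub>) = u"
      unfolding S' using bij by (auto simp: \<Phi>_def fun_eq_iff bij_betw_inv_into_right)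
  qed
  moreover have "\<Phi> \<one>\<^bsub>?S\<^esub> = \<one>\<^bsub>?S'\<^esub>"
    using \<phi> by (auto simp: skew_group_algebra_def \<Phi>_def fun_eq_iff algebra_iso_map_def)
  moreover have "\<Phi> (u \<oplus>\<^bsub>?S\<^esub> v) = \<Phi> u \<oplus>\<^bsub>?S'\<^esub> \<Phi> v" if "u \<in> carrier ?S" "v \<in> carrier ?S" for u v
    using that unfolding S by (auto simp: skew_group_algebra_def \<Phi>_def fun_eq_iff \<phi>_add)
  moreover have smult0: "c \<odot>\<^bsub>B'\<^esub> \<zero>\<^bsub>B'\<^esub> = \<zero>\<^bsub>B'\<^esub>" for c
    using \<phi> B(3)[of c] by (metis B.zero_closed algebra_iso_map_def)
  moreover have "\<Phi> (c \<odot>\<^bsub>?S\<^esub> u) = c \<odot>\<^bsub>?S'\<^esub> \<Phi> u" if "u \<in> carrier ?S" for c u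
    using that \<phi> B(2) unfolding S
    by (auto simp: skew_group_algebra_def \<Phi>_def fun_eq_iff algebra_iso_map_def algebra_closed_def smult0)
  moreover have "\<Phi> (u \<otimes>\<^bsub>?S\<^esub> v) = \<Phi> u \<otimes>\<^bsub>?S'\<^esub> \<Phi> v" if u: "u \<in> carrier ?S" and v: "v \<in> carrier ?S" for u v
  proof
    fix t
    show "\<Phi> (u \<otimes>\<^bsub>?S\<^esub> v) t = (\<Phi> u \<otimes>\<^bsub>?S'\<^esub> \<Phi> v) t"
    proof (cases "t \<in> carrier G")
      case True
      have cl: "act p (v (inv\<^bsub>G\<^esub> p \<otimes>\<^bsub>G\<^esub> t)) \<in> carrier B" "u p \<in> carrier B" "v (inv\<^bsub>G\<^esub> p \<otimes>\<^bsub>G\<^esub> t) \<in> carrier B"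
        if "p \<in> carrier G" for p
        using that True u v unfolding S by (auto intro!: act)
      hence cl': "u p \<otimes>\<^bsub>B\<^esub> act p (v (inv\<^bsub>G\<^esub> p \<otimes>\<^bsub>G\<^esub> t)) \<in> carrier B" if "p \<in> carrier G" for p
        using that B(2) by (simp add: algebra_closed_def)
      have "\<phi> (\<Oplus>\<^bsub>B\<^esub>p\<in>carrier G. u p \<otimes>\<^bsub>B\<^esub> act p (v (inv\<^bsub>G\<^esub> p \<otimes>\<^bsub>G\<^esub> t)))
        = (\<Oplus>\<^bsub>B'\<^esub>p\<in>carrier G. \<phi> (u p \<otimes>\<^bsub>B\<^esub> act p (v (inv\<^bsub>G\<^esub> p \<otimes>\<^bsub>G\<^esub> t))))"
        using cl' by (intro hom_finsum B(1) B' \<phi>(2) \<phi>_in \<phi>_add G(2)) auto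
      also have "\<dots> = (\<Oplus>\<^bsub>B'\<^esub>p\<in>carrier G. \<phi> (u p) \<otimes>\<^bsub>B'\<^esub> act' p (\<phi> (v (inv\<^bsub>G\<^esub> p \<otimes>\<^bsub>G\<^esub> t))))"
        using cl cl' by (intro B'.finsum_cong') (auto simp: \<phi>_mult[symmetric] equiv[symmetric] intro!: \<phi>_in)
      also have "\<dots> = (\<Oplus>\<^bsub>B'\<^esub>p\<in>carrier G. \<Phi> u p \<otimes>\<^bsub>B'\<^esub> act' p (\<Phi> v (inv\<^bsub>G\<^esub> p \<otimes>\<^bsub>G\<^esub> t)))"
        using cl cl' True by (intro B'.finsum_cong') (auto simp: \<Phi>_def \<phi>_mult[symmetric] equiv[symmetric] intro!: \<phi>_in)
      finally show ?thesis using True by (simp add: skew_group_algebra_def \<Phi>_def)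
    qed (simp add: \<Phi>_def skew_group_algebra_def)
  qed
  ultimately have "algebra_iso_map ?S ?S' \<Phi>" by (simp add: algebra_iso_map_def)
  thus ?thesis by (auto simp: algebra_iso_iff)
qed

lemma finsum_path_algebra:
  "finite I \<Longrightarrow> f \<in> I \<rightarrow> carrier (path_algebra Q) \<Longrightarrow> finsum (path_algebra Q) f I = sum f I"
proof (induction I rule: finite_induct)
  interpret abelian_monoid "path_algebra Q" by (rule path_algebra_abelian_monoid)
  case (insert i I)
  thus ?case by (subst finsum_insert) auto
qed (simp add: abelian_monoid.finsum_empty[OF path_algebra_abelian_monoid])

section \<open>Covering quivers\<close>

definition primitive_root :: "'k::field \<Rightarrow> nat \<Rightarrow> bool" where
  "primitive_root \<xi> r \<longleftrightarrow> 0 < r \<and> \<xi> ^ r = 1 \<and> (\<forall>m. 0 < m \<and> m < r \<longrightarrow> \<xi> ^ m \<noteq> 1)"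

lemma primitive_root_nonzero: "primitive_root \<xi> r \<Longrightarrow> \<xi> \<noteq> 0"
  by (auto simp: primitive_root_def power_0_left)

lemma primitive_root_powi_mod:
  assumes "primitive_root \<xi> r"
  shows "\<xi> powi (a mod int r) = \<xi> powi a"
proof -
  have "\<xi> powi a = \<xi> powi (int r * (a div int r) + a mod int r)" by simp
  also have "\<dots> = \<xi> powi (a mod int r)"
    using assms primitive_root_nonzero[OF assms]
    by (subst power_int_add) (auto simp: power_int_mult primitive_root_def simp del: mult_div_mod_eq)
  finally show ?thesis ..
qed

lemma primitive_root_powi_cong:
  "primitive_root \<xi> r \<Longrightarrow> a mod int r = b mod int r \<Longrightarrow> \<xi> powi a = \<xi> powi b"
  using primitive_root_powi_mod by metis

lemma primitive_root_powi_eq_1: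
  assumes "primitive_root \<xi> r"
  shows "\<xi> powi a = 1 \<longleftrightarrow> int r dvd a"
proof -
  have r: "int r > 0" using assms by (simp add: primitive_root_def)
  define m where "m = nat (a mod int r)"
  have m: "int m = a mod int r" "m < r" using r by (auto simp: m_def nat_less_iff)
  have "\<xi> powi a = \<xi> ^ m" using primitive_root_powi_mod[OF assms, of a] m(1) by (metis power_int_of_nat)
  thus ?thesis using assms m by (cases "m = 0") (auto simp: primitive_root_def dvd_eq_mod_eq_0)
qed

text \<open>Orthogonality of the characters of Z/r: a geometric sum whose ratio
  \<open>\<xi> powi a\<close> has \<open>r\<close>-th power 1 vanishes unless the ratio itself is
  1.\<close>

lemma sum_powers_primitive_root:
  fixes \<xi> :: "'k::field_char_0"
  assumes "primitive_root \<xi> r"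
  shows "(\<Sum>n<r. \<xi> powi (int n * a)) = (if int r dvd a then of_nat r else 0)"
proof -
  let ?z = "\<xi> powi a"
  have *: "\<xi> powi (int n * a) = ?z ^ n" for n by (simp add: mult.commute power_int_mult power_int_of_nat)
  have "?z ^ r = 1" using primitive_root_powi_eq_1[OF assms, of "int r * a"] *[of r] by simp
  thus ?thesis
    using primitive_root_powi_eq_1[OF assms, of a] sum_gp_strict[of ?z r] by (auto simp: *)
qed

lemma sum_int_interval: "(\<Sum>s\<in>{0..<int r}. h s) = (\<Sum>n<r. h (int n))"
  by (rule sum.reindex_bij_witness[where i = int and j = nat]) auto

text \<open>The derived quiver of the voltage assignment \<open>wt\<close> with values in Z/r:
  crossing \<open>e\<close> moves up by \<open>wt e\<close> sheets. Arrows are indexed by the sheet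
  of their head, as in \<open>quiver_SG\<close>, so the shift appears at the tail.\<close>

definition covering_quiver :: "('v, 'e) pre_digraph \<Rightarrow> ('e \<Rightarrow> int) \<Rightarrow> nat \<Rightarrow> ('v \<times> int, 'e \<times> int) pre_digraph" where
  "covering_quiver Q wt r = \<lparr>verts = verts Q \<times> {0..<int r}, arcs = arcs Q \<times> {0..<int r},
     tail = \<lambda>(e, j). (tail Q e, (j - wt e) mod int r), head = \<lambda>(e, j). (head Q e, j)\<rparr>"

lemma covering_quiver_sel [simp]:
  "verts (covering_quiver Q wt r) = verts Q \<times> {0..<int r}"
  "arcs (covering_quiver Q wt r) = arcs Q \<times> {0..<int r}"
  "tail (covering_quiver Q wt r) (e, j) = (tail Q e, (j - wt e) mod int r)"
  "head (covering_quiver Q wt r) (e, j) = (head Q e, j)"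
  by (simp_all add: covering_quiver_def)

lemma fin_digraph_covering:
  assumes "fin_digraph Q" "0 < r"
  shows "fin_digraph (covering_quiver Q wt r)"
proof -
  interpret fin_digraph Q by fact
  show ?thesis using assms(2) by unfold_locales auto
qed

lemma loopfree_covering:
  assumes "loopfree_digraph Q" "0 < r"
  shows "loopfree_digraph (covering_quiver Q wt r)"
proof -
  interpret loopfree_digraph Q by fact
  show ?thesis using assms(2) by unfold_locales (auto dest: no_loops)
qed

fun lift_path :: "('e \<Rightarrow> int) \<Rightarrow> nat \<Rightarrow> int \<Rightarrow> 'e list \<Rightarrow> ('e \<times> int) list" where
  "lift_path wt r s [] = []"
| "lift_path wt r s (e # p) = (e, (s + wt e) mod int r) # lift_path wt r ((s + wt e) mod int r) p"

lemma map_fst_lift_path [simp]: "map fst (lift_path wt r s p) = p"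
  by (induction p arbitrary: s) auto

text \<open>Unique path lifting: the starting sheet and the projected path determine the sheet of
  each successive head.\<close>

lemma covering_paths:
  assumes "fin_digraph Q" "0 < r"
  shows "((i, s), P) \<in> paths (covering_quiver Q wt r)
    \<longleftrightarrow> s \<in> {0..<int r} \<and> (i, map fst P) \<in> paths Q \<and> P = lift_path wt r s (map fst P)"
proof (induction P arbitrary: i s)
  case (Cons a P)
  have wf: "wf_digraph Q" "wf_digraph (covering_quiver Q wt r)"
    using assms fin_digraph_covering fin_digraph.axioms(1) by blast+
  obtain e j where a: "a = (e, j)" by (cases a)
  have r: "int r > 0" using assms by simp
  have "j \<in> {0..<int r} \<and> s = (j - wt e) mod int r \<longleftrightarrow> s \<in> {0..<int r} \<and> j = (s + wt e) mod int r"
    using r by (auto simp: mod_simps)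
  thus ?case
    by (auto simp: a Cons_in_paths[OF wf(1)] Cons_in_paths[OF wf(2)] Cons.IH)
qed auto

lemma covering_awlast:
  assumes "((i, s), P) \<in> paths (covering_quiver Q wt r)" "fin_digraph Q" "0 < r"
  shows "pre_digraph.awlast (covering_quiver Q wt r) (i, s) P
    = (pre_digraph.awlast Q i (map fst P), (s + sum_list (map wt (map fst P))) mod int r)"
  using assms(1)
proof (induction P arbitrary: i s)
  case Nil
  thus ?case by simp
next
  case (Cons a P)
  have wf: "wf_digraph (covering_quiver Q wt r)"
    using assms fin_digraph_covering fin_digraph.axioms(1) by blast
  obtain e j where a: "a = (e, j)" by (cases a)
  have j: "j = (s + wt e) mod int r"
    using Cons.prems covering_paths[OF assms(2,3), of i s "a # P" wt] by (simp add: a)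
  have P: "((head Q e, j), P) \<in> paths (covering_quiver Q wt r)"
    using Cons.prems by (simp add: a Cons_in_paths[OF wf])
  show ?case
    using Cons.IH[OF P] by (simp add: a j mod_simps add.assoc)
qed

section \<open>Finite cyclic groups with a chosen generator\<close>

locale cyclic_group_of_order = group G for G (structure) +
  fixes g :: 'a and r :: nat
  assumes gen_in: "g \<in> carrier G" and carrier_range: "carrier G = range (\<lambda>n::nat. g [^] n)"
    and card_carrier: "card (carrier G) = r" and pow_r: "g [^] r = \<one>" and r_pos: "0 < r"
begin

lemma pow_mod: "g [^] (n mod r) = g [^] n" for n :: nat
proof -
  have "g [^] n = g [^] (r * (n div r) + n mod r)" by simp
  also have "\<dots> = g [^] (r * (n div r)) \<otimes> g [^] (n mod r)"
    by (rule nat_pow_mult[OF gen_in, symmetric])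
  also have "g [^] (r * (n div r)) = (g [^] r) [^] (n div r)"
    by (rule nat_pow_pow[OF gen_in, symmetric])
  finally show ?thesis using gen_in by (simp add: pow_r)
qed

lemma carrier_eq: "carrier G = {g [^] n | n. n < r}"
proof -
  have "g [^] n \<in> {g [^] n | n. n < r}" for n :: nat
    using pow_mod[of n, symmetric] r_pos by (auto intro!: exI[of _ "n mod r"])
  thus ?thesis unfolding carrier_range by blast
qed

lemma bij_pow: "bij_betw (\<lambda>n. g [^] n) {..<r} (carrier G)"
proof -
  have "carrier G = (\<lambda>n. g [^] n) ` {..<r}" unfolding carrier_eq by auto
  thus ?thesis using card_carrier by (auto simp: bij_betw_def intro: eq_card_imp_inj_on)
qed

text \<open>\<open>t + (r - n)\<close> represents \<open>t - n\<close> modulo \<open>r\<close>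
  within the natural numbers; \<open>n < r\<close> keeps the inner subtraction exact.\<close>

lemma inv_pow_mult:
  assumes "n < r"
  shows "inv (g [^] n) \<otimes> g [^] t = g [^] ((t + (r - n)) mod r)"
proof -
  have "g [^] n \<otimes> g [^] ((t + (r - n)) mod r) = g [^] (t + r)"
    using assms gen_in by (simp add: pow_mod nat_pow_mult add.commute)
  also have "\<dots> = g [^] t" using gen_in by (simp add: nat_pow_mult[symmetric] pow_r)
  finally have "g [^] t = g [^] n \<otimes> g [^] ((t + (r - n)) mod r)" ..
  thus ?thesis using gen_in by (simp add: m_assoc[symmetric])
qed

text \<open>\<open>cyclic_action\<close> picks the least exponent representing a group element.
  Powers below \<open>r\<close> are distinct, so no smaller exponent than \<open>n\<close> can
  occur.\<close>

lemma Least_pow: "n < r \<Longrightarrow> (LEAST m. g [^] n = g [^] (m::nat)) = n"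
proof (rule Least_equality)
  fix m :: nat assume "n < r" "g [^] n = g [^] m"
  thus "n \<le> m" using bij_betw_imp_inj_on[OF bij_pow] by (cases "m < r") (auto simp: inj_on_def)
qed simp

lemma cyclic_action_pow: "n < r \<Longrightarrow> cyclic_action G g \<tau> (g [^] n) = \<tau> ^^ n"
  by (simp add: cyclic_action_def Least_pow)

end

text \<open>For coefficients given by a formula, finiteness of the support is settled by naming a
  finite set \<open>K\<close> that contains it.\<close>

lemma lookup_Abs_restricted:
  assumes "finite K" "\<And>x. x \<notin> K \<Longrightarrow> f x = 0"
  shows "Poly_Mapping.lookup (Abs_poly_mapping f) = f"
proof -
  have "finite {x. f x \<noteq> 0}" by (rule finite_subset[OF _ assms(1)]) (use assms(2) in auto)
  thus ?thesis by simp
qed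

text \<open>The substitution \<open>q = t - n\<close> in Z/r, which untangles the convolution over
  the group.\<close>

lemma sum_shift_mod:
  fixes h :: "nat \<Rightarrow> nat \<Rightarrow> 'k::comm_monoid_add"
  assumes "n < r"
  shows "(\<Sum>t<r. h t ((t + (r - n)) mod r)) = (\<Sum>q<r. h ((q + n) mod r) q)"
proof (rule sum.reindex_bij_witness[where i = "\<lambda>q. (q + n) mod r" and j = "\<lambda>t. (t + (r - n)) mod r"])
  fix a assume a: "a \<in> {..<r}"
  have "((a + (r - n)) mod r + n) mod r = (a + (r - n) + n) mod r" by (simp add: mod_simps)
  also have "\<dots> = a" using a assms by simp
  finally show "((a + (r - n)) mod r + n) mod r = a" .
  thus "h (((a + (r - n)) mod r + n) mod r) ((a + (r - n)) mod r) = h a ((a + (r - n)) mod r)" by simp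
  have "((a + n) mod r + (r - n)) mod r = (a + n + (r - n)) mod r" by (simp add: mod_simps)
  also have "\<dots> = a" using a assms by simp
  finally show "((a + n) mod r + (r - n)) mod r = a" .
qed (use assms in auto)

text \<open>
  The discrete Fourier transform over the group: the idempotent
  \<open>\<epsilon>\<^sub>s = 1/r \<Sum>\<^sub>n \<xi>\<^bsup>-ns\<^esup> g\<^sup>n\<close> satisfies \<open>\<epsilon>\<^sub>s p = p \<epsilon>\<^bsub>s - wt p\<^esub>\<close> for a path \<open>p\<close>, so \<open>p \<epsilon>\<^sub>s\<close> behaves like the
  lift of \<open>p\<close> starting on sheet \<open>s\<close>.
\<close>

theorem skew_path_algebra_covering:
  fixes Q :: "('v, 'e) pre_digraph" and \<xi> :: "'k::field_char_0"
    and \<tau> :: "(('v \<times> 'e list) \<Rightarrow>\<^sub>0 'k) \<Rightarrow> ('v \<times> 'e list) \<Rightarrow>\<^sub>0 'k"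
  assumes Q: "fin_digraph Q" and G: "cyclic_group_of_order G g r" and \<xi>: "primitive_root \<xi> r"
    and \<tau>: "\<And>F v p. Poly_Mapping.lookup (\<tau> F) (v, p) = \<xi> powi sum_list (map wt p) * Poly_Mapping.lookup F (v, p)"
  shows "skew_group_algebra (path_algebra Q) G (cyclic_action G g \<tau>)
    \<cong>\<^sub>a\<^sub>l\<^sub>g (path_algebra (covering_quiver Q wt r) :: ('k, _) module)"
proof -
  interpret cyclic_group_of_order G g r by fact
  let ?Q = "path_algebra Q :: ('k, _) module"
  let ?S = "skew_group_algebra ?Q G (cyclic_action G g \<tau>)"
  let ?C = "covering_quiver Q wt r"
  let ?R = "path_algebra ?C :: ('k, _) module"
  let ?lk = "Poly_Mapping.lookup"
  note paths = covering_paths[OF Q r_pos, of _ _ _ wt]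
  have wfQ: "wf_digraph Q" and wfC: "wf_digraph ?C" and finC: "finite (verts ?C)"
    using fin_digraph.axioms(1) fin_digraph.finite_verts Q fin_digraph_covering[OF Q r_pos] by blast+
  have \<xi>0: "\<xi> \<noteq> 0" by (rule primitive_root_nonzero[OF \<xi>])
  have powi_add: "\<xi> powi (a + b) = \<xi> powi a * \<xi> powi b" for a b using \<xi>0 by (simp add: power_int_add)
  have \<tau>_pow: "?lk ((\<tau> ^^ n) F) (v, p) = \<xi> powi (int n * sum_list (map wt p)) * ?lk F (v, p)" for n F v p
    by (induction n) (simp_all add: \<tau> powi_add ring_distribs)
  have S: "carrier ?S = {u. (\<forall>p\<in>carrier G. Poly_Mapping.keys (u p) \<subseteq> paths Q) \<and> (\<forall>p. p \<notin> carrier G \<longrightarrow> u p = 0)}"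
    by (auto simp: skew_group_algebra_def)
  have pow_in: "g [^]\<^bsub>G\<^esub> n \<in> carrier G" for n :: nat using gen_in by simp

  \<comment> \<open>Since \<open>g \<epsilon>_s = \<xi>^s \<epsilon>_s\<close>, the element
    \<open>p g^n\<close> is the sum over \<open>s\<close> of
    \<open>\<xi>^(n s) p \<epsilon>_s\<close>. This gives the coefficient at the lift of
    \<open>p\<close> that starts on sheet \<open>s\<close>.\<close>
  define \<Psi> :: "_ \<Rightarrow> _ \<Rightarrow>\<^sub>0 'k" where "\<Psi> u = Abs_poly_mapping (\<lambda>x. if x \<in> paths ?C
      then \<Sum>n<r. \<xi> powi (int n * snd (fst x)) * ?lk (u (g [^]\<^bsub>G\<^esub> n)) (fst (fst x), map fst (snd x)) else 0)" for u
  have lk\<Psi>: "?lk (\<Psi> u) ((i, s), P) = (if ((i, s), P) \<in> paths ?C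
      then \<Sum>n<r. \<xi> powi (int n * s) * ?lk (u (g [^]\<^bsub>G\<^esub> n)) (i, map fst P) else 0)" for u i s P
  proof -
    \<comment> \<open>Only lifts of the paths that occur in some coefficient of \<open>u\<close> can
      contribute, and each of them has \<open>r\<close> lifts.\<close>
    let ?K = "(\<lambda>((i, p), s). ((i, s), lift_path wt r s p)) ` ((\<Union>n<r. Poly_Mapping.keys (u (g [^]\<^bsub>G\<^esub> n))) \<times> {0..<int r})"
    have "(if x \<in> paths ?C then \<Sum>n<r. \<xi> powi (int n * snd (fst x)) * ?lk (u (g [^]\<^bsub>G\<^esub> n)) (fst (fst x), map fst (snd x)) else 0) = 0"
      if notin: "x \<notin> ?K" for x
    proof (cases "x \<in> paths ?C")
      case True
      obtain i s P where x: "x = ((i, s), P)" by (metis prod.exhaust)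
      have P: "s \<in> {0..<int r}" "P = lift_path wt r s (map fst P)" using True paths unfolding x by blast+
      have "?lk (u (g [^]\<^bsub>G\<^esub> n)) (i, map fst P) = 0" if n: "n < r" for n
      proof (rule ccontr)
        assume "?lk (u (g [^]\<^bsub>G\<^esub> n)) (i, map fst P) \<noteq> 0"
        hence "((i, map fst P), s) \<in> (\<Union>n<r. Poly_Mapping.keys (u (g [^]\<^bsub>G\<^esub> n))) \<times> {0..<int r}"
          using n P(1) by (auto simp: in_keys_iff)
        hence "((i, s), lift_path wt r s (map fst P)) \<in> ?K" by force
        hence "((i, s), P) \<in> ?K" by (simp only: P(2)[symmetric])
        thus False using notin unfolding x by blast
      qed
      thus ?thesis by (simp add: x)
    qed simp
    thus ?thesis unfolding \<Psi>_def by (subst lookup_Abs_restricted[where K = ?K]) simp_all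
  qed

  define idx where "idx h = (LEAST n::nat. h = g [^]\<^bsub>G\<^esub> n)" for h
  have idx: "idx (g [^]\<^bsub>G\<^esub> n) = n" if "n < r" for n using Least_pow[OF that] by (simp add: idx_def)
  \<comment> \<open>The inverse transform: it expands each \<open>\<epsilon>_s\<close> in powers of
    \<open>g\<close> and collects the coefficient of \<open>h\<close>, whose exponent is
    \<open>idx h\<close>.\<close>
  define \<Theta> :: "_ \<Rightarrow> _ \<Rightarrow> _ \<Rightarrow>\<^sub>0 'k" where "\<Theta> F h = (if h \<in> carrier G then Abs_poly_mapping (\<lambda>x. if x \<in> paths Q
      then (\<Sum>s\<in>{0..<int r}. \<xi> powi (- int (idx h) * s) * ?lk F ((fst x, s), lift_path wt r s (snd x))) / of_nat r else 0) else 0)" for F h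
  have lk\<Theta>: "?lk (\<Theta> F h) (i, p) = (if (i, p) \<in> paths Q
      then (\<Sum>s\<in>{0..<int r}. \<xi> powi (- int (idx h) * s) * ?lk F ((i, s), lift_path wt r s p)) / of_nat r else 0)"
    if h: "h \<in> carrier G" for F h i p
  proof -
    let ?K = "(\<lambda>((i, s), P). (i, map fst P)) ` Poly_Mapping.keys F"
    have zero: "?lk F ((fst x, s), lift_path wt r s (snd x)) = 0" if "x \<notin> ?K" for x s
    proof (rule ccontr)
      assume "?lk F ((fst x, s), lift_path wt r s (snd x)) \<noteq> 0"
      hence "((fst x, s), lift_path wt r s (snd x)) \<in> Poly_Mapping.keys F" by (simp add: in_keys_iff)
      from imageI[OF this, of "\<lambda>((i, s), P). (i, map fst P)"] that show False by simp
    qed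
    show ?thesis
      unfolding \<Theta>_def if_P[OF h]
      by (subst lookup_Abs_restricted[where K = ?K]) (simp_all add: zero)
  qed

  have \<Psi>_in: "\<Psi> u \<in> carrier ?R" for u
    by (auto simp: keys_subset_iff lk\<Psi>)
  have \<Theta>_in: "\<Theta> F \<in> carrier ?S" for F
    unfolding S by (auto simp: keys_subset_iff lk\<Theta>) (simp add: \<Theta>_def)
  have r0: "of_nat r \<noteq> (0::'k)" using r_pos by simp
  have left: "\<Theta> (\<Psi> u) = u" if u: "u \<in> carrier ?S" for u
  proof
    fix h
    show "\<Theta> (\<Psi> u) h = u h"
    proof (cases "h \<in> carrier G")
      case True
      then obtain m where m: "m < r" "h = g [^]\<^bsub>G\<^esub> m" unfolding carrier_eq by blast
      have "?lk (\<Theta> (\<Psi> u) h) (i, p) = ?lk (u h) (i, p)" for i p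
      proof (cases "(i, p) \<in> paths Q")
        case p: True
        have "(\<Sum>s\<in>{0..<int r}. \<xi> powi (- int m * s) * ?lk (\<Psi> u) ((i, s), lift_path wt r s p))
          = (\<Sum>s\<in>{0..<int r}. \<Sum>n<r. \<xi> powi (s * (int n - int m)) * ?lk (u (g [^]\<^bsub>G\<^esub> n)) (i, p))"
          using p by (intro sum.cong refl) (auto simp: lk\<Psi> paths sum_distrib_left mult.assoc[symmetric]
              simp flip: powi_add simp: algebra_simps)
        also have "\<dots> = (\<Sum>n<r. (\<Sum>s\<in>{0..<int r}. \<xi> powi (s * (int n - int m))) * ?lk (u (g [^]\<^bsub>G\<^esub> n)) (i, p))"
          by (subst sum.swap) (simp add: sum_distrib_right)
        also have "\<dots> = (\<Sum>n<r. if n = m then of_nat r * ?lk (u (g [^]\<^bsub>G\<^esub> m)) (i, p) else 0)"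
        proof (intro sum.cong refl)
          fix n assume n: "n \<in> {..<r}"
          have "int r dvd int n - int m \<longleftrightarrow> n = m"
          proof
            assume "int r dvd int n - int m"
            hence "int n mod int r = int m mod int r" by (simp add: mod_eq_dvd_iff)
            thus "n = m" using n m by simp
          qed simp
          thus "(\<Sum>s\<in>{0..<int r}. \<xi> powi (s * (int n - int m))) * ?lk (u (g [^]\<^bsub>G\<^esub> n)) (i, p)
            = (if n = m then of_nat r * ?lk (u (g [^]\<^bsub>G\<^esub> m)) (i, p) else 0)"
            by (simp add: sum_int_interval sum_powers_primitive_root[OF \<xi>])
        qed
        also have "\<dots> = of_nat r * ?lk (u (g [^]\<^bsub>G\<^esub> m)) (i, p)" using m by simp
        finally show ?thesis using p r0 by (simp add: lk\<Theta> True) (simp add: m idx)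
      next
        case False
        thus ?thesis using u True unfolding S by (auto simp: lk\<Theta> keys_subset_iff)
      qed
      thus ?thesis by (intro poly_mapping_eqI) (auto simp: split_paired_all)
    next
      case False
      thus ?thesis using u unfolding S by (simp add: \<Theta>_def)
    qed
  qed
  have right: "\<Psi> (\<Theta> F) = F" if F: "F \<in> carrier ?R" for F
  proof (rule poly_mapping_eqI)
    fix x :: "('v \<times> int) \<times> ('e \<times> int) list"
    obtain i s P where x: "x = ((i, s), P)" by (metis prod.exhaust)
    show "?lk (\<Psi> (\<Theta> F)) x = ?lk F x"
    proof (cases "x \<in> paths ?C")
      case True
      hence P: "s \<in> {0..<int r}" "(i, map fst P) \<in> paths Q" "lift_path wt r s (map fst P) = P"
        using paths[of i s P] by (auto simp: x)
      let ?F = "\<lambda>s'. ?lk F ((i, s'), lift_path wt r s' (map fst P))"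
      have "(\<Sum>n<r. \<xi> powi (int n * s) * ((\<Sum>s'\<in>{0..<int r}. \<xi> powi (- int n * s') * ?F s') / of_nat r))
        = (\<Sum>n<r. \<Sum>s'\<in>{0..<int r}. \<xi> powi (int n * (s - s')) * (?F s' / of_nat r))"
        by (intro sum.cong refl) (simp add: sum_distrib_left sum_divide_distrib mult.assoc[symmetric]
            ring_distribs diff_conv_add_uminus powi_add del: add_uminus_conv_diff)
      also have "\<dots> = (\<Sum>s'\<in>{0..<int r}. (\<Sum>n<r. \<xi> powi (int n * (s - s'))) * (?F s' / of_nat r))"
        by (subst sum.swap) (simp add: sum_distrib_right sum_divide_distrib)
      also have "\<dots> = (\<Sum>s'\<in>{0..<int r}. if s' = s then ?F s else 0)"
      proof (intro sum.cong refl)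
        fix s' assume s': "s' \<in> {0..<int r}"
        have "int r dvd s - s' \<longleftrightarrow> s' = s"
        proof
          assume "int r dvd s - s'"
          hence "s mod int r = s' mod int r" by (simp add: mod_eq_dvd_iff)
          thus "s' = s" using s' P(1) by simp
        qed simp
        thus "(\<Sum>n<r. \<xi> powi (int n * (s - s'))) * (?F s' / of_nat r) = (if s' = s then ?F s else 0)"
          using r0 by (simp add: sum_powers_primitive_root[OF \<xi>])
      qed
      also have "\<dots> = ?F s" using P(1) by simp
      finally have *: "(\<Sum>n<r. \<xi> powi (int n * s) * ((\<Sum>s'\<in>{0..<int r}. \<xi> powi (- int n * s') * ?F s') / of_nat r)) = ?F s" .
      have "?lk (\<Psi> (\<Theta> F)) x = (\<Sum>n<r. \<xi> powi (int n * s) * ((\<Sum>s'\<in>{0..<int r}. \<xi> powi (- int n * s') * ?F s') / of_nat r))"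
        using True P(2) unfolding x lk\<Psi>
        by (simp only: if_True, intro sum.cong refl) (simp add: lk\<Theta>[OF pow_in] idx)
      thus ?thesis using * by (simp add: P(3) x)
    next
      case False
      thus ?thesis using F by (auto simp: x lk\<Psi> keys_subset_iff)
    qed
  qed
  have bij: "bij_betw \<Psi> (carrier ?S) (carrier ?R)"
    using \<Psi>_in \<Theta>_in left right by (intro bij_betwI[where g = \<Theta>]) auto

  have one: "\<Psi> \<one>\<^bsub>?S\<^esub> = \<one>\<^bsub>?R\<^esub>"
  proof (rule poly_mapping_eqI)
    fix x :: "('v \<times> int) \<times> ('e \<times> int) list"
    obtain i s P where x: "x = ((i, s), P)" by (metis prod.exhaust)
    have is_one: "g [^]\<^bsub>G\<^esub> n = \<one>\<^bsub>G\<^esub> \<longleftrightarrow> n = 0" if "n < r" for n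
      using bij_betw_imp_inj_on[OF bij_pow] that r_pos nat_pow_0[of g] by (auto simp: inj_on_def)
    have "(\<Sum>n<r. \<xi> powi (int n * s) * ?lk (if g [^]\<^bsub>G\<^esub> n = \<one>\<^bsub>G\<^esub> then \<one>\<^bsub>?Q\<^esub> else \<zero>\<^bsub>?Q\<^esub>) (i, map fst P))
      = (\<Sum>n<r. if n = 0 then ?lk \<one>\<^bsub>?Q\<^esub> (i, map fst P) else 0)"
      by (intro sum.cong refl) (simp add: is_one)
    also have "\<dots> = ?lk \<one>\<^bsub>?Q\<^esub> (i, map fst P)" using r_pos by simp
    also have "\<dots> = (if i \<in> verts Q \<and> map fst P = [] then 1 else 0)"
      by (rule lookup_path_one) (rule fin_digraph.finite_verts[OF Q])
    finally have "?lk (\<Psi> \<one>\<^bsub>?S\<^esub>) x = (if x \<in> paths ?C then if i \<in> verts Q \<and> P = [] then 1 else 0 else 0)"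
      by (simp add: x lk\<Psi> skew_group_algebra_def del: path_algebra_sel)
    also have "\<dots> = (if (i, s) \<in> verts ?C \<and> P = [] then 1 else 0)"
      by (auto simp: x)
    also have "\<dots> = ?lk \<one>\<^bsub>?R\<^esub> x"
      unfolding x by (rule lookup_path_one[OF finC, symmetric])
    finally show "?lk (\<Psi> \<one>\<^bsub>?S\<^esub>) x = ?lk \<one>\<^bsub>?R\<^esub> x" .
  qed

  have mult: "\<Psi> (u \<otimes>\<^bsub>?S\<^esub> v) = \<Psi> u \<otimes>\<^bsub>?R\<^esub> \<Psi> v" if u: "u \<in> carrier ?S" and v: "v \<in> carrier ?S" for u v
  proof (rule poly_mapping_eqI)
    fix x :: "('v \<times> int) \<times> ('e \<times> int) list"
    obtain i s P where x: "x = ((i, s), P)" by (metis prod.exhaust)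
    have out: "?lk (path_mult ?C (\<Psi> u) (\<Psi> v)) x = 0" if "x \<notin> paths ?C"
      using path_algebra_mult_closed[OF wfC \<Psi>_in \<Psi>_in, of u v] that unfolding x by (auto simp: keys_subset_iff)
    show "?lk (\<Psi> (u \<otimes>\<^bsub>?S\<^esub> v)) x = ?lk (\<Psi> u \<otimes>\<^bsub>?R\<^esub> \<Psi> v) x"
    proof (cases "x \<in> paths ?C")
      case True
      define p where "p = map fst P"
      \<comment> \<open>\<open>U\<close> and \<open>V\<close> are the coefficients belonging to the
        cut after \<open>k\<close> arrows: the initial part comes from the right factor
        \<open>v\<close>, the rest from \<open>u\<close>. The initial part climbs \<open>w k\<close>
        sheets.\<close>
      define U where "U n k = ?lk (u (g [^]\<^bsub>G\<^esub> n)) (pre_digraph.awlast Q i (take k p), drop k p)" for n :: nat and k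
      define V where "V n k = ?lk (v (g [^]\<^bsub>G\<^esub> n)) (i, take k p)" for n :: nat and k
      define w where "w k = sum_list (map wt (take k p))" for k
      have splitC: "((i, s), take k P) \<in> paths ?C" "(pre_digraph.awlast ?C (i, s) (take k P), drop k P) \<in> paths ?C" for k
        using append_in_paths[OF wfC, of "(i, s)" "take k P" "drop k P"] True by (auto simp: x)
      have lastC: "pre_digraph.awlast ?C (i, s) (take k P) = (pre_digraph.awlast Q i (take k p), (s + w k) mod int r)" for k
        using covering_awlast[OF splitC(1) Q r_pos, of k] by (simp add: w_def p_def take_map)
      \<comment> \<open>Moving \<open>g^n\<close> past the initial part of the path costs the scalar
        \<open>\<xi>^(n w k)\<close>.\<close>
      have uv: "?lk ((u \<otimes>\<^bsub>?S\<^esub> v) (g [^]\<^bsub>G\<^esub> t)) (i, p)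
        = (\<Sum>n<r. \<Sum>k\<le>length p. U n k * (\<xi> powi (int n * w k) * V ((t + (r - n)) mod r) k))" if t: "t < r" for t
      proof -
        have "(u \<otimes>\<^bsub>?S\<^esub> v) (g [^]\<^bsub>G\<^esub> t)
          = (\<Oplus>\<^bsub>?Q\<^esub>h\<in>carrier G. path_mult Q (u h) (cyclic_action G g \<tau> h (v (inv\<^bsub>G\<^esub> h \<otimes>\<^bsub>G\<^esub> g [^]\<^bsub>G\<^esub> t))))"
          using pow_in by (simp add: skew_group_algebra_def)
        also have "\<dots> = (\<Sum>h\<in>carrier G. path_mult Q (u h) (cyclic_action G g \<tau> h (v (inv\<^bsub>G\<^esub> h \<otimes>\<^bsub>G\<^esub> g [^]\<^bsub>G\<^esub> t))))"
        proof (rule finsum_path_algebra)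
          show "finite (carrier G)" unfolding carrier_eq by simp
          show "(\<lambda>h. path_mult Q (u h) (cyclic_action G g \<tau> h (v (inv\<^bsub>G\<^esub> h \<otimes>\<^bsub>G\<^esub> g [^]\<^bsub>G\<^esub> t)))) \<in> carrier G \<rightarrow> carrier ?Q"
          proof
            fix h assume h: "h \<in> carrier G"
            have "v (inv\<^bsub>G\<^esub> h \<otimes>\<^bsub>G\<^esub> g [^]\<^bsub>G\<^esub> t) \<in> carrier ?Q" using v h pow_in unfolding S by auto
            hence "cyclic_action G g \<tau> h (v (inv\<^bsub>G\<^esub> h \<otimes>\<^bsub>G\<^esub> g [^]\<^bsub>G\<^esub> t)) \<in> carrier ?Q"
              unfolding cyclic_action_def by (auto simp: keys_subset_iff \<tau>_pow)
            moreover have "u h \<in> carrier ?Q" using u h unfolding S by auto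
            ultimately show "path_mult Q (u h) (cyclic_action G g \<tau> h (v (inv\<^bsub>G\<^esub> h \<otimes>\<^bsub>G\<^esub> g [^]\<^bsub>G\<^esub> t))) \<in> carrier ?Q"
              by (intro path_algebra_mult_closed wfQ)
          qed
        qed
        also have "\<dots> = (\<Sum>n<r. path_mult Q (u (g [^]\<^bsub>G\<^esub> n)) (cyclic_action G g \<tau> (g [^]\<^bsub>G\<^esub> n) (v (inv\<^bsub>G\<^esub> (g [^]\<^bsub>G\<^esub> n) \<otimes>\<^bsub>G\<^esub> g [^]\<^bsub>G\<^esub> t))))"
          by (rule sum.reindex_bij_betw[OF bij_pow, symmetric])
        also have "\<dots> = (\<Sum>n<r. path_mult Q (u (g [^]\<^bsub>G\<^esub> n)) ((\<tau> ^^ n) (v (g [^]\<^bsub>G\<^esub> ((t + (r - n)) mod r)))))"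
          by (intro sum.cong refl) (simp add: cyclic_action_pow inv_pow_mult)
        finally show ?thesis
          by (simp only: lookup_sum lookup_path_mult \<tau>_pow U_def V_def w_def)
      qed
      have shift: "(\<Sum>t<r. \<xi> powi (int t * s) * V ((t + (r - n)) mod r) k)
        = \<xi> powi (int n * s) * (\<Sum>q<r. \<xi> powi (int q * s) * V q k)" if "n < r" for n k
      proof -
        have "(\<Sum>t<r. \<xi> powi (int t * s) * V ((t + (r - n)) mod r) k) = (\<Sum>q<r. \<xi> powi (int ((q + n) mod r) * s) * V q k)"
          by (rule sum_shift_mod[OF that, where h = "\<lambda>t q. \<xi> powi (int t * s) * V q k"])
        also have "\<dots> = (\<Sum>q<r. \<xi> powi (int n * s) * (\<xi> powi (int q * s) * V q k))"
        proof (intro sum.cong refl)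
          fix q
          have "\<xi> powi (int ((q + n) mod r) * s) = \<xi> powi (int n * s + int q * s)"
            by (rule primitive_root_powi_cong[OF \<xi>]) (simp add: zmod_int mod_simps algebra_simps)
          thus "\<xi> powi (int ((q + n) mod r) * s) * V q k = \<xi> powi (int n * s) * (\<xi> powi (int q * s) * V q k)"
            by (simp add: powi_add)
        qed
        finally show ?thesis by (simp add: sum_distrib_left)
      qed
      have "?lk (\<Psi> (u \<otimes>\<^bsub>?S\<^esub> v)) x = (\<Sum>t<r. \<xi> powi (int t * s) *
          (\<Sum>n<r. \<Sum>k\<le>length p. U n k * (\<xi> powi (int n * w k) * V ((t + (r - n)) mod r) k)))"
        using True unfolding x lk\<Psi>
        by (simp only: if_True, intro sum.cong refl) (simp add: uv flip: p_def)
      also have "\<dots> = (\<Sum>n<r. \<Sum>k\<le>length p. U n k * \<xi> powi (int n * w k) *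
          (\<Sum>t<r. \<xi> powi (int t * s) * V ((t + (r - n)) mod r) k))"
        unfolding sum_distrib_left
        by (rule trans[OF sum.swap], rule sum.cong[OF refl], rule trans[OF sum.swap], rule sum.cong[OF refl],
            simp add: mult_ac)
      also have "\<dots> = (\<Sum>n<r. \<Sum>k\<le>length p. U n k * \<xi> powi (int n * w k) *
          (\<xi> powi (int n * s) * (\<Sum>q<r. \<xi> powi (int q * s) * V q k)))"
        by (intro sum.cong refl, subst shift) simp_all
      also have "\<dots> = (\<Sum>k\<le>length p. (\<Sum>n<r. \<xi> powi (int n * ((s + w k) mod int r)) * U n k) *
          (\<Sum>q<r. \<xi> powi (int q * s) * V q k))"
      proof (rule trans[OF sum.swap], rule sum.cong[OF refl])
        fix k
        \<comment> \<open>This is where the sheets match: the scalar of the starting sheet and the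
          one from moving \<open>g^n\<close> past the initial part combine to the scalar of the
          sheet on which the lifted second part begins.\<close>
        have E: "\<xi> powi (int n * ((s + w k) mod int r)) = \<xi> powi (int n * w k) * \<xi> powi (int n * s)" for n
        proof -
          have "\<xi> powi (int n * ((s + w k) mod int r)) = \<xi> powi (int n * w k + int n * s)"
            by (rule primitive_root_powi_cong[OF \<xi>]) (simp add: mod_simps algebra_simps)
          thus ?thesis by (simp add: powi_add)
        qed
        show "(\<Sum>n<r. U n k * \<xi> powi (int n * w k) * (\<xi> powi (int n * s) * (\<Sum>q<r. \<xi> powi (int q * s) * V q k)))
          = (\<Sum>n<r. \<xi> powi (int n * ((s + w k) mod int r)) * U n k) * (\<Sum>q<r. \<xi> powi (int q * s) * V q k)"
          by (simp only: E sum_distrib_right) (simp only: mult_ac)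
      qed
      also have "\<dots> = (\<Sum>k\<le>length P. ?lk (\<Psi> u) (pre_digraph.awlast ?C (i, s) (take k P), drop k P) * ?lk (\<Psi> v) ((i, s), take k P))"
      proof (rule sum.cong)
        fix k
        show "(\<Sum>n<r. \<xi> powi (int n * ((s + w k) mod int r)) * U n k) * (\<Sum>q<r. \<xi> powi (int q * s) * V q k)
          = ?lk (\<Psi> u) (pre_digraph.awlast ?C (i, s) (take k P), drop k P) * ?lk (\<Psi> v) ((i, s), take k P)"
          using splitC[of k] unfolding lastC lk\<Psi> by (simp add: U_def V_def p_def take_map drop_map)
      qed (simp add: p_def)
      finally show ?thesis by (simp add: x lookup_path_mult)
    next
      case False
      thus ?thesis using out by (simp add: x lk\<Psi>)
    qed
  qed

  have "\<Psi> (u \<oplus>\<^bsub>?S\<^esub> v) = \<Psi> u \<oplus>\<^bsub>?R\<^esub> \<Psi> v" for u v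
    by (rule poly_mapping_eqI)
      (auto simp: split_paired_all lk\<Psi> lookup_add skew_group_algebra_def ring_distribs sum.distrib)
  moreover have "\<Psi> (c \<odot>\<^bsub>?S\<^esub> u) = c \<odot>\<^bsub>?R\<^esub> \<Psi> u" for c u
    by (rule poly_mapping_eqI)
      (auto simp: split_paired_all lk\<Psi> skew_group_algebra_def sum_distrib_left mult_ac)
  ultimately have "algebra_iso_map ?S ?R \<Psi>"
    using bij one mult by (simp add: algebra_iso_map_def)
  thus ?thesis by (auto simp: algebra_iso_iff)
qed

section \<open>The free algebra and its one-relator quotients\<close>

abbreviation word_deg :: "nat \<Rightarrow> nat \<Rightarrow> gword \<Rightarrow> nat" where
  "word_deg dx dy w \<equiv> (\<Sum>s\<leftarrow>letters w. gen_deg dx dy s)"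

lemma letters_zero [simp]: "letters 0 = []" and letters_plus [simp]: "letters (v + w) = letters v @ letters w"
  by (simp_all add: zero_gword_def plus_gword_def)

lemma letters_Nil_iff: "letters w = [] \<longleftrightarrow> w = 0" "[] = letters w \<longleftrightarrow> w = 0"
  by (cases w; auto simp: zero_gword_def)+

lemma word_deg_eq_0:
  assumes "0 < dx" "0 < dy"
  shows "word_deg dx dy w = 0 \<longleftrightarrow> w = 0"
proof -
  have "0 < gen_deg dx dy s" for s using assms by (cases s) auto
  thus ?thesis unfolding letters_Nil_iff(1)[symmetric]
    by (cases "letters w") (auto simp: neq0_conv[symmetric] simp del: neq0_conv)
qed

lemma sum_delta_split:
  "(\<Sum>k\<le>length t. if q = take k t \<and> p = drop k t then c else 0) = (if q @ p = t then c else (0::'k::comm_monoid_add))"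
proof -
  have "(\<Sum>(q', p')\<in>{(q, p)}. if q' @ p' = t then if q = q' \<and> p = p' then c else 0 else 0)
    = (\<Sum>k\<le>length t. if q = take k t \<and> p = drop k t then c else 0)"
    by (rule sum_over_splits) auto
  moreover have "(\<Sum>(q', p')\<in>{(q, p)}. if q' @ p' = t then if q = q' \<and> p = p' then c else 0 else 0)
    = (if q @ p = t then c else 0)" by simp
  ultimately show ?thesis by (simp only:)
qed

text \<open>Both sides are additive in each factor, so two monomials suffice; a word is their
  product at no more than one cutting position.\<close>

lemma lookup_gword_times:
  fixes A B :: "gword \<Rightarrow>\<^sub>0 'k::field"
  shows "Poly_Mapping.lookup (A * B) w = (\<Sum>k\<le>length (letters w).
    Poly_Mapping.lookup A (Word (take k (letters w))) * Poly_Mapping.lookup B (Word (drop k (letters w))))"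
proof (rule additive_eqI_singles[of "\<lambda>A. Poly_Mapping.lookup (A * B) w"])
  fix u c
  show "Poly_Mapping.lookup (Poly_Mapping.single u c * B) w = (\<Sum>k\<le>length (letters w).
    Poly_Mapping.lookup (Poly_Mapping.single u c) (Word (take k (letters w))) * Poly_Mapping.lookup B (Word (drop k (letters w))))"
  proof (rule additive_eqI_singles[of "\<lambda>B. Poly_Mapping.lookup (Poly_Mapping.single u c * B) w"])
    fix v d
    have "w = u + v \<longleftrightarrow> letters u @ letters v = letters w"
      by (cases w; cases u; cases v) (auto simp: plus_gword_def)
    moreover have "u = Word l \<longleftrightarrow> letters u = l" for u l by (cases u) auto
    ultimately have "Poly_Mapping.lookup (Poly_Mapping.single u c * Poly_Mapping.single v d) w
      = (\<Sum>k\<le>length (letters w). if letters u = take k (letters w) \<and> letters v = drop k (letters w) then c * d else 0)"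
      by (simp add: mult_single lookup_single when_def sum_delta_split eq_commute)
    also have "\<dots> = (\<Sum>k\<le>length (letters w). Poly_Mapping.lookup (Poly_Mapping.single u c) (Word (take k (letters w)))
      * Poly_Mapping.lookup (Poly_Mapping.single v d) (Word (drop k (letters w))))"
      by (intro sum.cong refl) (auto simp: lookup_single when_def \<open>\<And>u l. u = Word l \<longleftrightarrow> letters u = l\<close>)
    finally show "Poly_Mapping.lookup (Poly_Mapping.single u c * Poly_Mapping.single v d) w = \<dots>" .
  qed (simp_all add: lookup_add ring_distribs sum.distrib)
qed (simp_all add: lookup_add ring_distribs sum.distrib)

lemma free_algebra_sel [simp]:
  "carrier (free_algebra dx dy) = UNIV" "mult (free_algebra dx dy) = (*)" "one (free_algebra dx dy) = 1"
  "zero (free_algebra dx dy) = 0" "add (free_algebra dx dy) = (+)"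
  "smult (free_algebra dx dy) = (\<lambda>c. Poly_Mapping.map ((*) c))"
  by (simp_all add: free_algebra_def)

lemma hcomp_free_algebra:
  "F \<in> hcomp (free_algebra dx dy) n \<longleftrightarrow> (\<forall>w. int (word_deg dx dy w) \<noteq> n \<longrightarrow> Poly_Mapping.lookup F w = 0)"
  by (auto simp: free_algebra_def in_keys_iff)

lemma ring_free_algebra: "ring (free_algebra dx dy :: ('k::field, _) graded_algebra)"
  by (rule ringI; (intro abelian_groupI monoidI)?)
    (auto simp: ring_distribs mult.assoc add_ac intro: exI[of _ "- _"] left_minus)

lemma free_algebra_minus:
  "F \<ominus>\<^bsub>(free_algebra dx dy :: ('k::field, _) graded_algebra)\<^esub> H = F - H"
proof -
  interpret ring "free_algebra dx dy :: ('k, _) graded_algebra" by (rule ring_free_algebra)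
  have "\<ominus>\<^bsub>(free_algebra dx dy :: ('k, _) graded_algebra)\<^esub> H = - H" by (rule minus_equality) simp_all
  thus ?thesis by (simp add: a_minus_def)
qed

lemma free_algebra_scale: "Poly_Mapping.map ((*) c) F = Poly_Mapping.single 0 c * F"
  for F :: "gword \<Rightarrow>\<^sub>0 'k::field"
  by (rule mult_map_scale_conv_mult)

lemma scale_times_left: "Poly_Mapping.map ((*) c) (F * H) = Poly_Mapping.map ((*) c) F * H"
  and scale_times_right: "Poly_Mapping.map ((*) c) (F * H) = F * Poly_Mapping.map ((*) c) H"
  for F :: "gword \<Rightarrow>\<^sub>0 'k::field"
  by (rule poly_mapping_eqI; simp add: lookup_gword_times sum_distrib_left mult_ac)+

lemma hcomp_free_add:
  "F \<in> hcomp (free_algebra dx dy) n \<Longrightarrow> H \<in> hcomp (free_algebra dx dy) n \<Longrightarrow> F + H \<in> hcomp (free_algebra dx dy) n"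
  by (simp add: hcomp_free_algebra lookup_add)

lemma hcomp_free_times:
  assumes "F \<in> hcomp (free_algebra dx dy) m" "H \<in> hcomp (free_algebra dx dy) n"
  shows "F * H \<in> hcomp (free_algebra dx dy) (m + n)"
  unfolding hcomp_free_algebra lookup_gword_times
proof (intro allI impI sum.neutral ballI)
  fix w k assume w: "int (word_deg dx dy w) \<noteq> m + n"
  have "word_deg dx dy w = word_deg dx dy (Word (take k (letters w))) + word_deg dx dy (Word (drop k (letters w)))"
    by (simp flip: sum_list_append map_append)
  hence "int (word_deg dx dy (Word (take k (letters w)))) \<noteq> m \<or> int (word_deg dx dy (Word (drop k (letters w)))) \<noteq> n"
    using w by linarith
  thus "Poly_Mapping.lookup F (Word (take k (letters w))) * Poly_Mapping.lookup H (Word (drop k (letters w))) = 0"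
    using assms unfolding hcomp_free_algebra mult_eq_0_iff by blast
qed

locale one_relator =
  fixes dx dy :: nat and f :: "gword \<Rightarrow>\<^sub>0 'k::field"
begin

abbreviation "free \<equiv> free_algebra dx dy :: ('k, gword \<Rightarrow>\<^sub>0 'k) graded_algebra"
abbreviation "rel \<equiv> relation_ideal dx dy f"
abbreviation "S \<equiv> one_relator_algebra dx dy f"

definition cls :: "(gword \<Rightarrow>\<^sub>0 'k) \<Rightarrow> (gword \<Rightarrow>\<^sub>0 'k) set" where
  "cls F = rel +>\<^bsub>free\<^esub> F"

sublocale free: ring free by (rule ring_free_algebra)

sublocale rel: ideal rel free
  unfolding relation_ideal_def by (rule free.genideal_ideal) simp

lemma relator_in: "f \<in> rel"
  unfolding relation_ideal_def by (rule free.genideal_self') simp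

text \<open>The elements satisfying \<open>P\<close> form an ideal containing \<open>f\<close>,
  hence contain the least such ideal. Negatives are obtained as products with -1.\<close>

lemma rel_induct [consumes 1, case_names zero relator add mult]:
  assumes F: "F \<in> rel"
    and P: "P 0" "P f" "\<And>F H. P F \<Longrightarrow> P H \<Longrightarrow> P (F + H)" "\<And>F A. P F \<Longrightarrow> P (A * F) \<and> P (F * A)"
  shows "P F"
proof -
  have "ideal {F. P F} free"
  proof (rule idealI)
    show "subgroup {F. P F} (add_monoid free)"
    proof (rule free.add.subgroupI)
      fix F assume "F \<in> {F. P F}"
      hence "P (- 1 * F)" using P(4) by blast
      thus "\<ominus>\<^bsub>free\<^esub> F \<in> {F. P F}" using free_algebra_minus[where F = 0 and H = F and dx = dx and dy = dy] by (simp add: a_minus_def)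
    qed (use P in auto)
  qed (use P ring_free_algebra in auto)
  from free.genideal_minimal[OF this, of "{f}"] P(2) F show ?thesis
    unfolding relation_ideal_def by auto
qed

lemma cls_eq_iff: "cls F = cls H \<longleftrightarrow> F - H \<in> rel"
  unfolding cls_def using free.quotient_eq_iff_same_a_r_cos[OF rel.ideal_axioms, of F H] by (simp add: free_algebra_minus)

lemma cls_mem: "H \<in> cls F \<longleftrightarrow> H - F \<in> rel"
proof -
  have "H \<in> cls F \<longleftrightarrow> (\<exists>h\<in>rel. H = h + F)" unfolding cls_def a_r_coset_def' by auto
  also have "\<dots> \<longleftrightarrow> H - F \<in> rel" by (auto simp: diff_eq_eq[symmetric])
  finally show ?thesis .
qed

lemma carrier_S: "carrier S = range cls"
  unfolding one_relator_algebra_def quotient_algebra_def A_RCOSETS_def' cls_def by auto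

lemma cls_add: "cls F \<oplus>\<^bsub>S\<^esub> cls H = cls (F + H)"
  unfolding one_relator_algebra_def quotient_algebra_def cls_def using rel.a_rcos_sum[of F H] by simp

lemma cls_mult: "cls F \<otimes>\<^bsub>S\<^esub> cls H = cls (F * H)"
  unfolding one_relator_algebra_def quotient_algebra_def cls_def using rel.rcoset_mult_add[of F H] by simp

lemma one_S: "\<one>\<^bsub>S\<^esub> = cls 1" and hcomp_S: "hcomp S n = cls ` hcomp free n"
  unfolding one_relator_algebra_def quotient_algebra_def cls_def by simp_all

lemma zero_S: "\<zero>\<^bsub>S\<^esub> = cls 0"
proof -
  have "rel = cls 0" unfolding cls_def a_r_coset_def' by simp
  thus ?thesis by (simp add: one_relator_algebra_def quotient_algebra_def)
qed

lemma rel_scale: "F \<in> rel \<Longrightarrow> Poly_Mapping.map ((*) c) F \<in> rel"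
  using rel.I_l_closed[of F "Poly_Mapping.single 0 c"] by (simp add: free_algebra_scale)

lemma cls_scale: "c \<odot>\<^bsub>S\<^esub> cls F = cls (Poly_Mapping.map ((*) c) F)"
proof -
  \<comment> \<open>Scalar multiplication on the quotient is a union over representatives; each of
    them must contribute the same coset.\<close>
  have "cls (Poly_Mapping.map ((*) c) H) = cls (Poly_Mapping.map ((*) c) F)" if "H \<in> cls F" for H
  proof -
    have "Poly_Mapping.map ((*) c) (H - F) = Poly_Mapping.map ((*) c) H - Poly_Mapping.map ((*) c) F"
      by (rule poly_mapping_eqI) (simp add: lookup_minus ring_distribs)
    thus ?thesis using rel_scale[of "H - F" c] that by (simp add: cls_eq_iff cls_mem)
  qed
  moreover have "F \<in> cls F" by (simp add: cls_mem rel.zero_closed[simplified])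
  ultimately have "(\<Union>H\<in>cls F. cls (Poly_Mapping.map ((*) c) H)) = cls (Poly_Mapping.map ((*) c) F)" by blast
  thus ?thesis by (simp add: one_relator_algebra_def quotient_algebra_def cls_def)
qed

lemmas cls_simps = cls_add cls_mult cls_scale

lemma cls_in [simp]: "cls F \<in> carrier S" by (simp add: carrier_S)

lemma abelian_monoid_S: "abelian_monoid S"
  by (intro abelian_monoidI) (auto simp: carrier_S zero_S cls_add add_ac)

lemma finsum_S: "finite K \<Longrightarrow> finsum S (\<lambda>k. cls (h k)) K = cls (sum h K)"
proof (induction K rule: finite_induct)
  interpret abelian_monoid S by (rule abelian_monoid_S)
  case (insert k K)
  thus ?case by (subst finsum_insert) (auto simp: cls_add)
qed (simp add: abelian_monoid.finsum_empty[OF abelian_monoid_S] zero_S)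

lemma zero_in_hcomp: "cls 0 \<in> hcomp S n"
  unfolding hcomp_S by (intro imageI) (simp add: hcomp_free_algebra)

text \<open>Cutting a word of degree below \<open>n\<close> gives two words of degree below
  \<open>n\<close>, and a multiple of \<open>F\<close> evaluates \<open>F\<close> at one of them. So
  vanishing in low degrees passes to multiples.\<close>

lemma rel_low_degree:
  assumes f: "f \<in> hcomp free n" and F: "F \<in> rel" and w: "int (word_deg dx dy w) < n"
  shows "Poly_Mapping.lookup F w = 0"
  using F w
proof (induction F arbitrary: w rule: rel_induct)
  case (mult F A)
  have *: "word_deg dx dy w = word_deg dx dy (Word (take k (letters w))) + word_deg dx dy (Word (drop k (letters w)))" for w k
    by (simp flip: sum_list_append map_append)
  show ?case
  proof (intro conjI allI impI)
    fix w assume w: "int (word_deg dx dy w) < n"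
    have low: "int (word_deg dx dy (Word (take k (letters w)))) < n" "int (word_deg dx dy (Word (drop k (letters w)))) < n"
      for k using w *[of w k] by linarith+
    show "Poly_Mapping.lookup (A * F) w = 0" "Poly_Mapping.lookup (F * A) w = 0"
      unfolding lookup_gword_times using mult low by (auto intro!: sum.neutral)
  qed
qed (use f in \<open>auto simp: hcomp_free_algebra lookup_add\<close>)

section \<open>The degree of the relation\<close>

text \<open>\<open>F\<close> is its constant term plus \<open>x\<close> times
  \<open>left_quotient Gx F\<close> plus \<open>y\<close> times \<open>left_quotient Gy F\<close>;
  these are one-sided Fox derivatives.\<close>

definition left_quotient :: "gen \<Rightarrow> (gword \<Rightarrow>\<^sub>0 'k) \<Rightarrow> gword \<Rightarrow>\<^sub>0 'k" where
  "left_quotient s F = Abs_poly_mapping (\<lambda>w. Poly_Mapping.lookup F (Word (s # letters w)))"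

lemma lookup_left_quotient [simp]:
  "Poly_Mapping.lookup (left_quotient s F) w = Poly_Mapping.lookup F (Word (s # letters w))"
proof -
  let ?K = "(\<lambda>w. Word (tl (letters w))) ` Poly_Mapping.keys F"
  have "w \<in> ?K" if "Poly_Mapping.lookup F (Word (s # letters w)) \<noteq> 0" for w
    by (rule image_eqI[of _ _ "Word (s # letters w)"]) (use that in \<open>auto simp: in_keys_iff\<close>)
  thus ?thesis unfolding left_quotient_def by (subst lookup_Abs_restricted[where K = ?K]) auto
qed

lemma left_quotient_add: "left_quotient s (F + H) = left_quotient s F + left_quotient s H"
  by (rule poly_mapping_eqI) (simp add: lookup_add)

lemma left_quotient_scale: "left_quotient s (Poly_Mapping.map ((*) c) F) = Poly_Mapping.map ((*) c) (left_quotient s F)"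
  by (rule poly_mapping_eqI) simp

text \<open>In a word beginning with \<open>s\<close>, every cut behind the first letter leaves this
  letter to \<open>F\<close>. The cut in front of it hands the whole word to \<open>H\<close> and
  contributes only the constant term of \<open>F\<close>.\<close>

lemma left_quotient_times:
  "left_quotient s (F * H) = left_quotient s F * H + Poly_Mapping.map ((*) (Poly_Mapping.lookup F 0)) (left_quotient s H)"
proof (rule poly_mapping_eqI)
  fix w
  have "Poly_Mapping.lookup (left_quotient s (F * H)) w = (\<Sum>k\<le>Suc (length (letters w)).
      Poly_Mapping.lookup F (Word (take k (s # letters w))) * Poly_Mapping.lookup H (Word (drop k (s # letters w))))"
    by (simp add: lookup_gword_times)
  thus "Poly_Mapping.lookup (left_quotient s (F * H)) w = Poly_Mapping.lookup
      (left_quotient s F * H + Poly_Mapping.map ((*) (Poly_Mapping.lookup F 0)) (left_quotient s H)) w"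
    by (subst (asm) sum.atMost_Suc_shift) (simp add: lookup_add lookup_gword_times zero_gword_def)
qed

lemma left_quotient_hcomp:
  "F \<in> hcomp free n \<Longrightarrow> left_quotient s F \<in> hcomp free (n - int (gen_deg dx dy s))"
  by (auto simp: hcomp_free_algebra)

text \<open>
  Fox calculus: \<open>fox U V\<close> is the derivation with values \<open>U\<close> at \<open>x\<close> and \<open>V\<close> at \<open>y\<close>, where the algebra acts on the left
  through the augmentation.
\<close>

definition fox :: "(gword \<Rightarrow>\<^sub>0 'k) \<Rightarrow> (gword \<Rightarrow>\<^sub>0 'k) \<Rightarrow> (gword \<Rightarrow>\<^sub>0 'k) \<Rightarrow> gword \<Rightarrow>\<^sub>0 'k" where
  "fox U V F = U * left_quotient Gx F + V * left_quotient Gy F"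

lemma fox_add: "fox U V (F + H) = fox U V F + fox U V H"
  by (simp add: fox_def left_quotient_add ring_distribs)

lemma fox_scale: "fox U V (Poly_Mapping.map ((*) c) F) = Poly_Mapping.map ((*) c) (fox U V F)"
  by (simp add: fox_def left_quotient_scale scale_times_right map_scale_add)

lemma fox_diff: "fox U V (F - H) = fox U V F - fox U V H"
proof -
  have "fox U V (F - H) + fox U V H = fox U V F" by (simp flip: fox_add)
  thus ?thesis by (simp add: eq_diff_eq)
qed

text \<open>The Leibniz rule in which the left factor acts through its constant term; it becomes the
  cocycle identity in \<open>derivation_cocycle\<close>.\<close>

lemma fox_times: "fox U V (F * H) = fox U V F * H + Poly_Mapping.map ((*) (Poly_Mapping.lookup F 0)) (fox U V H)"
  by (simp add: fox_def left_quotient_times ring_distribs mult.assoc scale_times_right map_scale_add add_ac)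

lemma fox_generator: "fox U V (Poly_Mapping.single (Word [s]) 1) = (case s of Gx \<Rightarrow> U | Gy \<Rightarrow> V)"
proof -
  have "left_quotient t (Poly_Mapping.single (Word [s]) 1) = (if s = t then 1 else 0)" for t
    by (rule poly_mapping_eqI) (auto simp: lookup_single when_def lookup_one letters_Nil_iff)
  thus ?thesis by (auto simp: fox_def split: gen.split)
qed

lemma fox_hcomp:
  assumes "U \<in> hcomp free (int dx + m)" "V \<in> hcomp free (int dy + m)" "F \<in> hcomp free n"
  shows "fox U V F \<in> hcomp free (m + n)"
proof -
  have "U * left_quotient Gx F \<in> hcomp free (int dx + m + (n - int dx))"
    using left_quotient_hcomp[OF assms(3), of Gx] by (intro hcomp_free_times assms) simp
  moreover have "V * left_quotient Gy F \<in> hcomp free (int dy + m + (n - int dy))"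
    using left_quotient_hcomp[OF assms(3), of Gy] by (intro hcomp_free_times assms) simp
  ultimately show ?thesis unfolding fox_def by (intro hcomp_free_add) (simp_all add: algebra_simps)
qed

end

text \<open>Positivity of \<open>n\<close> keeps constants out of the ideal, so the constant term is
  well defined on \<open>S\<close> and is its augmentation.\<close>

locale graded_one_relator = one_relator dx dy f for dx dy and f :: "gword \<Rightarrow>\<^sub>0 'k::field" +
  fixes n :: int
  assumes dx_pos: "0 < dx" and dy_pos: "0 < dy" and f_hom: "f \<in> hcomp free n" and n_pos: "0 < n"
    and graded: "is_graded_algebra S"
begin

lemmas word_deg_zero [simp] = word_deg_eq_0[OF dx_pos dy_pos]

sublocale S: ring S
  using graded by (simp add: is_graded_algebra_def k_algebra_def)

lemma cls_uminus: "\<ominus>\<^bsub>S\<^esub> cls F = cls (- F)"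
  by (rule S.minus_equality) (simp_all add: cls_add zero_S)

lemma augmentation_ideal: "F \<in> rel \<Longrightarrow> Poly_Mapping.lookup F 0 = 0"
  using rel_low_degree[OF f_hom] n_pos by simp

text \<open>Existence splits off the homogeneous parts of positive degree (\<open>part\<close>);
  uniqueness holds because constant terms vanish on positive degrees and on
  \<open>rel\<close>.\<close>

lemma augmentation_cls: "augmentation S (cls F) = Poly_Mapping.lookup F 0"
  unfolding augmentation_def
proof (rule the_equality)
  define part where "part i = Poly_Mapping.mapp (\<lambda>w c. if int (word_deg dx dy w) = i then c else 0) F" for i
  have lookup_part: "Poly_Mapping.lookup (part i) w = (if int (word_deg dx dy w) = i then Poly_Mapping.lookup F w else 0)" for i w
    by (auto simp: part_def lookup_mapp when_def in_keys_iff)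
  define K where "K = {i \<in> (\<lambda>w. int (word_deg dx dy w)) ` Poly_Mapping.keys F. 1 \<le> i}"
  have K: "finite K" "K \<subseteq> {int 1..}" by (auto simp: K_def)
  have "(\<Oplus>\<^bsub>S\<^esub>i\<in>K. cls (part i)) \<in> tail_ideal S 1"
    unfolding tail_ideal_def using K
    by (auto simp: hcomp_S hcomp_free_algebra lookup_part intro!: exI[of _ K] exI[of _ "\<lambda>i. cls (part i)"])
  moreover have "cls F = Poly_Mapping.lookup F 0 \<odot>\<^bsub>S\<^esub> \<one>\<^bsub>S\<^esub> \<oplus>\<^bsub>S\<^esub> (\<Oplus>\<^bsub>S\<^esub>i\<in>K. cls (part i))"
  proof -
    have "F = Poly_Mapping.map ((*) (Poly_Mapping.lookup F 0)) 1 + sum part K"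
    proof (rule poly_mapping_eqI)
      fix w
      have "(\<Sum>i\<in>K. Poly_Mapping.lookup (part i) w) = (\<Sum>i\<in>K. if i = int (word_deg dx dy w) then Poly_Mapping.lookup F w else 0)"
        by (intro sum.cong refl) (auto simp: lookup_part)
      also have "\<dots> = (if int (word_deg dx dy w) \<in> K then Poly_Mapping.lookup F w else 0)"
        using K(1) by simp
      also have "\<dots> = (if w = 0 then 0 else Poly_Mapping.lookup F w)"
      proof (cases "w = 0 \<or> Poly_Mapping.lookup F w = 0")
        case False
        hence "w \<in> Poly_Mapping.keys F" "word_deg dx dy w \<noteq> 0"
          using word_deg_zero[of w] unfolding in_keys_iff by blast+
        moreover from this(2) have "1 \<le> int (word_deg dx dy w)" by linarith
        ultimately show ?thesis using False by (auto simp: K_def)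
      qed (auto simp: K_def)
      finally show "Poly_Mapping.lookup F w = Poly_Mapping.lookup (Poly_Mapping.map ((*) (Poly_Mapping.lookup F 0)) 1 + sum part K) w"
        by (simp add: lookup_add lookup_sum lookup_one when_def)
    qed
    thus ?thesis by (simp add: finsum_S[OF K(1)] one_S cls_simps)
  qed
  ultimately show "\<exists>b\<in>tail_ideal S 1. cls F = Poly_Mapping.lookup F 0 \<odot>\<^bsub>S\<^esub> \<one>\<^bsub>S\<^esub> \<oplus>\<^bsub>S\<^esub> b" by blast
next
  fix c assume "\<exists>b\<in>tail_ideal S 1. cls F = c \<odot>\<^bsub>S\<^esub> \<one>\<^bsub>S\<^esub> \<oplus>\<^bsub>S\<^esub> b"
  then obtain K h where K: "finite K" "K \<subseteq> {int 1..}" "h \<in> (\<Pi> i\<in>K. hcomp S i)"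
    and F: "cls F = c \<odot>\<^bsub>S\<^esub> \<one>\<^bsub>S\<^esub> \<oplus>\<^bsub>S\<^esub> (\<Oplus>\<^bsub>S\<^esub>i\<in>K. h i)"
    unfolding tail_ideal_def by blast
  have "\<forall>i\<in>K. \<exists>H. H \<in> hcomp free i \<and> h i = cls H" using K(3) unfolding hcomp_S by blast
  then obtain H where H: "\<And>i. i \<in> K \<Longrightarrow> H i \<in> hcomp free i" "\<And>i. i \<in> K \<Longrightarrow> h i = cls (H i)" by metis
  have "(\<Oplus>\<^bsub>S\<^esub>i\<in>K. h i) = (\<Oplus>\<^bsub>S\<^esub>i\<in>K. cls (H i))" by (rule S.finsum_cong') (auto simp: H(2))
  hence "cls F = cls (Poly_Mapping.map ((*) c) 1 + sum H K)"
    by (simp add: F finsum_S[OF K(1)] one_S cls_simps)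
  hence "Poly_Mapping.lookup (F - (Poly_Mapping.map ((*) c) 1 + sum H K)) 0 = 0"
    unfolding cls_eq_iff by (rule augmentation_ideal)
  moreover have "Poly_Mapping.lookup (H i) 0 = 0" if "i \<in> K" for i
    using H(1)[OF that] K(2) that by (auto simp: hcomp_free_algebra)
  ultimately show "c = Poly_Mapping.lookup F 0"
    by (simp add: lookup_minus lookup_add lookup_sum lookup_one)
qed

text \<open>It suffices to test the derivation on the relator. For \<open>F\<close> in the ideal,
  the Leibniz terms of \<open>A * F\<close> are multiples of \<open>F\<close> and of
  \<open>fox U V F\<close>; in \<open>F * A\<close> the second term carries the constant term of
  \<open>F\<close>, which is zero.\<close>

lemma fox_rel:
  assumes f: "fox U V f \<in> rel" and F: "F \<in> rel"
  shows "fox U V F \<in> rel"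
proof -
  have add: "a + b \<in> rel" if "a \<in> rel" "b \<in> rel" for a b using rel.a_closed[OF that] by simp
  have mult: "a * b \<in> rel" "b * a \<in> rel" if "a \<in> rel" for a b using rel.I_l_closed[OF that, of b] rel.I_r_closed[OF that, of b] by simp_all
  have zero: "0 \<in> rel" using rel.zero_closed by simp
  have "F \<in> rel \<and> fox U V F \<in> rel"
    using F
  proof (induction rule: rel_induct)
    case zero
    show ?case using \<open>0 \<in> rel\<close> fox_scale[of U V 0 0] by simp
  next
    case (mult F A)
    thus ?case
      using add rel_scale \<open>\<And>a b. a \<in> rel \<Longrightarrow> a * b \<in> rel\<close> \<open>\<And>a b. a \<in> rel \<Longrightarrow> b * a \<in> rel\<close>
      by (auto simp: fox_times augmentation_ideal intro!: add)
  qed (use f relator_in add fox_add in auto)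
  thus ?thesis ..
qed

definition quotient_derivation :: "(gword \<Rightarrow>\<^sub>0 'k) \<Rightarrow> (gword \<Rightarrow>\<^sub>0 'k) \<Rightarrow> (gword \<Rightarrow>\<^sub>0 'k) set \<Rightarrow> (gword \<Rightarrow>\<^sub>0 'k) set" where
  "quotient_derivation U V X = cls (fox U V (SOME F. cls F = X))"

lemma quotient_derivation_cls:
  assumes "fox U V f \<in> rel"
  shows "quotient_derivation U V (cls F) = cls (fox U V F)"
proof -
  have "cls (SOME F'. cls F' = cls F) = cls F" by (rule someI_ex) blast
  hence "(SOME F'. cls F' = cls F) - F \<in> rel" by (simp add: cls_eq_iff)
  from fox_rel[OF assms this] show ?thesis
    by (simp add: quotient_derivation_def cls_eq_iff fox_diff)
qed

section \<open>Derivations as 1-cocycles of the bar complex\<close>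

lemma tuples_1: "as \<in> tuples S (Suc 0) \<longleftrightarrow> (\<exists>F. as = [cls F])"
  by (auto simp: tuples_def length_Suc_conv carrier_S)

lemma cls_tuple [simp]: "[cls F] \<in> tuples S (Suc 0)"
  using tuples_1 by blast

lemma tuples_2: "as \<in> tuples S (Suc (Suc 0)) \<longleftrightarrow> (\<exists>F H. as = [cls F, cls H])"
  by (auto simp: tuples_def length_Suc_conv carrier_S)

lemma residue_module_sel [simp]:
  "carrier (residue_module S) = UNIV" "add (residue_module S) = (+)"
  "ract (residue_module S) c (cls F) = c * Poly_Mapping.lookup F 0"
  "mcomp (residue_module S) i = (if i = 0 then UNIV else {0})"
  by (simp_all add: residue_module_def augmentation_cls)

lemma shifted_regular_sel [simp]:
  "carrier (shift m (regular_module S)) = carrier S" "zero (shift m (regular_module S)) = zero S"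
  "add (shift m (regular_module S)) = add S" "ract (shift m (regular_module S)) = mult S"
  "mcomp (shift m (regular_module S)) i = hcomp S (m + i)"
  by (simp_all add: shift_def regular_module_def)

text \<open>Negation and finite sums depend only on carrier, zero and addition, which the regular
  module and its shifts share with \<open>S\<close>.\<close>

lemma shifted_regular_ops [simp]:
  "a_inv (shift m (regular_module S)) = a_inv S" "finsum (shift m (regular_module S)) = finsum S"
  by (simp_all add: a_inv_def m_inv_def finsum_def finprod_def fun_eq_iff)

lemma scal_residue [simp]: "scal S (residue_module S) t c = c * t"
  by (simp add: scal_def one_S cls_scale)

lemma scal_regular [simp]: "scal S (shift m (regular_module S)) t (cls F) = t \<odot>\<^bsub>S\<^esub> cls F"
  by (simp add: scal_def one_S cls_simps flip: scale_times_right)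

text \<open>With \<open>e\<close> the augmentation, the differential evaluates to
  \<open>c(\<mu> e(a), b) - c(\<mu>, ab) + c(\<mu>, a) b\<close>; for a multiple
  \<open>\<mu>\<close> of a derivation this is zero by the Leibniz rule
  \<open>fox_times\<close>.\<close>

lemma derivation_cocycle:
  assumes U: "U \<in> hcomp free (int dx + m)" and V: "V \<in> hcomp free (int dy + m)" and rel: "fox U V f \<in> rel"
  defines "c \<equiv> \<lambda>\<mu> as. if as \<in> tuples S 1 then \<mu> \<odot>\<^bsub>S\<^esub> quotient_derivation U V (hd as) else \<zero>\<^bsub>S\<^esub>"
  shows "c \<in> cocycle_set S 1 (residue_module S) (shift m (regular_module S))"
proof -
  have c: "c \<mu> [cls F] = cls (Poly_Mapping.map ((*) \<mu>) (fox U V F))" for \<mu> F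
    unfolding c_def by (simp add: quotient_derivation_cls[OF rel] cls_scale)
  have out: "c \<mu> as = \<zero>\<^bsub>S\<^esub>" if "as \<notin> tuples S (Suc 0)" for \<mu> as using that by (simp add: c_def)
  have add: "Poly_Mapping.map ((*) (a + b)) F = Poly_Mapping.map ((*) a) F + Poly_Mapping.map ((*) b) F"
    and comm: "Poly_Mapping.map ((*) a) (Poly_Mapping.map ((*) b) F) = Poly_Mapping.map ((*) b) (Poly_Mapping.map ((*) a) F)"
    and mult: "Poly_Mapping.map ((*) (a * b)) F = Poly_Mapping.map ((*) a) (Poly_Mapping.map ((*) b) F)"
    for a b and F H :: "gword \<Rightarrow>\<^sub>0 'k"
    by (rule poly_mapping_eqI; simp add: lookup_add ring_distribs mult.assoc mult.left_commute)+
  have deg: "c \<mu> as \<in> hcomp S (m + (p + sum_list qs))"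
    if *: "\<mu> \<in> (if p = 0 then UNIV else {0})" "length as = Suc 0" "list_all2 (\<lambda>a q. a \<in> hcomp S q) as qs" for \<mu> as p qs
  proof -
    obtain a q where a: "as = [a]" "qs = [q]" "a \<in> hcomp S q"
      using *(2,3) by (auto simp: length_Suc_conv list_all2_Cons1)
    then obtain F where F: "F \<in> hcomp free q" "a = cls F" by (auto simp: hcomp_S)
    have "Poly_Mapping.map ((*) \<mu>) (fox U V F) \<in> hcomp free (m + (p + q))"
    proof (cases "p = 0")
      case True
      thus ?thesis using fox_hcomp[OF U V F(1)] by (simp add: hcomp_free_algebra)
    next
      case False
      hence "\<mu> = 0" using *(1) by simp
      thus ?thesis by (simp add: hcomp_free_algebra lookup_scale[of 0])
    qed
    thus ?thesis by (simp add: a F(2) c hcomp_S)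
  qed
  have cochain: "is_cochain S 1 (residue_module S) (shift m (regular_module S)) c"
    unfolding is_cochain_def
    using deg by (auto simp: tuples_1 out c carrier_S cls_simps fox_add fox_scale add map_scale_add mult mult.commute comm)
  have "coboundary S 1 (residue_module S) (shift m (regular_module S)) c = (\<lambda>_ _. \<zero>\<^bsub>S\<^esub>)"
  proof (intro ext)
    fix \<mu> as
    show "coboundary S 1 (residue_module S) (shift m (regular_module S)) c \<mu> as = \<zero>\<^bsub>S\<^esub>"
    proof (cases "as \<in> tuples S (Suc (Suc 0))")
      case True
      then obtain F H where as: "as = [cls F, cls H]" by (auto simp: tuples_2)
      let ?m = "\<lambda>a. Poly_Mapping.map ((*) a)"
      have "coboundary S 1 (residue_module S) (shift m (regular_module S)) c \<mu> as
        = cls (?m (\<mu> * Poly_Mapping.lookup F 0) (fox U V H)) \<oplus>\<^bsub>S\<^esub> cls (- ?m \<mu> (fox U V (F * H))) \<oplus>\<^bsub>S\<^esub> cls (?m \<mu> (fox U V F) * H)"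
        using True unfolding coboundary_def as
        by (simp add: c alt_sign_def merge_def cls_mult cls_uminus)
      also have "\<dots> = cls (?m (\<mu> * Poly_Mapping.lookup F 0) (fox U V H) + (- ?m \<mu> (fox U V (F * H))) + ?m \<mu> (fox U V F) * H)"
        by (simp add: cls_add)
      also have "?m (\<mu> * Poly_Mapping.lookup F 0) (fox U V H) + (- ?m \<mu> (fox U V (F * H))) + ?m \<mu> (fox U V F) * H = 0"
        by (simp add: fox_times map_scale_add mult scale_times_left)
      finally show ?thesis by (simp add: zero_S)
    qed (simp add: coboundary_def)
  qed
  thus ?thesis using cochain by (simp add: cocycle_set_def cochains_def)
qed

text \<open>
  In negative degree there are no 0-cochains, hence no 1-coboundaries, and a derivation has to vanish.
\<close>

lemma negative_derivation_zero:
  assumes gor: "gorenstein_condition S 2 l" and neg: "\<And>i. i < 0 \<Longrightarrow> hcomp S i = {\<zero>\<^bsub>S\<^esub>}" and m: "m < 0"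
    and U: "U \<in> hcomp free (int dx + m)" and V: "V \<in> hcomp free (int dy + m)" and rel: "fox U V f \<in> rel"
  shows "fox U V F \<in> rel"
proof -
  let ?M = "residue_module S" and ?N = "shift m (regular_module S)"
  define c where "c = (\<lambda>\<mu> as. if as \<in> tuples S 1 then \<mu> \<odot>\<^bsub>S\<^esub> quotient_derivation U V (hd as) else \<zero>\<^bsub>S\<^esub>)"
  have c: "c \<in> cocycle_set S 1 ?M ?N" unfolding c_def by (rule derivation_cocycle[OF U V rel])
  let ?W = "coboundary_set S 1 ?M ?N"
  \<comment> \<open>Cohomological degree 1 differs from the dimension 2, so the Gorenstein condition
    makes this Ext group zero.\<close>
  have "carrier (Ext S 1 ?M ?N) = {\<zero>\<^bsub>Ext S 1 ?M ?N\<^esub>}"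
    using gor[unfolded gorenstein_condition_def Let_def, THEN spec, THEN spec, of 1 m] by simp
  hence "?W +>\<^bsub>(cochains S 1 ?M ?N)\<lparr>carrier := cocycle_set S 1 ?M ?N\<rparr>\<^esub> c = ?W"
    using c unfolding Ext_def quotient_space_def A_RCOSETS_def' by auto
  \<comment> \<open>The equality of cosets is used elementwise: adding \<open>c\<close> to a
    coboundary gives a coboundary. As all coboundaries vanish at \<open>(1, [cls F])\<close> and at
    least one exists, \<open>c\<close> vanishes there as well.\<close>
  hence W: "(\<lambda>\<mu> as. w \<mu> as \<oplus>\<^bsub>S\<^esub> c \<mu> as) \<in> ?W" if "w \<in> ?W" for w
    using that unfolding a_r_coset_def' cochains_def by auto
  have W0: "w 1 [cls F] = \<zero>\<^bsub>S\<^esub>" if w: "w \<in> ?W" for w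
  proof -
    obtain c0 where c0: "is_cochain S 0 ?M ?N c0" "w = coboundary S 0 ?M ?N c0"
      using w by (auto simp: coboundary_set_def cochains_def)
    have "c0 \<mu> [] \<in> mcomp ?N (0 + sum_list [])" for \<mu>
    proof -
      have "\<mu> \<in> mcomp ?M 0 \<and> length [] = 0 \<and> list_all2 (\<lambda>a q. a \<in> hcomp S q) [] [] \<longrightarrow> c0 \<mu> [] \<in> mcomp ?N (0 + sum_list [])"
        using c0(1) unfolding is_cochain_def by blast
      thus ?thesis by simp
    qed
    hence "c0 \<mu> [] = \<zero>\<^bsub>S\<^esub>" for \<mu> using neg[OF m] by simp
    thus ?thesis
      unfolding c0(2) by (simp add: coboundary_def alt_sign_def)
  qed
  have "is_cochain S 0 ?M ?N (\<lambda>_ _. \<zero>\<^bsub>S\<^esub>)"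
    unfolding is_cochain_def using zero_in_hcomp scal_regular[of _ _ 0]
    by (simp add: zero_S cls_simps)
  hence "coboundary S 0 ?M ?N (\<lambda>_ _. \<zero>\<^bsub>S\<^esub>) \<in> ?W" by (simp add: coboundary_set_def cochains_def)
  from W0[OF W[OF this]] W0[OF this] have "c 1 [cls F] = \<zero>\<^bsub>S\<^esub>"
    by (simp add: c_def quotient_derivation_cls[OF rel] cls_scale zero_S)
  hence "cls (fox U V F) = cls 0"
    by (simp add: c_def quotient_derivation_cls[OF rel] cls_scale zero_S)
  thus ?thesis by (simp add: cls_eq_iff)
qed

end

lemma relation_degree:
  fixes f :: "gword \<Rightarrow>\<^sub>0 'k::field"
  assumes pos: "0 < dx" "0 < dy" and f: "f \<in> hcomp (free_algebra dx dy) n" "f \<noteq> 0"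
    and conn: "connected_graded (one_relator_algebra dx dy f)"
    and gor: "gorenstein_condition (one_relator_algebra dx dy f) 2 l"
  shows "int (dx + dy) \<le> n"
proof (rule ccontr)
  assume "\<not> ?thesis"
  hence small: "n < int dx + int dy" by simp
  interpret one_relator dx dy f .
  let ?c = "\<lambda>l. Poly_Mapping.lookup f (Word l)"
  \<comment> \<open>Connectedness embeds \<open>k\<close> into \<open>S\<close>, so the quotient is
    not zero.\<close>
  have one: "1 \<notin> rel"
  proof
    assume "1 \<in> rel"
    hence "(1::'k) \<odot>\<^bsub>S\<^esub> \<one>\<^bsub>S\<^esub> = 0 \<odot>\<^bsub>S\<^esub> \<one>\<^bsub>S\<^esub>" by (simp add: one_S cls_scale cls_eq_iff)
    moreover have "inj (\<lambda>c::'k. c \<odot>\<^bsub>S\<^esub> \<one>\<^bsub>S\<^esub>)" using conn by (simp add: connected_graded_def bij_betw_def)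
    ultimately show False by (metis injD zero_neq_one)
  qed
  note deg0 = word_deg_eq_0[OF pos]
  have hom: "int (word_deg dx dy w) = n" if "Poly_Mapping.lookup f w \<noteq> 0" for w
    using f(1) that by (auto simp: hcomp_free_algebra)
  obtain w where w: "Poly_Mapping.lookup f w \<noteq> 0" using f(2) by (metis lookup_zero poly_mapping_eqI)
  have n_pos: "0 < n"
  proof (rule ccontr)
    assume "\<not> ?thesis"
    hence n: "n = 0" using hom[OF w] by simp
    define a where "a = Poly_Mapping.lookup f 0"
    have "f = Poly_Mapping.single 0 a"
      using hom deg0 by (intro poly_mapping_eqI) (auto simp: lookup_single when_def a_def n)
    moreover from this have "a \<noteq> 0" using f(2) by auto
    ultimately have "Poly_Mapping.single 0 (inverse a) * f = 1" by (simp add: mult_single)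
    thus False using rel.I_l_closed[OF relator_in, of "Poly_Mapping.single 0 (inverse a)"] one by simp
  qed
  interpret graded_one_relator dx dy f n
    using pos f conn n_pos by unfold_locales (auto simp: connected_graded_def)
  have zero_rel: "0 \<in> rel" using rel.zero_closed by simp
  \<comment> \<open>A derivation of negative degree vanishes, so the value 1 at a generator would
    lie in the ideal.\<close>
  have contra: False
    if "m < 0" "U \<in> hcomp free (int dx + m)" "V \<in> hcomp free (int dy + m)" "fox U V f = 0" "U = 1 \<or> V = 1" for U V m
  proof -
    have neg: "hcomp S i = {\<zero>\<^bsub>S\<^esub>}" if "i < 0" for i
      using conn that unfolding connected_graded_def by blast
    have "fox U V f \<in> rel" using that(4) zero_rel by (simp only:)
    note vanish = negative_derivation_zero[OF gor neg that(1,2,3) this]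
    from vanish[of "Poly_Mapping.single (Word [Gx]) 1"] vanish[of "Poly_Mapping.single (Word [Gy]) 1"] that(5) one
    show False unfolding fox_generator by auto
  qed
  have one_hom: "1 \<in> hcomp free 0" and zero_hom: "0 \<in> hcomp free i" for i
    by (auto simp: hcomp_free_algebra lookup_one when_def)
  have "left_quotient Gx f \<noteq> 0"
    using contra[of "- int dx" 1 0] pos one_hom zero_hom by (auto simp: fox_def)
  then obtain w1 where w1: "?c (Gx # letters w1) \<noteq> 0" by (metis lookup_left_quotient lookup_zero poly_mapping_eqI)
  have "left_quotient Gy f \<noteq> 0"
    using contra[of "- int dy" 0 1] pos one_hom zero_hom by (auto simp: fox_def)
  then obtain w2 where w2: "?c (Gy # letters w2) \<noteq> 0" by (metis lookup_left_quotient lookup_zero poly_mapping_eqI)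
  have n: "n = int dx + int (word_deg dx dy w1)" "n = int dy + int (word_deg dx dy w2)"
    using hom[OF w1] hom[OF w2] by simp_all
  have first: "dx \<le> word_deg dx dy w \<or> dy \<le> word_deg dx dy w" if "w \<noteq> 0" for w
  proof (cases "letters w")
    case (Cons s t)
    thus ?thesis by (cases s) auto
  qed (use that in \<open>simp add: letters_Nil_iff\<close>)
  \<comment> \<open>By \<open>small\<close>, \<open>w1\<close> has degree below \<open>dy\<close>
    and \<open>w2\<close> has degree below \<open>dx\<close>. If both were nonempty,
    \<open>first\<close> would give \<open>dx \<le> deg w1 < dy\<close> and
    \<open>dy \<le> deg w2 < dx\<close>.\<close>
  have "w1 = 0 \<or> w2 = 0" using first[of w1] first[of w2] n small by linarith
  hence "n = int dx \<or> n = int dy" using n by auto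
  \<comment> \<open>If \<open>f\<close> has the degree of the letter \<open>s\<close>, its quotient
    by \<open>s\<close> has degree 0 and is a scalar.\<close>
  have solve: "left_quotient s f = Poly_Mapping.single 0 (?c [s]) \<and> ?c [s] \<noteq> 0"
    if "n = int (gen_deg dx dy s)" "left_quotient s f \<noteq> 0" for s
  proof -
    have eq: "left_quotient s f = Poly_Mapping.single 0 (?c [s])"
    proof (rule poly_mapping_eqI)
      fix w
      show "Poly_Mapping.lookup (left_quotient s f) w = Poly_Mapping.lookup (Poly_Mapping.single 0 (?c [s])) w"
        using hom[of "Word (s # letters w)"] that(1) deg0[of w]
        by (auto simp: lookup_single when_def)
    qed
    thus ?thesis using that(2) by auto
  qed
  have times_single_zero: "H * Poly_Mapping.single 0 b = Poly_Mapping.map ((*) b) H" for H :: "gword \<Rightarrow>\<^sub>0 'k" and b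
  proof -
    have "Poly_Mapping.single 0 b = Poly_Mapping.map ((*) b) (1 :: gword \<Rightarrow>\<^sub>0 'k)"
      by (rule poly_mapping_eqI) (auto simp: lookup_single lookup_one when_def)
    thus ?thesis by (simp flip: scale_times_right)
  qed
  show False
    using \<open>n = int dx \<or> n = int dy\<close>
  proof
    assume "n = int dy"
    hence b: "left_quotient Gy f = Poly_Mapping.single 0 (?c [Gy])" "?c [Gy] \<noteq> 0"
      using solve[of Gy] \<open>left_quotient Gy f \<noteq> 0\<close> by auto
    \<comment> \<open>The scalar coefficient of \<open>y\<close> is divided out so that
      \<open>left_quotient Gx f\<close> and \<open>V\<close> times this coefficient cancel; the
      value 1 at \<open>x\<close> puts the derivation in degree \<open>- dx\<close>.\<close>
    define d where "d = - inverse (?c [Gy])"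
    define V where "V = Poly_Mapping.map ((*) d) (left_quotient Gx f)"
    have "V * Poly_Mapping.single 0 (?c [Gy]) = - left_quotient Gx f"
      using b(2) unfolding times_single_zero by (intro poly_mapping_eqI, simp add: V_def, simp add: d_def)
    hence "fox 1 V f = 0" using b(1) by (simp add: fox_def)
    moreover have "V \<in> hcomp free (int dy + - int dx)"
      using left_quotient_hcomp[OF f(1), of Gx] \<open>n = int dy\<close> by (simp add: V_def hcomp_free_algebra)
    ultimately show False using contra[of "- int dx" 1 V] pos one_hom by simp
  next
    assume "n = int dx"
    hence b: "left_quotient Gx f = Poly_Mapping.single 0 (?c [Gx])" "?c [Gx] \<noteq> 0"
      using solve[of Gx] \<open>left_quotient Gx f \<noteq> 0\<close> by auto
    define d where "d = - inverse (?c [Gx])"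
    define U where "U = Poly_Mapping.map ((*) d) (left_quotient Gy f)"
    have "U * Poly_Mapping.single 0 (?c [Gx]) = - left_quotient Gy f"
      using b(2) unfolding times_single_zero by (intro poly_mapping_eqI, simp add: U_def, simp add: d_def)
    hence "fox U 1 f = 0" using b(1) by (simp add: fox_def)
    moreover have "U \<in> hcomp free (int dx + - int dy)"
      using left_quotient_hcomp[OF f(1), of Gy] \<open>n = int dx\<close> by (simp add: U_def hcomp_free_algebra)
    ultimately show False using contra[of "- int dy" U 1] pos one_hom by simp
  qed
qed

section \<open>The quiver of the Beilinson algebra\<close>

lemma sum_list_map_rev: "sum_list (map h (rev l)) = sum_list (map h l)" for h :: "'a \<Rightarrow> 'b::comm_monoid_add"
  by (metis rev_map sum_list_rev)

lemma finite_gen: "finite (UNIV :: gen set)"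
proof -
  have "UNIV = {Gx, Gy}" using gen.exhaust by auto
  thus ?thesis by (metis finite.emptyI finite.insertI)
qed

lemma quiver_S_sel [simp]:
  "verts (quiver_S dx dy) = {..<dx + dy}" "(i, s) \<in> arcs (quiver_S dx dy) \<longleftrightarrow> i + gen_deg dx dy s < dx + dy"
  "tail (quiver_S dx dy) (i, s) = i" "head (quiver_S dx dy) (i, s) = i + gen_deg dx dy s"
  by (simp_all add: quiver_S_def)

lemma fin_digraph_quiver_S: "fin_digraph (quiver_S dx dy)"
proof
  have "arcs (quiver_S dx dy) \<subseteq> {..<dx + dy} \<times> UNIV" by auto
  thus "finite (arcs (quiver_S dx dy))" using finite_gen by (meson finite_SigmaI finite_lessThan finite_subset)
qed auto

lemma loopfree_quiver_S:
  assumes "0 < dx" "0 < dy"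
  shows "loopfree_digraph (quiver_S dx dy)"
proof -
  interpret fin_digraph "quiver_S dx dy" by (rule fin_digraph_quiver_S)
  show ?thesis
  proof unfold_locales
    fix e :: "nat \<times> gen"
    obtain i s where e: "e = (i, s)" by (cases e)
    show "tail (quiver_S dx dy) e \<noteq> head (quiver_S dx dy) e" using assms by (cases s) (simp_all add: e)
  qed
qed

fun arrows_from :: "nat \<Rightarrow> nat \<Rightarrow> nat \<Rightarrow> gen list \<Rightarrow> (nat \<times> gen) list" where
  "arrows_from dx dy i [] = []"
| "arrows_from dx dy i (s # l) = (i, s) # arrows_from dx dy (i + gen_deg dx dy s) l"

lemma map_snd_arrows_from [simp]: "map snd (arrows_from dx dy i l) = l"
  by (induction l arbitrary: i) auto

lemma length_arrows_from [simp]: "length (arrows_from dx dy i l) = length l"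
  by (induction l arbitrary: i) auto

lemma take_arrows_from: "take k (arrows_from dx dy i l) = arrows_from dx dy i (take k l)"
  by (induction l arbitrary: i k) (auto simp: take_Cons split: nat.split)

lemma drop_arrows_from:
  "drop k (arrows_from dx dy i l) = arrows_from dx dy (i + sum_list (map (gen_deg dx dy) (take k l))) (drop k l)"
  by (induction l arbitrary: i k) (auto simp: drop_Cons take_Cons add.assoc split: nat.split)

lemma awlast_arrows_from:
  "pre_digraph.awlast (quiver_S dx dy) i (arrows_from dx dy i l) = i + sum_list (map (gen_deg dx dy) l)"
  by (induction l arbitrary: i) (auto simp: add.assoc)

text \<open>The vertices on a path are partial sums of degrees and do not decrease, so bounding the
  last one bounds all of them, and the letters with the source recover the arrows.\<close>

lemma paths_quiver_S:
  "(i, p) \<in> paths (quiver_S dx dy)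
    \<longleftrightarrow> p = arrows_from dx dy i (map snd p) \<and> i + sum_list (map (gen_deg dx dy) (map snd p)) < dx + dy"
proof (induction p arbitrary: i)
  case (Cons a p)
  have wf: "wf_digraph (quiver_S dx dy)" using fin_digraph_quiver_S fin_digraph.axioms(1) by blast
  obtain i' s where a: "a = (i', s)" by (cases a)
  show ?case by (auto simp: a Cons_in_paths[OF wf] Cons.IH add.assoc)
qed auto

text \<open>The exponent of \<open>\<xi>\<close> in the action of \<open>g\<close> on a generator,
  which is also the number of sheets that the lifted arrow climbs.\<close>

definition gen_weight :: "gen \<Rightarrow> int" where
  "gen_weight s = (case s of Gx \<Rightarrow> 1 | Gy \<Rightarrow> - 1)"

lemma lookup_arrow_scaling:
  fixes \<xi> :: "'k::field"
  assumes "\<xi> \<noteq> 0"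
  shows "Poly_Mapping.lookup (arrow_scaling \<xi> F) (u, p)
    = \<xi> powi sum_list (map (\<lambda>e. gen_weight (snd e)) p) * Poly_Mapping.lookup F (u, p)"
proof -
  have prod: "(\<Prod>(i, s)\<leftarrow>p. case s of Gx \<Rightarrow> \<xi> | Gy \<Rightarrow> inverse \<xi>) = \<xi> powi sum_list (map (\<lambda>e. gen_weight (snd e)) p)"
    for p :: "(nat \<times> gen) list"
    using assms by (induction p) (auto simp: gen_weight_def power_int_add power_int_minus split: gen.split)
  have "Poly_Mapping.lookup (arrow_scaling \<xi> F) (u, p) = (\<Sum>x\<in>Poly_Mapping.keys F.
      if x = (u, p) then \<xi> powi sum_list (map (\<lambda>e. gen_weight (snd e)) p) * Poly_Mapping.lookup F (u, p) else 0)"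
    unfolding arrow_scaling_def lookup_sum
    by (intro sum.cong refl) (auto simp: prod lookup_single when_def split: prod.split)
  thus ?thesis by (auto simp: in_keys_iff)
qed

section \<open>The comparison of the path algebra with the Beilinson algebra\<close>

context one_relator
begin

text \<open>The arrows traversed first form the right factor of a product of paths, hence the right
  end of the word; this is why the letters are reversed.\<close>

definition entry :: "((nat \<times> (nat \<times> gen) list) \<Rightarrow>\<^sub>0 'k) \<Rightarrow> nat \<Rightarrow> nat \<Rightarrow> gword \<Rightarrow>\<^sub>0 'k" where
  "entry F i j = Abs_poly_mapping (\<lambda>w. if i + word_deg dx dy w = j
     then Poly_Mapping.lookup F (i, arrows_from dx dy i (rev (letters w))) else 0)"

lemma lookup_entry: "Poly_Mapping.lookup (entry F i j) w = (if i + word_deg dx dy w = j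
    then Poly_Mapping.lookup F (i, arrows_from dx dy i (rev (letters w))) else 0)"
proof -
  let ?K = "(\<lambda>(i, p). Word (rev (map snd p))) ` Poly_Mapping.keys F"
  have "w \<in> ?K" if "Poly_Mapping.lookup F (i, arrows_from dx dy i (rev (letters w))) \<noteq> 0" for w
    by (rule image_eqI[of _ _ "(i, arrows_from dx dy i (rev (letters w)))"]) (use that in \<open>auto simp: in_keys_iff\<close>)
  thus ?thesis unfolding entry_def by (subst lookup_Abs_restricted[where K = ?K]) auto
qed

lemma entry_hcomp: "entry F i j \<in> hcomp free (int j - int i)"
  by (auto simp: hcomp_free_algebra lookup_entry)

lemma entry_add: "entry (F + H) i j = entry F i j + entry H i j"
  and entry_scale: "entry (Poly_Mapping.map ((*) c) F) i j = Poly_Mapping.map ((*) c) (entry F i j)"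
  by (rule poly_mapping_eqI; simp add: lookup_entry lookup_add)+

text \<open>A cut of a word determines an intermediate vertex \<open>m\<close>, which is at most
  \<open>j\<close>; the bound on \<open>j\<close> keeps it inside the range of summation.\<close>

lemma entry_mult:
  assumes "j < dx + dy"
  shows "entry (path_mult (quiver_S dx dy) F H) i j = (\<Sum>m<dx + dy. entry F m j * entry H i m)"
proof (rule poly_mapping_eqI)
  fix w
  let ?lk = "Poly_Mapping.lookup" and ?A = "arrows_from dx dy" and ?d = "\<lambda>l. sum_list (map (gen_deg dx dy) l)"
  define l where "l = letters w"
  define N where "N = length l"
  \<comment> \<open>For a cut after \<open>k\<close> letters, \<open>drop k l\<close> is traversed
    first, and its endpoint is the only \<open>m\<close> that contributes.\<close>
  define h where "h k = ?lk F (i + ?d (drop k l), ?A (i + ?d (drop k l)) (rev (take k l))) * ?lk H (i, ?A i (rev (drop k l)))" for k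
  have split: "?d l = ?d (take k l) + ?d (drop k l)" for k by (simp flip: sum_list_append map_append)
  have inner: "(\<Sum>m<dx + dy. (if m + ?d (take k l) = j then ?lk F (m, ?A m (rev (take k l))) else 0)
      * (if i + ?d (drop k l) = m then ?lk H (i, ?A i (rev (drop k l))) else 0))
    = (if i + ?d l = j then h k else 0)" for k
  proof -
    have "(\<Sum>m<dx + dy. (if m + ?d (take k l) = j then ?lk F (m, ?A m (rev (take k l))) else 0)
        * (if i + ?d (drop k l) = m then ?lk H (i, ?A i (rev (drop k l))) else 0))
      = (\<Sum>m<dx + dy. if m = i + ?d (drop k l) then if i + ?d l = j then h k else 0 else 0)"
      using split[of k] by (intro sum.cong refl) (auto simp: h_def)
    also have "\<dots> = (if i + ?d l = j then h k else 0)"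
      using assms split[of k] by (auto simp: sum.delta)
    finally show ?thesis .
  qed
  have "?lk (\<Sum>m<dx + dy. entry F m j * entry H i m) w = (\<Sum>m<dx + dy. \<Sum>k\<le>N.
      (if m + ?d (take k l) = j then ?lk F (m, ?A m (rev (take k l))) else 0)
        * (if i + ?d (drop k l) = m then ?lk H (i, ?A i (rev (drop k l))) else 0))"
    by (simp only: lookup_sum lookup_gword_times lookup_entry l_def N_def gword.sel)
  also have "\<dots> = (\<Sum>k\<le>N. if i + ?d l = j then h k else 0)"
    by (rule trans[OF sum.swap]) (simp only: inner)
  \<comment> \<open>Cuts of the word count from its left end, cuts of the path from its start;
    because of the reversal they correspond under \<open>k\<close> to \<open>N - k\<close>.\<close>
  also have "\<dots> = (if i + ?d l = j then \<Sum>k\<le>N. h (N - k) else 0)"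
  proof -
    have "(\<Sum>k\<le>N. h k) = (\<Sum>k\<le>N. h (N - k))"
      by (rule sum.reindex_bij_witness[of _ "\<lambda>k. N - k" "\<lambda>k. N - k"]) auto
    thus ?thesis by simp
  qed
  also have "(\<Sum>k\<le>N. h (N - k)) = ?lk (path_mult (quiver_S dx dy) F H) (i, ?A i (rev l))"
    unfolding lookup_path_mult
  proof (rule sum.cong)
    fix k assume "k \<in> {..length (?A i (rev l))}"
    hence k: "k \<le> N" by (simp add: N_def)
    have drop: "rev (drop (N - k) l) = take k (rev l)" and take: "rev (take (N - k) l) = drop k (rev l)"
      using k by (simp_all add: rev_drop rev_take N_def)
    have "?d (drop (N - k) l) = ?d (rev (drop (N - k) l))" by (simp add: sum_list_map_rev)
    hence deg: "?d (drop (N - k) l) = ?d (take k (rev l))" by (simp only: drop)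
    show "h (N - k) = ?lk F (pre_digraph.awlast (quiver_S dx dy) i (take k (?A i (rev l))), drop k (?A i (rev l)))
        * ?lk H (i, take k (?A i (rev l)))"
      by (simp only: h_def drop take deg take_arrows_from drop_arrows_from awlast_arrows_from)
  qed (simp add: N_def)
  finally show "?lk (entry (path_mult (quiver_S dx dy) F H) i j) w = ?lk (\<Sum>m<dx + dy. entry F m j * entry H i m) w"
    by (simp add: lookup_entry l_def)
qed

definition to_beilinson :: "((nat \<times> (nat \<times> gen) list) \<Rightarrow>\<^sub>0 'k) \<Rightarrow> nat \<Rightarrow> nat \<Rightarrow> (gword \<Rightarrow>\<^sub>0 'k) set" where
  "to_beilinson F = (\<lambda>i j. if i < dx + dy \<and> j < dx + dy then cls (entry F i j) else \<zero>\<^bsub>S\<^esub>)"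

text \<open>\<open>low\<close> yields injectivity: the entry from \<open>i\<close> to
  \<open>j\<close> has degree \<open>j - i\<close>, which is below \<open>dx + dy\<close>, and there
  elements of the ideal have no coefficients. Surjectivity only needs homogeneous representatives of
  the entries.\<close>

lemma to_beilinson_iso:
  assumes low: "\<And>F w. F \<in> rel \<Longrightarrow> word_deg dx dy w < dx + dy \<Longrightarrow> Poly_Mapping.lookup F w = 0"
  shows "algebra_iso_map (path_algebra (quiver_S dx dy)) (beilinson S (dx + dy)) to_beilinson"
proof -
  let ?P = "path_algebra (quiver_S dx dy) :: ('k, _) module" and ?B = "beilinson S (dx + dy)"
  let ?lk = "Poly_Mapping.lookup" and ?A = "arrows_from dx dy"
  have into: "to_beilinson F \<in> carrier ?B" for F
    using entry_hcomp by (auto simp: beilinson_def to_beilinson_def hcomp_S)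
  have "inj_on to_beilinson (carrier ?P)"
  proof (rule inj_onI)
    fix F H assume FH: "F \<in> carrier ?P" "H \<in> carrier ?P" "to_beilinson F = to_beilinson H"
    show "F = H"
    proof (rule poly_mapping_eqI)
      fix x :: "nat \<times> (nat \<times> gen) list"
      obtain i p where x: "x = (i, p)" by (cases x)
      show "?lk F x = ?lk H x"
      proof (cases "x \<in> paths (quiver_S dx dy)")
        case True
        define w where "w = Word (rev (map snd p))"
        define j where "j = i + word_deg dx dy w"
        have p: "p = ?A i (rev (letters w))" and j: "j < dx + dy"
          using True unfolding x paths_quiver_S by (simp_all add: w_def j_def sum_list_map_rev)
        have "i < dx + dy" using j by (simp add: j_def)
        hence "cls (entry F i j) = cls (entry H i j)"
          using fun_cong[OF fun_cong[OF FH(3), of i], of j] j by (simp add: to_beilinson_def)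
        hence "entry F i j - entry H i j \<in> rel" by (simp add: cls_eq_iff)
        from low[OF this, of w] have "?lk (entry F i j) w = ?lk (entry H i j) w"
          using j by (simp add: j_def lookup_minus)
        thus ?thesis by (simp add: lookup_entry j_def x flip: p)
      next
        case False
        thus ?thesis using FH unfolding x by (auto simp: keys_subset_iff)
      qed
    qed
  qed
  moreover have "to_beilinson ` carrier ?P = carrier ?B"
  proof
    show "to_beilinson ` carrier ?P \<subseteq> carrier ?B" using into by blast
    show "carrier ?B \<subseteq> to_beilinson ` carrier ?P"
    proof
      fix a assume a: "a \<in> carrier ?B"
      have "\<exists>A. A \<in> hcomp free (int j - int i) \<and> a i j = cls A" if "i < dx + dy" "j < dx + dy" for i j
      proof -
        have "a i j \<in> hcomp S (int j - int i)" using a that by (auto simp: beilinson_def)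
        thus ?thesis unfolding hcomp_S by blast
      qed
      then obtain A where A: "\<And>i j. i < dx + dy \<Longrightarrow> j < dx + dy \<Longrightarrow> A i j \<in> hcomp free (int j - int i)"
        "\<And>i j. i < dx + dy \<Longrightarrow> j < dx + dy \<Longrightarrow> a i j = cls (A i j)" by metis
      \<comment> \<open>The preimage gives each path the coefficient of its reversed word in the
        representative chosen for its source and endpoint.\<close>
      define h where "h = (\<lambda>(i, p). if (i, p) \<in> paths (quiver_S dx dy)
        then ?lk (A i (i + sum_list (map (gen_deg dx dy) (map snd p)))) (Word (rev (map snd p))) else 0)"
      let ?K = "\<Union>i<dx + dy. \<Union>j<dx + dy. (\<lambda>w. (i, ?A i (rev (letters w)))) ` Poly_Mapping.keys (A i j)"
      have "h x = 0" if "x \<notin> ?K" for x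
      proof (rule ccontr)
        obtain i p where x: "x = (i, p)" by (cases x)
        define w where "w = Word (rev (map snd p))"
        define j where "j = i + sum_list (map (gen_deg dx dy) (map snd p))"
        assume "h x \<noteq> 0"
        hence path: "(i, p) \<in> paths (quiver_S dx dy)" and w: "w \<in> Poly_Mapping.keys (A i j)"
          by (auto simp: x h_def w_def j_def in_keys_iff split: if_splits)
        have p: "p = ?A i (rev (letters w))" and j: "j < dx + dy"
          using path unfolding paths_quiver_S by (simp_all add: w_def j_def)
        have i: "i < dx + dy" using j by (simp add: j_def)
        have "x \<in> ?K"
          unfolding x using i j imageI[OF w, of "\<lambda>w. (i, ?A i (rev (letters w)))"] by (subst p) blast
        thus False using that by contradiction
      qed
      hence lk: "?lk (Abs_poly_mapping h) = h"
        by (intro lookup_Abs_restricted[of ?K]) auto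
      have "to_beilinson (Abs_poly_mapping h) i j = a i j" for i j
      proof (cases "i < dx + dy \<and> j < dx + dy")
        case True
        have "entry (Abs_poly_mapping h) i j = A i j"
        proof (rule poly_mapping_eqI)
          fix w
          show "?lk (entry (Abs_poly_mapping h) i j) w = ?lk (A i j) w"
          proof (cases "i + word_deg dx dy w = j")
            case deg: True
            hence "(i, ?A i (rev (letters w))) \<in> paths (quiver_S dx dy)"
              using True by (simp add: paths_quiver_S sum_list_map_rev)
            thus ?thesis using deg by (simp add: lookup_entry lk, simp add: h_def sum_list_map_rev)
          next
            case False
            hence "int (word_deg dx dy w) \<noteq> int j - int i" by linarith
            thus ?thesis using A(1)[of i j] True False by (simp add: lookup_entry hcomp_free_algebra)
          qed
        qed
        thus ?thesis using True A(2)[of i j] by (simp add: to_beilinson_def)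
      next
        case False
        hence "a i j = \<zero>\<^bsub>S\<^esub>" using a by (auto simp: beilinson_def split: if_splits)
        thus ?thesis using False by (auto simp: to_beilinson_def)
      qed
      moreover have "Abs_poly_mapping h \<in> carrier ?P"
        unfolding path_algebra_sel mem_Collect_eq keys_subset_iff lk by (simp add: h_def split_paired_all)
      ultimately show "a \<in> to_beilinson ` carrier ?P" by (metis ext image_eqI)
    qed
  qed
  moreover have "to_beilinson \<one>\<^bsub>?P\<^esub> = \<one>\<^bsub>?B\<^esub>"
  proof -
    have "entry \<one>\<^bsub>?P\<^esub> i j = (if i = j then 1 else 0)" if "i < dx + dy" for i j
    proof (rule poly_mapping_eqI)
      fix w
      have "?A i (rev (letters w)) = [] \<longleftrightarrow> w = 0" by (metis length_0_conv length_arrows_from length_rev letters_Nil_iff(1))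
      thus "?lk (entry \<one>\<^bsub>?P\<^esub> i j) w = ?lk (if i = j then 1 else 0) w"
        using that unfolding lookup_entry
        by (subst lookup_path_one) (auto simp: lookup_one when_def)
    qed
    thus ?thesis by (auto simp: to_beilinson_def beilinson_def fun_eq_iff zero_S one_S simp del: path_algebra_sel)
  qed
  moreover have "to_beilinson (F \<otimes>\<^bsub>?P\<^esub> H) = to_beilinson F \<otimes>\<^bsub>?B\<^esub> to_beilinson H" for F H
  proof (intro ext)
    fix i j
    show "to_beilinson (F \<otimes>\<^bsub>?P\<^esub> H) i j = (to_beilinson F \<otimes>\<^bsub>?B\<^esub> to_beilinson H) i j"
    proof (cases "i < dx + dy \<and> j < dx + dy")
      case True
      interpret S: abelian_monoid S by (rule abelian_monoid_S)
      have "(\<Oplus>\<^bsub>S\<^esub>k\<in>{..<dx + dy}. to_beilinson F k j \<otimes>\<^bsub>S\<^esub> to_beilinson H i k)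
        = (\<Oplus>\<^bsub>S\<^esub>k\<in>{..<dx + dy}. cls (entry F k j * entry H i k))"
        using True by (intro S.finsum_cong') (auto simp: to_beilinson_def cls_mult)
      thus ?thesis using True by (simp add: beilinson_def finsum_S entry_mult) (simp add: to_beilinson_def entry_mult)
    qed (auto simp: to_beilinson_def beilinson_def)
  qed
  moreover have "to_beilinson (F \<oplus>\<^bsub>?P\<^esub> H) = to_beilinson F \<oplus>\<^bsub>?B\<^esub> to_beilinson H" for F H
    by (auto simp: to_beilinson_def beilinson_def fun_eq_iff entry_add cls_add zero_S)
  moreover have "to_beilinson (c \<odot>\<^bsub>?P\<^esub> F) = c \<odot>\<^bsub>?B\<^esub> to_beilinson F" for c F
    by (auto simp: to_beilinson_def beilinson_def fun_eq_iff entry_scale cls_scale zero_S)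
  ultimately show ?thesis by (simp add: algebra_iso_map_def bij_betw_def)
qed

lemma to_beilinson_zero: "to_beilinson 0 = \<zero>\<^bsub>beilinson S (dx + dy)\<^esub>"
proof -
  have "entry 0 i j = 0" for i j by (rule poly_mapping_eqI) (simp add: lookup_entry)
  thus ?thesis by (auto simp: to_beilinson_def beilinson_def fun_eq_iff zero_S)
qed

lemma abelian_monoid_beilinson: "abelian_monoid (beilinson S l)"
proof -
  interpret S: abelian_monoid S by (rule abelian_monoid_S)
  have hcomp: "x \<in> carrier S" if "x \<in> hcomp S n" for x n using that by (auto simp: hcomp_S)
  have add: "x \<oplus>\<^bsub>S\<^esub> y \<in> hcomp S n" if xy: "x \<in> hcomp S n" "y \<in> hcomp S n" for x y n
  proof -
    obtain F H where "F \<in> hcomp free n" "H \<in> hcomp free n" "x = cls F" "y = cls H" using xy by (auto simp: hcomp_S)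
    thus ?thesis by (auto simp: hcomp_S cls_add intro: hcomp_free_add)
  qed
  have zero: "\<zero>\<^bsub>S\<^esub> \<in> hcomp S n" for n using zero_in_hcomp by (simp add: zero_S)
  have entries: "a i j \<in> carrier S" if "a \<in> carrier (beilinson S l)" for a i j
    using that hcomp by (auto simp: beilinson_def split: if_splits)
      (metis S.zero_closed hcomp)
  show ?thesis
  proof (rule abelian_monoidI)
    fix x y assume "x \<in> carrier (beilinson S l)" "y \<in> carrier (beilinson S l)"
    thus "x \<oplus>\<^bsub>beilinson S l\<^esub> y \<in> carrier (beilinson S l)" by (simp add: beilinson_def add)
  qed (use entries in \<open>simp_all add: beilinson_def zero fun_eq_iff S.a_ac\<close>)
qed

section \<open>The diagonal action of \<open>g\<close> on classes and on paths\<close>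

definition word_scaling :: "'k \<Rightarrow> (gword \<Rightarrow>\<^sub>0 'k) \<Rightarrow> gword \<Rightarrow>\<^sub>0 'k" where
  "word_scaling \<xi> F = Poly_Mapping.mapp (\<lambda>w c. \<xi> powi sum_list (map gen_weight (letters w)) * c) F"

lemma lookup_word_scaling:
  "Poly_Mapping.lookup (word_scaling \<xi> F) w = \<xi> powi sum_list (map gen_weight (letters w)) * Poly_Mapping.lookup F w"
  by (auto simp: word_scaling_def lookup_mapp when_def in_keys_iff)

text \<open>Multiplicativity extends the values from the generators to monomials by induction on the
  length, and linearity extends them to all classes.\<close>

lemma diagonal_automorphism_cls:
  assumes g: "g \<in> gr_automorphisms S" and \<xi>: "\<xi> \<noteq> 0"
    and gx: "g (gen_class dx dy f Gx) = \<xi> \<odot>\<^bsub>S\<^esub> gen_class dx dy f Gx"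
    and gy: "g (gen_class dx dy f Gy) = inverse \<xi> \<odot>\<^bsub>S\<^esub> gen_class dx dy f Gy"
  shows "g (cls F) = cls (word_scaling \<xi> F)"
proof -
  have hom: "g \<in> ring_hom S S" and smult: "\<And>c X. X \<in> carrier S \<Longrightarrow> g (c \<odot>\<^bsub>S\<^esub> X) = c \<odot>\<^bsub>S\<^esub> g X"
    and closed: "\<And>X. X \<in> carrier S \<Longrightarrow> g X \<in> carrier S"
    using g ring_hom_closed[of g S S] by (auto simp: gr_automorphisms_def)
  have gen: "g (cls (Poly_Mapping.single (Word [s]) 1)) = \<xi> powi gen_weight s \<odot>\<^bsub>S\<^esub> cls (Poly_Mapping.single (Word [s]) 1)" for s
    using gx gy by (cases s) (simp_all add: gen_class_def cls_def gen_weight_def power_int_minus)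
  have monomial: "g (cls (Poly_Mapping.single (Word l) 1))
      = cls (Poly_Mapping.single (Word l) (\<xi> powi sum_list (map gen_weight l)))" for l
  proof (induction l)
    case Nil
    have "Poly_Mapping.single (Word []) 1 = (1 :: gword \<Rightarrow>\<^sub>0 'k)" by (simp flip: zero_gword_def)
    thus ?case using ring_hom_one[OF hom] by (simp add: one_S)
  next
    case (Cons s l)
    have "Word (s # l) = Word [s] + Word l" by (simp add: plus_gword_def)
    hence split: "Poly_Mapping.single (Word (s # l)) (a * b) = Poly_Mapping.single (Word [s]) a * Poly_Mapping.single (Word l) b"
      for a b :: 'k by (simp add: mult_single)
    have scale: "Poly_Mapping.map ((*) c) (Poly_Mapping.single w 1) = Poly_Mapping.single w c" for c :: 'k and w :: gword
      by (rule poly_mapping_eqI) (simp add: lookup_single when_def)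
    have "g (cls (Poly_Mapping.single (Word (s # l)) 1))
      = g (cls (Poly_Mapping.single (Word [s]) 1) \<otimes>\<^bsub>S\<^esub> cls (Poly_Mapping.single (Word l) 1))"
      using split[of 1 1] by (simp add: cls_mult)
    also have "\<dots> = g (cls (Poly_Mapping.single (Word [s]) 1)) \<otimes>\<^bsub>S\<^esub> g (cls (Poly_Mapping.single (Word l) 1))"
      by (intro ring_hom_mult[OF hom]) simp_all
    also have "\<dots> = cls (Poly_Mapping.single (Word (s # l)) (\<xi> powi gen_weight s * \<xi> powi sum_list (map gen_weight l)))"
      unfolding gen Cons.IH split by (simp add: cls_simps scale)
    finally show ?case using \<xi> by (simp add: power_int_add)
  qed
  show ?thesis
  proof (rule additive_eqI_singles[of "\<lambda>F. g (cls F)"])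
    have "cls 0 = 0 \<odot>\<^bsub>S\<^esub> cls 0" by (simp add: cls_scale)
    moreover have "0 \<odot>\<^bsub>S\<^esub> X = cls 0" if "X \<in> carrier S" for X using that by (auto simp: carrier_S cls_scale)
    ultimately have "g (cls 0) = cls 0" using smult[of "cls 0" 0] closed[of "cls 0"] by simp
    moreover have "word_scaling \<xi> 0 = 0" by (rule poly_mapping_eqI) (simp add: lookup_word_scaling)
    ultimately show "g (cls 0) = cls (word_scaling \<xi> 0)" by simp
  next
    fix F H assume "g (cls F) = cls (word_scaling \<xi> F)" "g (cls H) = cls (word_scaling \<xi> H)"
    moreover have "word_scaling \<xi> (F + H) = word_scaling \<xi> F + word_scaling \<xi> H"
      by (rule poly_mapping_eqI) (simp add: lookup_word_scaling lookup_add ring_distribs)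
    ultimately show "g (cls (F + H)) = cls (word_scaling \<xi> (F + H))"
      using ring_hom_add[OF hom, of "cls F" "cls H"] by (simp add: cls_add)
  next
    fix w and c :: 'k
    obtain l where w: "w = Word l" by (cases w)
    have "Poly_Mapping.single w c = Poly_Mapping.map ((*) c) (Poly_Mapping.single (Word l) 1)"
      by (rule poly_mapping_eqI) (simp add: lookup_single when_def w)
    hence "cls (Poly_Mapping.single w c) = c \<odot>\<^bsub>S\<^esub> cls (Poly_Mapping.single (Word l) 1)" by (simp only: cls_scale)
    hence "g (cls (Poly_Mapping.single w c)) = c \<odot>\<^bsub>S\<^esub> cls (Poly_Mapping.single (Word l) (\<xi> powi sum_list (map gen_weight l)))"
      using smult[of "cls (Poly_Mapping.single (Word l) 1)" c] by (simp only: monomial cls_in)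
    also have "\<dots> = cls (word_scaling \<xi> (Poly_Mapping.single w c))"
      unfolding cls_scale by (intro arg_cong[of _ _ cls] poly_mapping_eqI) (auto simp: lookup_word_scaling lookup_single when_def w)
    finally show "g (cls (Poly_Mapping.single w c)) = cls (word_scaling \<xi> (Poly_Mapping.single w c))" .
  qed
qed

lemma entry_arrow_scaling:
  assumes "\<xi> \<noteq> 0"
  shows "entry (arrow_scaling \<xi> F) i j = word_scaling \<xi> (entry F i j)"
proof (rule poly_mapping_eqI)
  fix w
  have "sum_list (map (\<lambda>e. gen_weight (snd e)) (arrows_from dx dy i (rev (letters w))))
      = sum_list (map gen_weight (map snd (arrows_from dx dy i (rev (letters w)))))"
    by (simp add: o_def del: map_snd_arrows_from)
  also have "\<dots> = sum_list (map gen_weight (letters w))" by (simp add: sum_list_map_rev)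
  finally show "Poly_Mapping.lookup (entry (arrow_scaling \<xi> F) i j) w = Poly_Mapping.lookup (word_scaling \<xi> (entry F i j)) w"
    by (simp add: lookup_entry lookup_word_scaling lookup_arrow_scaling[OF assms])
qed

lemma to_beilinson_arrow_scaling:
  assumes g: "\<And>F. g (cls F) = cls (word_scaling \<xi> F)" and \<xi>: "\<xi> \<noteq> 0"
  shows "to_beilinson ((arrow_scaling \<xi> ^^ m) F) = entrywise (g ^^ m) (to_beilinson F)"
proof (induction m)
  case (Suc m)
  have "g \<zero>\<^bsub>S\<^esub> = \<zero>\<^bsub>S\<^esub>"
  proof -
    have "word_scaling \<xi> 0 = 0" by (rule poly_mapping_eqI) (simp add: lookup_word_scaling)
    thus ?thesis by (simp add: zero_S g)
  qed
  hence "to_beilinson (arrow_scaling \<xi> H) = entrywise g (to_beilinson H)" for H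
    by (auto simp: to_beilinson_def entrywise_def fun_eq_iff entry_arrow_scaling[OF \<xi>] g)
  thus ?case using Suc by (simp add: entrywise_def)
qed (simp add: entrywise_def)

section \<open>The cyclic group\<close>

lemma BijGroup_mult: "\<sigma> \<in> Bij A \<Longrightarrow> \<rho> \<in> Bij A \<Longrightarrow> \<sigma> \<otimes>\<^bsub>BijGroup A\<^esub> \<rho> = compose A \<sigma> \<rho>"
  by (simp add: BijGroup_def)

lemma hcomp_in_carrier: "X \<in> hcomp S n \<Longrightarrow> X \<in> carrier S"
  by (auto simp: hcomp_S)

lemma id_gr_automorphism: "\<one>\<^bsub>BijGroup (carrier S)\<^esub> \<in> gr_automorphisms S"
proof -
  have "a \<otimes>\<^bsub>S\<^esub> b \<in> carrier S \<and> a \<oplus>\<^bsub>S\<^esub> b \<in> carrier S \<and> c \<odot>\<^bsub>S\<^esub> a \<in> carrier S"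
    if "a \<in> carrier S" "b \<in> carrier S" for a b c
    using that by (auto simp: carrier_S cls_simps)
  thus ?thesis
    using id_Bij[of "carrier S"] by (auto simp: BijGroup_def gr_automorphisms_def ring_hom_def one_S hcomp_in_carrier)
qed

lemma compose_gr_automorphism:
  assumes "\<sigma> \<in> gr_automorphisms S" "\<rho> \<in> gr_automorphisms S"
  shows "\<sigma> \<otimes>\<^bsub>BijGroup (carrier S)\<^esub> \<rho> \<in> gr_automorphisms S"
proof -
  have cl: "a \<otimes>\<^bsub>S\<^esub> b \<in> carrier S \<and> a \<oplus>\<^bsub>S\<^esub> b \<in> carrier S \<and> c \<odot>\<^bsub>S\<^esub> a \<in> carrier S"
    if "a \<in> carrier S" "b \<in> carrier S" for a b c
    using that by (auto simp: carrier_S cls_simps)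
  have B: "\<sigma> \<in> Bij (carrier S)" "\<rho> \<in> Bij (carrier S)" using assms by (auto simp: gr_automorphisms_def)
  have "\<sigma> \<otimes>\<^bsub>BijGroup (carrier S)\<^esub> \<rho> = compose (carrier S) \<sigma> \<rho>" using B by (rule BijGroup_mult)
  moreover have "compose (carrier S) \<sigma> \<rho> \<in> gr_automorphisms S"
    unfolding gr_automorphisms_def mem_Collect_eq
  proof (intro conjI)
    show "compose (carrier S) \<sigma> \<rho> \<in> Bij (carrier S)" using B by (rule compose_Bij)
    show "compose (carrier S) \<sigma> \<rho> \<in> ring_hom S S"
      using assms cl by (auto simp: gr_automorphisms_def ring_hom_def compose_def one_S Pi_iff)
    show "\<forall>c. \<forall>a\<in>carrier S. compose (carrier S) \<sigma> \<rho> (c \<odot>\<^bsub>S\<^esub> a) = c \<odot>\<^bsub>S\<^esub> compose (carrier S) \<sigma> \<rho> a"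
      using assms cl by (auto simp: gr_automorphisms_def ring_hom_def compose_def Pi_iff)
    show "\<forall>n. compose (carrier S) \<sigma> \<rho> ` hcomp S n \<subseteq> hcomp S n"
      using assms by (fastforce simp: gr_automorphisms_def compose_def hcomp_in_carrier)
  qed
  ultimately show ?thesis by simp
qed

text \<open>All computations take place in \<open>BijGroup\<close>, which is known to be a group.
  Since the \<open>r\<close>-th power of \<open>g\<close> is the identity, inverses are powers, and
  the generated subgroup consists of the powers with natural exponents.\<close>

lemma cyclic_generated_group:
  assumes g: "g \<in> gr_automorphisms S" and pow: "\<And>X. X \<in> carrier S \<Longrightarrow> (g ^^ r) X = X" and r: "0 < r"
    and G: "G = (GrAut S)\<lparr>carrier := generate (GrAut S) {g}\<rparr>" and card: "card (carrier G) = r"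
  shows "cyclic_group_of_order G g r"
    and "\<And>m X. X \<in> carrier S \<Longrightarrow> (g [^]\<^bsub>G\<^esub> (m::nat)) X = (g ^^ m) X"
proof -
  let ?B = "BijGroup (carrier S)"
  interpret B: group ?B by (rule group_BijGroup)
  have mult: "mult (GrAut S) = mult ?B" and one_Gr: "one (GrAut S) = one ?B" and car: "carrier (GrAut S) = gr_automorphisms S"
    by (simp_all add: GrAut_def)
  have gB: "g \<in> carrier ?B" using g by (simp add: gr_automorphisms_def BijGroup_def)
  have in_gr: "g [^]\<^bsub>?B\<^esub> m \<in> gr_automorphisms S" for m :: nat
    by (induction m) (auto intro: id_gr_automorphism compose_gr_automorphism g)
  have app: "(g [^]\<^bsub>?B\<^esub> m) X = (g ^^ m) X" if "X \<in> carrier S" for m :: nat and X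
    using that
  proof (induction m arbitrary: X)
    case 0
    thus ?case by (simp add: BijGroup_def)
  next
    case (Suc m)
    have Bij: "g [^]\<^bsub>?B\<^esub> m \<in> Bij (carrier S)" "g \<in> Bij (carrier S)"
      using in_gr[of m] g by (simp_all add: gr_automorphisms_def)
    have gX: "g X \<in> carrier S" by (rule funcset_mem[OF Bij_imp_funcset[OF Bij(2)] Suc.prems])
    have "g [^]\<^bsub>?B\<^esub> m \<otimes>\<^bsub>?B\<^esub> g = compose (carrier S) (g [^]\<^bsub>?B\<^esub> m) g"
      by (rule BijGroup_mult[OF Bij])
    hence "(g [^]\<^bsub>?B\<^esub> Suc m) X = (g [^]\<^bsub>?B\<^esub> m) (g X)"
      using Suc.prems by (simp add: compose_eq)
    also have "\<dots> = (g ^^ m) (g X)" by (rule Suc.IH[OF gX])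
    finally show ?case by (simp only: funpow_Suc_right o_apply)
  qed
  have pow_r: "g [^]\<^bsub>?B\<^esub> r = \<one>\<^bsub>?B\<^esub>"
  proof (rule extensionalityI)
    show "g [^]\<^bsub>?B\<^esub> r \<in> extensional (carrier S)"
      using in_gr[of r] by (auto simp: gr_automorphisms_def Bij_def)
  qed (auto simp: BijGroup_def app[unfolded BijGroup_def] pow)
  \<comment> \<open>The inverse in \<open>GrAut S\<close> is a description over graded
    automorphisms: the power \<open>r - 1\<close> provides existence among them, and uniqueness is
    inherited from \<open>BijGroup\<close>.\<close>
  have inv: "inv\<^bsub>GrAut S\<^esub> g = g [^]\<^bsub>?B\<^esub> (r - 1)"
    unfolding m_inv_def car mult one_Gr
  proof (rule the_equality)
    have "g \<otimes>\<^bsub>?B\<^esub> g [^]\<^bsub>?B\<^esub> (r - 1) = \<one>\<^bsub>?B\<^esub>" "g [^]\<^bsub>?B\<^esub> (r - 1) \<otimes>\<^bsub>?B\<^esub> g = \<one>\<^bsub>?B\<^esub>"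
      using r pow_r B.nat_pow_Suc[of g "r - 1"] B.nat_pow_Suc2[OF gB, of "r - 1"] by simp_all
    thus *: "g [^]\<^bsub>?B\<^esub> (r - 1) \<in> gr_automorphisms S \<and> g \<otimes>\<^bsub>?B\<^esub> g [^]\<^bsub>?B\<^esub> (r - 1) = \<one>\<^bsub>?B\<^esub>
        \<and> g [^]\<^bsub>?B\<^esub> (r - 1) \<otimes>\<^bsub>?B\<^esub> g = \<one>\<^bsub>?B\<^esub>"
      using in_gr by blast
    fix y assume y: "y \<in> gr_automorphisms S \<and> g \<otimes>\<^bsub>?B\<^esub> y = \<one>\<^bsub>?B\<^esub> \<and> y \<otimes>\<^bsub>?B\<^esub> g = \<one>\<^bsub>?B\<^esub>"
    hence "y \<in> carrier ?B" by (simp add: gr_automorphisms_def BijGroup_def)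
    thus "y = g [^]\<^bsub>?B\<^esub> (r - 1)"
      using y * B.inv_equality[of y g] B.inv_equality[of "g [^]\<^bsub>?B\<^esub> (r - 1)" g] gB by simp
  qed
  have "generate (GrAut S) {g} = range (\<lambda>m::nat. g [^]\<^bsub>?B\<^esub> m)"
  proof (rule equalityI; rule subsetI)
    fix h assume "h \<in> generate (GrAut S) {g}"
    thus "h \<in> range (\<lambda>m::nat. g [^]\<^bsub>?B\<^esub> m)"
    proof induction
      case one
      show ?case unfolding one_Gr by (rule range_eqI[of _ _ 0]) simp
    next
      case (incl h)
      thus ?case using gB by (intro range_eqI[of _ _ "Suc 0"]) simp
    next
      case (inv h)
      thus ?case using \<open>inv\<^bsub>GrAut S\<^esub> g = _\<close> by simp
    next
      case (eng h1 h2)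
      thus ?case using B.nat_pow_mult[OF gB] by (auto simp: mult)
    qed
  next
    fix h assume "h \<in> range (\<lambda>m::nat. g [^]\<^bsub>?B\<^esub> m)"
    then obtain m :: nat where "h = g [^]\<^bsub>?B\<^esub> m" by blast
    moreover have "g [^]\<^bsub>?B\<^esub> m \<in> generate (GrAut S) {g}"
    proof (induction m)
      case 0
      show ?case using generate.one[of "GrAut S" "{g}"] by (simp add: one_Gr)
    next
      case (Suc m)
      thus ?case using generate.eng[OF Suc generate.incl[of g]] by (simp add: mult)
    qed
    ultimately show "h \<in> generate (GrAut S) {g}" by simp
  qed
  hence G_eq: "G = ?B\<lparr>carrier := range (\<lambda>m::nat. g [^]\<^bsub>?B\<^esub> m)\<rparr>" by (simp add: G GrAut_def)
  have sub: "subgroup (range (\<lambda>m::nat. g [^]\<^bsub>?B\<^esub> m)) ?B"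
  proof (rule B.subgroupI)
    fix a assume "a \<in> range (\<lambda>m::nat. g [^]\<^bsub>?B\<^esub> m)"
    then obtain m :: nat where a: "a = g [^]\<^bsub>?B\<^esub> m" by blast
    have "g [^]\<^bsub>?B\<^esub> (m * (r - 1)) \<otimes>\<^bsub>?B\<^esub> a = g [^]\<^bsub>?B\<^esub> (m * (r - 1) + m)"
      unfolding a by (rule B.nat_pow_mult[OF gB])
    also have "m * (r - 1) + m = r * m" using r by (cases r) auto
    also have "g [^]\<^bsub>?B\<^esub> (r * m) = \<one>\<^bsub>?B\<^esub>" using B.nat_pow_pow[OF gB, of r m] pow_r by simp
    finally have "inv\<^bsub>?B\<^esub> a = g [^]\<^bsub>?B\<^esub> (m * (r - 1))" using gB a by (intro B.inv_equality) auto
    thus "inv\<^bsub>?B\<^esub> a \<in> range (\<lambda>m::nat. g [^]\<^bsub>?B\<^esub> m)" by blast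
  qed (use gB B.nat_pow_mult[OF gB] in auto)
  have nat_pow: "g [^]\<^bsub>G\<^esub> m = g [^]\<^bsub>?B\<^esub> m" for m :: nat
    unfolding G_eq by (rule B.nat_pow_consistent[symmetric])
  show "cyclic_group_of_order G g r"
  proof (intro cyclic_group_of_order.intro cyclic_group_of_order_axioms.intro)
    show "group G" unfolding G_eq by (rule subgroup.subgroup_is_group[OF sub B.group_axioms])
    have "carrier G = range (\<lambda>n::nat. g [^]\<^bsub>?B\<^esub> n)" by (simp add: G_eq)
    also have "\<dots> = range (\<lambda>n::nat. g [^]\<^bsub>G\<^esub> n)"
      by (rule arg_cong[where f = range], rule ext, rule nat_pow[symmetric])
    finally show "carrier G = range (\<lambda>n::nat. g [^]\<^bsub>G\<^esub> n)" .
    show "g \<in> carrier G" using gB range_eqI[of g "\<lambda>m::nat. g [^]\<^bsub>?B\<^esub> m" "Suc 0"] by (simp add: G_eq)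
    show "g [^]\<^bsub>G\<^esub> r = \<one>\<^bsub>G\<^esub>" unfolding nat_pow pow_r by (simp add: G_eq)
  qed (fact card r)+
  show "\<And>m X. X \<in> carrier S \<Longrightarrow> (g [^]\<^bsub>G\<^esub> (m::nat)) X = (g ^^ m) X"
    unfolding nat_pow by (rule app)
qed

end

text \<open>The weights 1 and -1 turn the tail sheet \<open>j - wt e\<close> into
  \<open>j - 1\<close> for \<open>x\<close> and \<open>j + 1\<close> for \<open>y\<close>.\<close>

lemma quiver_SG_eq_covering:
  "quiver_SG dx dy r = covering_quiver (quiver_S dx dy) (\<lambda>e. gen_weight (snd e)) r"
  by (auto simp: quiver_SG_def covering_quiver_def quiver_S_def gen_weight_def fun_eq_iff split: gen.split)

theorem theorem4p8:
  fixes dx dy r :: nat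
    and f :: "gword \<Rightarrow>\<^sub>0 'k::{alg_closed_field, field_char_0}"
    and \<xi> :: 'k
    and S :: "('k, (gword \<Rightarrow>\<^sub>0 'k) set) graded_algebra"
    and g :: "(gword \<Rightarrow>\<^sub>0 'k) set \<Rightarrow> (gword \<Rightarrow>\<^sub>0 'k) set"
    and G :: "((gword \<Rightarrow>\<^sub>0 'k) set \<Rightarrow> (gword \<Rightarrow>\<^sub>0 'k) set) monoid"
    and nablaSG kQSG
  assumes "0 < dx" and "0 < dy" and "coprime dx dy"
    and "\<exists>n. f \<in> hcomp (free_algebra dx dy :: ('k, gword \<Rightarrow>\<^sub>0 'k) graded_algebra) n"
    and "S = one_relator_algebra dx dy f"
    and "noetherian S"
    and "AS_regular S 2 (int (dx + dy))"
    and "g \<in> gr_automorphisms S"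
    and "g (gen_class dx dy f Gx) = \<xi> \<odot>\<^bsub>S\<^esub> gen_class dx dy f Gx"
    and "g (gen_class dx dy f Gy) = inverse \<xi> \<odot>\<^bsub>S\<^esub> gen_class dx dy f Gy"
    and "0 < r" and "\<xi> ^ r = 1" and "\<forall>m. 0 < m \<and> m < r \<longrightarrow> \<xi> ^ m \<noteq> 1"
    and "G = (GrAut S)\<lparr>carrier := generate (GrAut S) {g}\<rparr>"
    and "carrier G \<subseteq> HSL S 2 (int (dx + dy))"
    and "finite (carrier G)" and "card (carrier G) = r"
    and "nablaSG = skew_group_algebra (beilinson S (dx + dy)) G entrywise"
    and "kQSG = skew_group_algebra
                  (path_algebra (quiver_S dx dy) :: ('k, (nat \<times> (nat \<times> gen) list) \<Rightarrow>\<^sub>0 'k) module)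
                  G (cyclic_action G g (arrow_scaling \<xi>))"
  shows "nablaSG \<cong>\<^sub>a\<^sub>l\<^sub>g kQSG
    \<and> kQSG \<cong>\<^sub>a\<^sub>l\<^sub>g (path_algebra (quiver_SG dx dy r)
               :: ('k, ((nat \<times> int) \<times> ((nat \<times> gen) \<times> int) list) \<Rightarrow>\<^sub>0 'k) module)
    \<and> (\<forall>Q :: ('v, 'e) pre_digraph. fin_digraph Q
         \<and> kQSG \<cong>\<^sub>a\<^sub>l\<^sub>g (path_algebra Q :: ('k, ('v \<times> 'e list) \<Rightarrow>\<^sub>0 'k) module)
         \<longrightarrow> digraph_iso Q (quiver_SG dx dy r))"
proof -
  let ?\<tau> = "arrow_scaling \<xi>" and ?Q = "quiver_S dx dy"
  let ?kQ = "path_algebra ?Q :: ('k, (nat \<times> (nat \<times> gen) list) \<Rightarrow>\<^sub>0 'k) module"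
  let ?act = "cyclic_action G g ?\<tau>"
  let ?wt = "\<lambda>e :: nat \<times> gen. gen_weight (snd e)"
  interpret one_relator dx dy f .
  note pos = assms(1,2) and g = assms(8) and G = assms(14)[unfolded assms(5)] and S_eq = assms(5)
  have \<xi>: "primitive_root \<xi> r" using assms(11-13) by (simp add: primitive_root_def)
  note \<xi>0 = primitive_root_nonzero[OF \<xi>]
  obtain n where n: "f \<in> hcomp free n" using assms(4) by blast
  have low: "Poly_Mapping.lookup F w = 0" if F: "F \<in> rel" and w: "word_deg dx dy w < dx + dy" for F w
  proof (cases "f = 0")
    case True
    \<comment> \<open>Zero is homogeneous of every degree, so the bound applies with degree
      \<open>dx + dy\<close>.\<close>
    show ?thesis using rel_low_degree[of "int (dx + dy)", OF _ F] w by (simp add: True hcomp_free_algebra)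
  next
    case False
    have "int (dx + dy) \<le> n"
      using assms(7) unfolding S_eq AS_regular_def by (intro relation_degree[OF pos n False]) blast+
    hence "int (word_deg dx dy w) < n" using w by linarith
    thus ?thesis by (rule rel_low_degree[OF n F])
  qed
  have g_cls: "g (cls F) = cls (word_scaling \<xi> F)" for F
    using diagonal_automorphism_cls[OF g[unfolded S_eq] \<xi>0] assms(9,10) unfolding S_eq by blast
  have g_pow: "(g ^^ m) (cls F) = cls ((word_scaling \<xi> ^^ m) F)" for m F
    by (induction m) (simp_all add: g_cls)
  have lookup_pow: "Poly_Mapping.lookup ((word_scaling \<xi> ^^ m) F) w
      = (\<xi> powi sum_list (map gen_weight (letters w))) ^ m * Poly_Mapping.lookup F w" for m F w
    by (induction m) (simp_all add: lookup_word_scaling)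
  \<comment> \<open>Every monomial is scaled by a power of \<open>\<xi>\<close>, so the
    \<open>r\<close>-th iterate of \<open>g\<close> is the identity on \<open>S\<close>.\<close>
  have "(\<xi> powi a) ^ r = 1" for a
    using assms(12) by (metis power_int_1_left power_int_mult mult.commute power_int_of_nat)
  hence ws_r: "(word_scaling \<xi> ^^ r) F = F" for F by (intro poly_mapping_eqI) (simp add: lookup_pow)
  have g_r: "(g ^^ r) X = X" if X: "X \<in> carrier (one_relator_algebra dx dy f)" for X
  proof -
    obtain F where "X = cls F" using X unfolding carrier_S by blast
    thus ?thesis by (simp only: g_pow ws_r)
  qed
  note cyc = cyclic_generated_group[OF g[unfolded S_eq] g_r assms(11) G assms(17)]
  interpret cyclic_group_of_order G g r by (rule cyc(1))

  have act_pow: "?act (g [^]\<^bsub>G\<^esub> m) = ?\<tau> ^^ m" if "m < r" for m by (rule cyclic_action_pow[OF that])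
  have \<tau>_closed: "(?\<tau> ^^ m) F \<in> carrier ?kQ" if "F \<in> carrier ?kQ" for F m
    using that by (induction m) (auto simp: keys_subset_iff lookup_arrow_scaling[OF \<xi>0])
  have act_closed: "?act p F \<in> carrier ?kQ" if p: "p \<in> carrier G" and F: "F \<in> carrier ?kQ" for p F
  proof -
    obtain m where "m < r" "p = g [^]\<^bsub>G\<^esub> m" using p unfolding carrier_eq by blast
    thus ?thesis using \<tau>_closed[OF F] by (simp only: act_pow)
  qed
  have equivariant: "to_beilinson (?act p F) = entrywise p (to_beilinson F)" if p: "p \<in> carrier G" for p F
  proof -
    obtain m where m: "m < r" "p = g [^]\<^bsub>G\<^esub> m" using p unfolding carrier_eq by blast
    \<comment> \<open>Elements of \<open>G\<close> are known to agree with iterates of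
      \<open>g\<close> only on the carrier of \<open>S\<close>, so the entries have to lie
      there.\<close>
    have "to_beilinson F i j \<in> carrier (one_relator_algebra dx dy f)" for i j by (auto simp: to_beilinson_def zero_S)
    thus ?thesis
      using to_beilinson_arrow_scaling[OF g_cls \<xi>0, of m F] by (simp add: m(2) act_pow[OF m(1)] entrywise_def cyc(2))
  qed
  have scale0: "c \<odot>\<^bsub>?kQ\<^esub> \<zero>\<^bsub>?kQ\<^esub> = \<zero>\<^bsub>?kQ\<^esub>" for c by simp
  note kQ = path_algebra_abelian_monoid[of ?Q] path_algebra_closed[OF fin_digraph_quiver_S]
  have closed: "algebra_closed kQSG"
    unfolding assms(19) by (rule skew_group_algebra_closed[OF kQ(2,1) scale0 group_axioms act_closed])
  \<comment> \<open>The isomorphism is built starting from the path algebra, whose closure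
    properties are available, and is then reversed by \<open>closed\<close>.\<close>
  have "kQSG \<cong>\<^sub>a\<^sub>l\<^sub>g nablaSG"
    unfolding assms(18,19) S_eq
  proof (rule skew_group_algebra_iso[OF kQ scale0 abelian_monoid_beilinson group_axioms assms(16)])
    show "algebra_iso_map ?kQ (beilinson (one_relator_algebra dx dy f) (dx + dy)) to_beilinson"
      by (rule to_beilinson_iso[OF low])
    show "to_beilinson \<zero>\<^bsub>?kQ\<^esub> = \<zero>\<^bsub>beilinson (one_relator_algebra dx dy f) (dx + dy)\<^esub>"
      unfolding path_algebra_sel by (rule to_beilinson_zero)
  qed (rule act_closed equivariant; assumption)+
  hence iso1: "nablaSG \<cong>\<^sub>a\<^sub>l\<^sub>g kQSG" by (rule algebra_iso_sym[OF closed])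
  have iso2: "kQSG \<cong>\<^sub>a\<^sub>l\<^sub>g (path_algebra (quiver_SG dx dy r) :: ('k, _) module)"
    unfolding assms(19) quiver_SG_eq_covering
    by (rule skew_path_algebra_covering[OF fin_digraph_quiver_S cyc(1) \<xi> lookup_arrow_scaling[OF \<xi>0]])
  \<comment> \<open>Composing through \<open>kQSG\<close> gives an isomorphism of path algebras; the
    covering quiver has no loops because \<open>quiver_S\<close> has none when both degrees are
    positive.\<close>
  have "digraph_iso Q (quiver_SG dx dy r)"
    if "fin_digraph Q" "kQSG \<cong>\<^sub>a\<^sub>l\<^sub>g (path_algebra Q :: ('k, ('v \<times> 'e list) \<Rightarrow>\<^sub>0 'k) module)"
    for Q :: "('v, 'e) pre_digraph"
    using algebra_iso_trans[OF algebra_iso_sym[OF closed that(2)] iso2] that(1) pos assms(11)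
    unfolding quiver_SG_eq_covering
    by (intro path_algebra_determines_quiver) (auto intro: fin_digraph_covering loopfree_covering
        fin_digraph_quiver_S loopfree_quiver_S)
  thus ?thesis using iso1 iso2 by blast
qed

end
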